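(* Let $Y=\begin{pmatrix}A&B\\C&D\end{pmatrix}\in su(p,q)$ (blocks of sizes $p\times p$, $p\times q$, $q\times p$, $q\times q$), $z_0\in\mathbb{C}^n$, $c_0\in\mathbb{R}$, and let $X=((z_0,\bar z_0),c_0,Y)\in\mathfrak{g}$, where $\mathfrak{g}$ is the Lie algebra of $G=H_n\rtimes SU(p,q)$. Then, for each $z=(z_1,z_2)\in\mathbb{C}^p\times\mathbb{C}^q$, $$S(d\pi(X))(z)=\tfrac{\lambda}{2}\left(\overline{s(z_0)}z-\bar z s(z_0)\right)+i\lambda c_0-\mathrm{Tr}(A)-\tfrac{\lambda}{2}\left((\overline C\bar z_1)\bar z_2+(\overline Dz_2)\bar z_2+(Az_1)\bar z_1-z_1(\overline Bz_2)\right)$$ and $$W(d\pi(X))(z)=\tfrac{\lambda}{2}\left(\overline{s(z_0)}z-\bar z s(z_0)\right)+i\lambda c_0-\tfrac{\lambda}{2}\left((\overline C\bar z_1)\bar z_2+(\overline Dz_2)\bar z_2+(Az_1)\bar z_1-z_1(\overline Bz_2)\right).$$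
   Context: Let $p,q$ be positive integers, $n=p+q$, and fix $\lambda>0$. For $u,v\in\mathbb{C}^m$ write $uv=\sum_j u_jv_j$ (no conjugation) and $|u|^2=u\bar u$; matrices act on vectors in the usual way. $\overline N$ is the entrywise conjugate and $N^\star$ the conjugate transpose of a matrix $N$. $SU(p,q)$ is the group of $k\in SL(n,\mathbb{C})$ with $kJ_0k^\star=J_0$, $J_0=\begin{pmatrix}I_p&0\\0&-I_q\end{pmatrix}$, and $su(p,q)$ is its Lie algebra. Heisenberg group: $H_n=\{((z,\bar z),c):z\in\mathbb{C}^n,c\in\mathbb{R}\}$ with product $((z,\bar z),c)\cdot((z',\bar z'),c')=((z+z',\bar z+\bar z'),c+c'+\tfrac12\omega((z,\bar z),(z',\bar z')))$, where $\omega((z,w),(z',w'))=\tfrac{i}{2}(z(J_0w')-z'(J_0w))$. $SU(p,q)$ acts on $H_n$ by $k\cdot((z,\bar z),c)=((kz,\overline{kz}),c)$, and $G=H_n\rtimes SU(p,q)$ is the corresponding semidirect product, with elements $((z,\bar z),c,k)$. Its Lie algebra $\mathfrak{g}$ consists of the triples $((z_0,\bar z_0),c_0,Y)$, $z_0\in\mathbb{C}^n$, $c_0\in\mathbb{R}$, $Y\in su(p,q)$ (tangent vectors at the identity in these coordinates). For $z=(z^+,z^-)\in\mathbb{C}^p\times\mathbb{C}^q$ put $s(z)=(z^+,\overline{z^-})$. Fock space: $\mathcal{F}$ is the Hilbert space of holomorphic functions $f$ on $\mathbb{C}^n$ with $\|f\|^2=\left(\tfrac{\lambda}{2\pi}\right)^n\int_{\mathbb{C}^n}|f(z)|^2e^{-\lambda|z|^2/2}\,dm(z)<\infty$,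 $dm$ being Lebesgue measure. Put $dm_\lambda=\left(\tfrac{\lambda}{2\pi}\right)^n dm$ and $e_z(w)=\exp(\lambda\bar zw/2)$, so that $f(z)=\langle f,e_z\rangle$. For an operator $T$ on $\mathcal{F}$ (possibly an unbounded differential operator with polynomial coefficients) the kernel is $k_T(z,w)=\langle Te_w,e_z\rangle=(Te_w)(z)$, the Berezin symbol is $S(T)(z)=\langle Te_z,e_z\rangle/\langle e_z,e_z\rangle$, and the complex Weyl symbol is $$W(T)(z)=2^n\int_{\mathbb{C}^n}k_T(z+w,z-w)\exp\left(\tfrac{\lambda}{2}(-z\bar z-w\bar w+z\bar w-\bar zw)\right)dm_\lambda(w).$$ Representations: $\rho$ is the unitary representation of $H_n$ on $\mathcal{F}$ given, for $h=((z_0,\bar z_0),c_0)$, by $(\rho(h)f)(z)=e^{i\lambda c_0}\exp\lambda\left(\tfrac12\overline{s(z_0)}z-\tfrac14|z_0|^2\right)f(z-s(z_0))$. The harmonic representation $\sigma$ is the unitary representation of $SU(p,q)$ on $\mathcal{F}$ such that for $k=\begin{pmatrix}A&B\\C&D\end{pmatrix}$ the operator $\sigma(k)$ has kernel $$b_k(z,w)=(\det A)^{-1}\exp\tfrac{\lambda}{2}\left(-(\overline D^{-1}\overline C\bar w_1)\bar w_2+(\overline D^{-1}z_2)\bar w_2+(A^{-1}z_1)\bar w_1+z_1(\overline B\,\overline D^{-1}z_2)\right),$$ where $z=(z_1,z_2)$, $w=(w_1,w_2)$, $z_1,w_1\in\mathbb{C}^p$, $z_2,w_2\in\mathbb{C}^q$.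 The extended harmonic representation $\pi$ of $G$ on $\mathcal{F}$ is $\pi(h,k)=\rho(h)\sigma(k)$, and $d\pi(X)=\frac{d}{dt}\big|_{t=0}\pi(\exp(tX))$ is its differential (a differential operator with polynomial coefficients). *)

theory Defs
  imports "HOL-Analysis.Analysis"
begin

text \<open>
  Vectors in \<open>\<complex>\<^sup>p \<times> \<complex>\<^sup>q = \<complex>\<^sup>n\<close> are indexed by the sum type \<open>'p + 'q\<close>, so that
  \<open>p = CARD('p)\<close> and \<open>q = CARD('q)\<close> are arbitrary positive integers and \<open>n = p + q\<close>.
  The parameter \<open>lam\<close> is the fixed positive real number \<open>\<lambda>\<close>.
\<close>

text \<open>The bilinear product \<open>uv\<close>: no conjugation.\<close>

definition cdot :: "complex^'n \<Rightarrow> complex^'n \<Rightarrow> complex" (infixl "\<odot>" 70)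
  where "u \<odot> v = (\<Sum>j\<in>UNIV. u $ j * v $ j)"

definition vcnj :: "complex^'n \<Rightarrow> complex^'n"
  where "vcnj u = (\<chi> j. cnj (u $ j))"

definition mcnj :: "complex^'n^'m \<Rightarrow> complex^'n^'m"
  where "mcnj N = (\<chi> i j. cnj (N $ i $ j))"

definition mstar :: "complex^'n^'m \<Rightarrow> complex^'m^'n"
  where "mstar N = transpose (mcnj N)"

definition vjoin :: "complex^'p \<Rightarrow> complex^'q \<Rightarrow> complex^('p::finite + 'q::finite)"
  where "vjoin u v = (\<chi> j. case j of Inl a \<Rightarrow> u $ a | Inr b \<Rightarrow> v $ b)"

definition vfst :: "complex^('p::finite + 'q::finite) \<Rightarrow> complex^'p"
  where "vfst z = (\<chi> a. z $ Inl a)"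

definition vsnd :: "complex^('p::finite + 'q::finite) \<Rightarrow> complex^'q"
  where "vsnd z = (\<chi> b. z $ Inr b)"

definition mblock ::
  "complex^'p^'p \<Rightarrow> complex^'q^'p \<Rightarrow> complex^'p^'q \<Rightarrow> complex^'q^'q
    \<Rightarrow> complex^('p::finite + 'q::finite)^('p + 'q)"
  where "mblock A B C D = (\<chi> i. case i of Inl a \<Rightarrow> vjoin (A $ a) (B $ a)
                                        | Inr b \<Rightarrow> vjoin (C $ b) (D $ b))"

definition blockA :: "complex^('p::finite + 'q::finite)^('p + 'q) \<Rightarrow> complex^'p^'p"
  where "blockA k = (\<chi> i j. k $ Inl i $ Inl j)"

definition blockB :: "complex^('p::finite + 'q::finite)^('p + 'q) \<Rightarrow> complex^'q^'p"
  where "blockB k = (\<chi> i j. k $ Inl i $ Inr j)"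

definition blockC :: "complex^('p::finite + 'q::finite)^('p + 'q) \<Rightarrow> complex^'p^'q"
  where "blockC k = (\<chi> i j. k $ Inr i $ Inl j)"

definition blockD :: "complex^('p::finite + 'q::finite)^('p + 'q) \<Rightarrow> complex^'q^'q"
  where "blockD k = (\<chi> i j. k $ Inr i $ Inr j)"

definition smap :: "complex^('p::finite + 'q::finite) \<Rightarrow> complex^('p + 'q)"
  where "smap z = vjoin (vfst z) (vcnj (vsnd z))"

text \<open>
  A Lie group is given by its underlying set \<open>S\<close> inside a normed space of coordinates
  together with its product.  An element of the Lie algebra is the velocity at the identity of
  a one-parameter subgroup, and the exponential map evaluates this (unique) subgroup at time
  \<open>1\<close>.  For a closed matrix group the one-parameter subgroups are \<open>t \<mapsto> exp (tX)\<close>, so its Lie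
  algebra is the set of all \<open>X\<close> with \<open>exp (tX) \<in> S\<close> for all real \<open>t\<close>.
\<close>

definition one_param_subgroup ::
  "'a::real_normed_vector set \<Rightarrow> ('a \<Rightarrow> 'a \<Rightarrow> 'a) \<Rightarrow> 'a \<Rightarrow> (real \<Rightarrow> 'a) \<Rightarrow> bool"
  where "one_param_subgroup S m X \<gamma> \<longleftrightarrow>
    (\<forall>t. \<gamma> t \<in> S) \<and> (\<forall>s t. \<gamma> (s + t) = m (\<gamma> s) (\<gamma> t)) \<and>
    (\<gamma> has_vector_derivative X) (at 0)"

definition lie_algebra :: "'a::real_normed_vector set \<Rightarrow> ('a \<Rightarrow> 'a \<Rightarrow> 'a) \<Rightarrow> 'a set"
  where "lie_algebra S m = {X. \<exists>\<gamma>. one_param_subgroup S m X \<gamma>}"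

definition lie_exp ::
  "'a::real_normed_vector set \<Rightarrow> ('a \<Rightarrow> 'a \<Rightarrow> 'a) \<Rightarrow> 'a \<Rightarrow> 'a"
  where "lie_exp S m X = (THE \<gamma>. one_param_subgroup S m X \<gamma>) 1"

definition J0 :: "complex^('p::finite + 'q::finite)^('p + 'q)"
  where "J0 = mblock (mat 1) 0 0 (- mat 1)"

definition SUpq :: "(complex^('p::finite + 'q::finite)^('p + 'q)) set"
  where "SUpq = {k. det k = 1 \<and> k ** J0 ** mstar k = J0}"

definition supq :: "(complex^('p::finite + 'q::finite)^('p + 'q)) set"
  where "supq = lie_algebra SUpq (**)"

text \<open>Coordinates \<open>((z, w), c)\<close> of the Heisenberg group; its elements have \<open>w\<close> conjugate to \<open>z\<close>.\<close>

type_synonym ('p, 'q) heis = "((complex^('p + 'q)) \<times> (complex^('p + 'q))) \<times> real"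

type_synonym ('p, 'q) heis_su =
  "((complex^('p + 'q)) \<times> (complex^('p + 'q))) \<times> real \<times> (complex^('p + 'q)^('p + 'q))"

definition Heis :: "('p::finite, 'q::finite) heis set"
  where "Heis = {((z, vcnj z), c) | z c. True}"

definition omega ::
  "(complex^('p::finite + 'q::finite)) \<times> (complex^('p + 'q))
    \<Rightarrow> (complex^('p + 'q)) \<times> (complex^('p + 'q)) \<Rightarrow> complex"
  where "omega = (\<lambda>(z, w) (z', w'). \<i> / 2 * (z \<odot> (J0 *v w') - z' \<odot> (J0 *v w)))"

text \<open>On pairs \<open>(z, vcnj z)\<close> the form \<open>omega\<close> takes real values, so \<open>Re\<close> is only a coercion.\<close>

definition heis_mult ::
  "('p::finite, 'q::finite) heis \<Rightarrow> ('p, 'q) heis \<Rightarrow> ('p, 'q) heis"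
  where "heis_mult = (\<lambda>(u, c) (u', c'). (u + u', c + c' + 1/2 * Re (omega u u')))"

definition SU_act ::
  "complex^('p::finite + 'q::finite)^('p + 'q) \<Rightarrow> ('p, 'q) heis \<Rightarrow> ('p, 'q) heis"
  where "SU_act k = (\<lambda>((z, w), c). ((k *v z, vcnj (k *v z)), c))"

definition Gpq :: "('p::finite, 'q::finite) heis_su set"
  where "Gpq = {(u, c, k) | u c k. (u, c) \<in> Heis \<and> k \<in> SUpq}"

definition G_mult ::
  "('p::finite, 'q::finite) heis_su \<Rightarrow> ('p, 'q) heis_su \<Rightarrow> ('p, 'q) heis_su"
  where "G_mult = (\<lambda>(u, c, k) (u', c', k').
    case heis_mult (u, c) (SU_act k (u', c')) of (u'', c'') \<Rightarrow> (u'', c'', k ** k'))"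

definition dm :: "real \<Rightarrow> (complex^'n) measure"
  where "dm lam = density lborel (\<lambda>_. ennreal ((lam / (2 * pi)) ^ CARD('n)))"

definition gauss :: "real \<Rightarrow> complex^'n \<Rightarrow> real"
  where "gauss lam z = exp (- lam * (norm z)\<^sup>2 / 2)"

definition entire :: "(complex^'n \<Rightarrow> complex) \<Rightarrow> bool"
  where "entire f \<longleftrightarrow>
    (\<forall>z. \<exists>f'. (f has_derivative f') (at z) \<and> (\<forall>c v. f' (c *s v) = c * f' v))"

text \<open>The squared norm is an extended real, so that convergence to \<open>0\<close> includes finiteness.\<close>

definition fock_nrm2 :: "real \<Rightarrow> (complex^'n \<Rightarrow> complex) \<Rightarrow> ennreal"
  where "fock_nrm2 lam f = (\<integral>\<^sup>+ z. ennreal ((norm (f z))\<^sup>2 * gauss lam z) \<partial>dm lam)"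

definition fock :: "real \<Rightarrow> (complex^'n \<Rightarrow> complex) set"
  where "fock lam = {f. entire f \<and> fock_nrm2 lam f < \<infinity>}"

definition fock_inner :: "real \<Rightarrow> (complex^'n \<Rightarrow> complex) \<Rightarrow> (complex^'n \<Rightarrow> complex) \<Rightarrow> complex"
  where "fock_inner lam f g = (\<integral> z. f z * cnj (g z) * of_real (gauss lam z) \<partial>dm lam)"

definition coh :: "real \<Rightarrow> complex^'n \<Rightarrow> complex^'n \<Rightarrow> complex"
  where "coh lam z w = exp (of_real lam * (vcnj z \<odot> w) / 2)"

text \<open>Operators are maps on functions; the notions below only use their values on the \<open>coh lam w\<close>.\<close>

type_synonym 'n operator = "(complex^'n \<Rightarrow> complex) \<Rightarrow> complex^'n \<Rightarrow> complex"

definition kernel :: "real \<Rightarrow> 'n::finite operator \<Rightarrow> complex^'n \<Rightarrow> complex^'n \<Rightarrow> complex"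
  where "kernel lam T z w = fock_inner lam (T (coh lam w)) (coh lam z)"

definition berezin_symbol :: "real \<Rightarrow> 'n::finite operator \<Rightarrow> complex^'n \<Rightarrow> complex"
  where "berezin_symbol lam T z =
    fock_inner lam (T (coh lam z)) (coh lam z) / fock_inner lam (coh lam z) (coh lam z)"

definition weyl_symbol :: "real \<Rightarrow> 'n::finite operator \<Rightarrow> complex^'n \<Rightarrow> complex"
  where "weyl_symbol lam T z = 2 ^ CARD('n) *
    (\<integral> w. kernel lam T (z + w) (z - w) *
          exp (of_real lam / 2 *
            (- (z \<odot> vcnj z) - w \<odot> vcnj w + z \<odot> vcnj w - vcnj z \<odot> w)) \<partial>dm lam)"

definition rho :: "real \<Rightarrow> ('p::finite, 'q::finite) heis \<Rightarrow> ('p + 'q) operator"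
  where "rho lam = (\<lambda>((z0, w0), c0) f z.
    exp (\<i> * of_real lam * of_real c0) *
    exp (of_real lam * (1/2 * (vcnj (smap z0) \<odot> z) - 1/4 * of_real ((norm z0)\<^sup>2))) *
    f (z - smap z0))"

definition harm_kernel ::
  "real \<Rightarrow> complex^('p::finite + 'q::finite)^('p + 'q)
    \<Rightarrow> complex^('p + 'q) \<Rightarrow> complex^('p + 'q) \<Rightarrow> complex"
  where "harm_kernel lam k z w =
    (let A = blockA k; B = blockB k; C = blockC k; D = blockD k;
         z1 = vfst z; z2 = vsnd z; w1 = vfst w; w2 = vsnd w
     in inverse (det A) *
        exp (of_real lam / 2 *
          (- (((matrix_inv (mcnj D) ** mcnj C) *v vcnj w1) \<odot> vcnj w2)
           + (matrix_inv (mcnj D) *v z2) \<odot> vcnj w2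
           + (matrix_inv A *v z1) \<odot> vcnj w1
           + z1 \<odot> ((mcnj B ** matrix_inv (mcnj D)) *v z2))))"

text \<open>
  The operator on Fock space with kernel \<open>b\<close> (that is, \<open>\<langle>T (coh w), coh z\<rangle> = b z w\<close>) is the
  integral operator \<open>(T f) z = \<langle>f, T\<^sup>* (coh z)\<rangle>\<close>, where \<open>T\<^sup>* (coh z) w = cnj (b z w)\<close>.
\<close>

definition sigma ::
  "real \<Rightarrow> complex^('p::finite + 'q::finite)^('p + 'q) \<Rightarrow> ('p + 'q) operator"
  where "sigma lam k f z = fock_inner lam f (\<lambda>w. cnj (harm_kernel lam k z w))"

definition ext_harm :: "real \<Rightarrow> ('p::finite, 'q::finite) heis_su \<Rightarrow> ('p + 'q) operator"
  where "ext_harm lam = (\<lambda>(u, c, k) f. rho lam (u, c) (sigma lam k f))"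

text \<open>The derivative at \<open>t = 0\<close> of \<open>t \<mapsto> \<pi>(exp (tX)) f\<close> is taken in the norm of the Fock space.\<close>

definition d_ext_harm :: "real \<Rightarrow> ('p::finite, 'q::finite) heis_su \<Rightarrow> ('p + 'q) operator"
  where "d_ext_harm lam X f = (THE g. g \<in> fock lam \<and>
    ((\<lambda>t. fock_nrm2 lam (\<lambda>z.
        (ext_harm lam (lie_exp Gpq G_mult (t *\<^sub>R X)) f z - f z) / of_real t - g z))
      \<longlongrightarrow> 0) (at 0))"

end

(* The derivative of t \<mapsto> \<pi>(exp(tX)) is computed on the coherent states only, where everything is explicit.
   By the reproducing property, \<sigma>(k) maps e_w to its kernel b_k(-, w) as soon as k is close to 1, so that
   (\<pi>(exp(tX)) e_w)(z) = exp(E(t, z)) with E(t, -) a quadratic polynomial whose coefficients are differentiable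
   at t = 0 and E(0, -) linear.  Hence the difference quotients are dominated by a small Gaussian and converge
   in Fock norm, and d\<pi>(X) e_w = P(-, cnj w) e_w for a polynomial P of degree two.  The Berezin symbol is
   P(z, cnj z).  In the Weyl symbol all exponents combine to -\<lambda>|w|^2, so it is the Gaussian average of
   P(z + w, cnj z - cnj w): holomorphic and antiholomorphic terms average to their value at w = 0, and the mixed
   terms contribute (Tr (cnj D) + Tr A) / 2, which equals Tr A because Y is in su(p,q). *)

theory Submission
  imports Defs "HOL-Probability.Distributions" "HOL-Complex_Analysis.Cauchy_Integral_Formula"
begin

section \<open>Gaussian integrals and isometries\<close>

text \<open>Two definite descriptions shape the proof. \<open>lie_exp\<close> has a known value only
  once a one-parameter subgroup of \<open>Gpq\<close> with the given velocity exists and is unique;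
  its matrix component is handed over by the definition of \<open>supq\<close>, the other components
  are found by successive integration. \<open>d_ext_harm\<close> likewise requires that a limit in
  the squared Fock norm, an extended real, determines an entire function. All Gaussian integrals
  rest on the invariance of Lebesgue measure under linear isometries. Phase rotations give the mean
  value property of entire functions, a translation turns it into the reproducing property, and
  differentiating the latter gives the second moments that produce the traces. The growth rate in
  \<open>gauss_bounded\<close> records which of these integrals converge. The factor
  \<open>2 ^ CARD('n)\<close> in the Weyl symbol is exactly what turns \<open>dm lam\<close> into
  \<open>dm (2 * lam)\<close>, the measure normalised for \<open>gauss (2 * lam)\<close>.\<close>

lemma nn_integral_gaussian_real:
  fixes c :: real
  assumes "c > 0"
  shows "(\<integral>\<^sup>+x. ennreal (exp (- c * x\<^sup>2)) \<partial>lborel) = ennreal (sqrt (pi / c))"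
proof -
  \<comment> \<open>With variance \<open>1 / (2 * c)\<close> the integrand is a multiple of a normal
    density, whose total mass is 1.\<close>
  define s where "s = sqrt (1 / (2 * c))"
  have s: "s > 0" "s\<^sup>2 = 1 / (2 * c)"
    using assms by (auto simp: s_def)
  have eq: "exp (- c * x\<^sup>2) = sqrt (pi / c) * normal_density 0 s x" for x
    using assms by (simp add: normal_density_def s real_sqrt_divide)
  have "(\<integral>\<^sup>+x. ennreal (normal_density 0 s x) \<partial>lborel) = 1"
    using prob_space.emeasure_space_1[OF prob_space_normal_density[OF s(1), of 0]]
    by (simp add: emeasure_density)
  then show ?thesis
    unfolding eq using assms by (simp add: ennreal_mult' nn_integral_cmult)
qed

lemma nn_integral_gaussian:
  fixes c :: real
  assumes "c > 0"
  shows "(\<integral>\<^sup>+x. ennreal (exp (- c * (norm (x::'a::euclidean_space))\<^sup>2)) \<partial>lborel)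
    = ennreal (sqrt (pi / c) ^ DIM('a))"
proof -
  have "ennreal (exp (- c * (norm x)\<^sup>2)) = (\<Prod>b\<in>Basis. ennreal (exp (- c * (x \<bullet> b)\<^sup>2)))" for x :: 'a
  proof -
    have "(norm x)\<^sup>2 = (\<Sum>b\<in>Basis. (x \<bullet> b)\<^sup>2)"
      by (simp add: norm_eq_sqrt_inner euclidean_inner[of x x] power2_eq_square sum_nonneg)
    then show ?thesis
      by (simp only: sum_distrib_left exp_sum[OF finite_Basis]) (simp add: prod_ennreal)
  qed
  then have "(\<integral>\<^sup>+x. ennreal (exp (- c * (norm (x::'a))\<^sup>2)) \<partial>lborel)
      = (\<integral>\<^sup>+x. (\<Prod>b\<in>Basis. ennreal (exp (- c * ((x::'a) \<bullet> b)\<^sup>2))) \<partial>lborel)"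
    by simp
  also have "\<dots> = (\<Prod>b\<in>(Basis::'a set). \<integral>\<^sup>+x. ennreal (exp (- c * x\<^sup>2)) \<partial>lborel)"
    by (rule nn_integral_lborel_prod) auto
  also have "\<dots> = ennreal (sqrt (pi / c) ^ DIM('a))"
    unfolding nn_integral_gaussian_real[OF assms] using assms by (simp add: ennreal_power)
  finally show ?thesis .
qed

lemma nn_integral_lborel_translate:
  fixes f :: "'a::euclidean_space \<Rightarrow> ennreal"
  assumes "f \<in> borel_measurable borel"
  shows "(\<integral>\<^sup>+x. f (x + a) \<partial>lborel) = (\<integral>\<^sup>+x. f x \<partial>lborel)"
proof -
  have "(\<integral>\<^sup>+x. f x \<partial>lborel) = (\<integral>\<^sup>+x. f x \<partial>distr lborel borel ((+) a))"
    by (simp add: lborel_distr_plus)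
  also have "\<dots> = (\<integral>\<^sup>+x. f (a + x) \<partial>lborel)"
    using assms by (subst nn_integral_distr) auto
  finally show ?thesis by (simp add: add.commute)
qed

text \<open>Integrating a Gaussian against the image measure in two ways shows that the image measure
  is proportional to Lebesgue measure; the factor is \<open>1\<close> since the Gaussian is
  rotation invariant.\<close>

lemma lborel_distr_isometry:
  fixes T :: "'a::euclidean_space \<Rightarrow> 'a"
  assumes lin: "linear T" and iso: "\<And>x. norm (T x) = norm x"
  shows "distr lborel borel T = lborel"
proof (rule measure_eqI)
  have Tm[measurable]: "T \<in> borel_measurable borel"
    using lin by (intro borel_measurable_continuous_onI linear_continuous_on linear_conv_bounded_linear[THEN iffD1])
  have "inj T"
    using lin iso by (metis linear_injective_0 norm_eq_zero)
  then have "surj T"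
    using lin by (simp add: linear_inj_imp_surj)
  fix A assume "A \<in> sets (distr lborel borel T)"
  then have A[measurable]: "A \<in> sets borel" by simp
  define S where "S = inv T"
  have TS: "T (S y) = y" for y
    using \<open>surj T\<close> by (simp add: S_def surj_f_inv_f)
  have lS: "linear S"
  proof (rule linearI)
    have "T (S (b1 + b2)) = T (S b1 + S b2)" for b1 b2
      by (simp add: TS linear_add[OF lin])
    then show "S (b1 + b2) = S b1 + S b2" for b1 b2
      using \<open>inj T\<close> by (simp add: inj_eq)
    have "T (S (r *\<^sub>R b)) = T (r *\<^sub>R S b)" for r b
      by (simp add: TS linear_scale[OF lin])
    then show "S (r *\<^sub>R b) = r *\<^sub>R S b" for r b
      using \<open>inj T\<close> by (simp add: inj_eq)
  qed
  have Sm[measurable]: "S \<in> borel_measurable borel"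
    using lS by (intro borel_measurable_continuous_onI linear_continuous_on linear_conv_bounded_linear[THEN iffD1])
  define G where "G x = ennreal (exp (- 1 * (norm (x::'a))\<^sup>2))" for x
  define g where "g x = (indicator A x :: ennreal)" for x
  define K where "K = (\<integral>\<^sup>+x. G x \<partial>lborel)"
  have Gm[measurable]: "G \<in> borel_measurable borel" unfolding G_def by measurable
  have gm[measurable]: "g \<in> borel_measurable borel" unfolding g_def by measurable
  have K: "K \<noteq> 0" "K \<noteq> \<infinity>"
    using nn_integral_gaussian[of 1, where 'a='a] by (auto simp: K_def G_def)
  \<comment> \<open>The double integral of \<open>G x * g (y + T x)\<close> is computed in both
    orders. One order gives \<open>K\<close> times the mass of \<open>A\<close>. In the other,
    shifting x by \<open>S y\<close> moves the dependence on y into \<open>G (x - S y)\<close>, and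
    \<open>norm (x - S y) = norm (T x - y)\<close> makes the y-integral equal to \<open>K\<close>
    again.\<close>
  have "K * (\<integral>\<^sup>+y. g y \<partial>lborel) = (\<integral>\<^sup>+x. G x * (\<integral>\<^sup>+y. g y \<partial>lborel) \<partial>lborel)"
    by (simp add: K_def nn_integral_multc)
  also have "\<dots> = (\<integral>\<^sup>+x. \<integral>\<^sup>+y. G x * g (y + T x) \<partial>lborel \<partial>lborel)"
    by (simp add: nn_integral_cmult nn_integral_lborel_translate)
  also have "\<dots> = (\<integral>\<^sup>+y. \<integral>\<^sup>+x. G x * g (y + T x) \<partial>lborel \<partial>lborel)"
    by (rule lborel_pair.Fubini') measurable
  also have "\<dots> = (\<integral>\<^sup>+y. \<integral>\<^sup>+x. G (x - S y) * g (T x) \<partial>lborel \<partial>lborel)"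
  proof (rule nn_integral_cong)
    fix y
    have "(\<integral>\<^sup>+x. G (x - S y) * g (T x) \<partial>lborel) = (\<integral>\<^sup>+x. G ((x + S y) - S y) * g (T (x + S y)) \<partial>lborel)"
      by (rule nn_integral_lborel_translate[symmetric]) measurable
    then show "(\<integral>\<^sup>+x. G x * g (y + T x) \<partial>lborel) = (\<integral>\<^sup>+x. G (x - S y) * g (T x) \<partial>lborel)"
      by (simp add: linear_add[OF lin] TS add.commute)
  qed
  also have "\<dots> = (\<integral>\<^sup>+x. \<integral>\<^sup>+y. G (x - S y) * g (T x) \<partial>lborel \<partial>lborel)"
    by (rule lborel_pair.Fubini') measurable
  also have "\<dots> = (\<integral>\<^sup>+x. \<integral>\<^sup>+y. G (y + - T x) * g (T x) \<partial>lborel \<partial>lborel)"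
  proof (intro nn_integral_cong)
    fix x y
    have "norm (x - S y) = norm (T (x - S y))" by (simp add: iso)
    also have "\<dots> = norm (y + - T x)" by (simp add: linear_diff[OF lin] TS norm_minus_commute)
    finally show "G (x - S y) * g (T x) = G (y + - T x) * g (T x)" by (simp add: G_def)
  qed
  also have "\<dots> = (\<integral>\<^sup>+x. K * g (T x) \<partial>lborel)"
    by (simp add: nn_integral_multc nn_integral_lborel_translate K_def del: add_uminus_conv_diff)
  also have "\<dots> = K * (\<integral>\<^sup>+x. g (T x) \<partial>lborel)"
    by (simp add: nn_integral_cmult)
  finally have eq: "(\<integral>\<^sup>+y. g y \<partial>lborel) = (\<integral>\<^sup>+x. g (T x) \<partial>lborel)"
    using K by (simp add: ennreal_mult_cancel_left)
  have "emeasure (distr lborel borel T) A = (\<integral>\<^sup>+x. g x \<partial>distr lborel borel T)"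
    by (simp add: g_def)
  also have "\<dots> = (\<integral>\<^sup>+x. g (T x) \<partial>lborel)"
    by (subst nn_integral_distr) auto
  also have "\<dots> = emeasure lborel A"
    unfolding eq[symmetric] by (simp add: g_def[abs_def])
  finally show "emeasure (distr lborel borel T) A = emeasure lborel A" .
qed simp

section \<open>Entire functions of Gaussian growth\<close>

lemma norm_vector_scalar_mult: "norm (c *s (v::complex^'n)) = norm c * norm v"
  by (simp add: norm_vec_def norm_mult L2_set_right_distrib)

section \<open>The bilinear product and conjugation of vectors\<close>

lemma cdot_commute: "u \<odot> v = v \<odot> u"
  by (simp add: cdot_def mult.commute)

lemma cdot_add_left: "(u + u') \<odot> v = u \<odot> v + u' \<odot> v"
  by (simp add: cdot_def distrib_right sum.distrib)

lemma cdot_add_right: "u \<odot> (v + v') = u \<odot> v + u \<odot> v'"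
  by (simp add: cdot_def distrib_left sum.distrib)

lemma cdot_minus_left: "(- u) \<odot> v = - (u \<odot> v)"
  by (simp add: cdot_def sum_negf)

lemma cdot_diff_left: "(u - u') \<odot> v = u \<odot> v - u' \<odot> v"
  by (simp add: cdot_def left_diff_distrib sum_subtractf)

lemma cdot_diff_right: "u \<odot> (v - v') = u \<odot> v - u \<odot> v'"
  by (simp add: cdot_def right_diff_distrib sum_subtractf)

lemma cdot_scaleR_left: "(r *\<^sub>R u) \<odot> v = r *\<^sub>R (u \<odot> v)"
  by (simp add: cdot_def scaleR_sum_right)

lemma cdot_scaleR_right: "u \<odot> (r *\<^sub>R v) = r *\<^sub>R (u \<odot> v)"
  by (simp add: cdot_def scaleR_sum_right)

lemma cdot_zero [simp]: "0 \<odot> v = 0" "u \<odot> 0 = 0"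
  by (simp_all add: cdot_def)

lemma cdot_axis [simp]: "u \<odot> axis i a = u $ i * a" "axis i a \<odot> u = a * u $ i"
  by (simp_all add: cdot_def axis_def if_distrib[of "\<lambda>x. _ * x"] if_distrib[of "\<lambda>x. x * _"] cong: if_cong)

lemma norm_cdot_le: "norm (u \<odot> v) \<le> norm u * norm v"
proof -
  have "norm (u \<odot> v) \<le> (\<Sum>j\<in>UNIV. \<bar>norm (u $ j)\<bar> * \<bar>norm (v $ j)\<bar>)"
    unfolding cdot_def by (rule order_trans[OF norm_sum]) (simp add: norm_mult)
  also have "\<dots> \<le> norm u * norm v"
    unfolding norm_vec_def by (rule L2_set_mult_ineq)
  finally show ?thesis .
qed

lemma bounded_bilinear_cdot: "bounded_bilinear cdot"
  by unfold_locales
    (auto simp: cdot_add_left cdot_add_right cdot_scaleR_left cdot_scaleR_right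
      intro!: exI[of _ 1] norm_cdot_le)

lemma vcnj_simps [simp]:
  "vcnj (vcnj u) = u" "vcnj u $ i = cnj (u $ i)" "vcnj 0 = 0" "norm (vcnj u) = norm u"
  by (simp_all add: vcnj_def vec_eq_iff norm_vec_def)

lemma vcnj_add: "vcnj (u + v) = vcnj u + vcnj v"
  and vcnj_diff: "vcnj (u - v) = vcnj u - vcnj v"
  and vcnj_scaleR: "vcnj (r *\<^sub>R u) = r *\<^sub>R vcnj u"
  by (simp_all add: vcnj_def vec_eq_iff)

lemma cnj_cdot: "cnj (u \<odot> v) = vcnj u \<odot> vcnj v"
  by (simp add: cdot_def)

lemma cdot_vcnj_self: "u \<odot> vcnj u = of_real ((norm u)\<^sup>2)"
proof -
  have "(norm u)\<^sup>2 = (\<Sum>j\<in>UNIV. (norm (u $ j))\<^sup>2)"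
    by (simp add: norm_vec_def L2_set_def sum_nonneg)
  then show ?thesis
    by (simp only: of_real_sum complex_norm_square) (simp add: cdot_def)
qed

lemma bounded_linear_vcnj: "bounded_linear vcnj"
  by (rule bounded_linear_intro[where K=1]) (auto simp: vcnj_add vcnj_scaleR)

section \<open>Closure properties of entire functions\<close>

lemma entire_const [simp]: "entire (\<lambda>_. c)"
  unfolding entire_def by (intro allI exI[of _ "\<lambda>_. 0"]) auto

lemma entire_nth [simp]: "entire (\<lambda>z. z $ i)"
  unfolding entire_def
  by (intro allI exI[of _ "\<lambda>z. z $ i"])
    (auto intro!: bounded_linear_imp_has_derivative bounded_linear_vec_nth)

lemma entire_add [intro]:
  assumes "entire f" "entire g" shows "entire (\<lambda>z. f z + g z)"
  unfolding entire_def
proof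
  fix z
  obtain f' g' where "(f has_derivative f') (at z)" "\<forall>c v. f' (c *s v) = c * f' v"
    "(g has_derivative g') (at z)" "\<forall>c v. g' (c *s v) = c * g' v"
    using assms unfolding entire_def by blast
  then show "\<exists>h'. ((\<lambda>z. f z + g z) has_derivative h') (at z) \<and> (\<forall>c v. h' (c *s v) = c * h' v)"
    by (intro exI[of _ "\<lambda>v. f' v + g' v"]) (auto intro!: has_derivative_add simp: distrib_left)
qed

lemma entire_mult [intro]:
  assumes "entire f" "entire g" shows "entire (\<lambda>z. f z * g z)"
  unfolding entire_def
proof
  fix z
  obtain f' g' where "(f has_derivative f') (at z)" "\<forall>c v. f' (c *s v) = c * f' v"
    "(g has_derivative g') (at z)" "\<forall>c v. g' (c *s v) = c * g' v"
    using assms unfolding entire_def by blast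
  then show "\<exists>h'. ((\<lambda>z. f z * g z) has_derivative h') (at z) \<and> (\<forall>c v. h' (c *s v) = c * h' v)"
    by (intro exI[of _ "\<lambda>v. f z * g' v + f' v * g z"])
      (auto intro!: has_derivative_mult simp: algebra_simps)
qed

lemma entire_compose:
  assumes "entire f" and g: "\<And>w. (g has_field_derivative g' w) (at w)"
  shows "entire (\<lambda>z. g (f z))"
  unfolding entire_def
proof
  fix z
  obtain f' where f': "(f has_derivative f') (at z)" "\<forall>c v. f' (c *s v) = c * f' v"
    using assms unfolding entire_def by blast
  have "((\<lambda>z. g (f z)) has_derivative (\<lambda>v. g' (f z) * f' v)) (at z)"
    using has_derivative_compose[OF f'(1), of g "(*) (g' (f z))"] g[of "f z"]
    by (simp add: has_field_derivative_def)
  with f'(2) show "\<exists>h'. ((\<lambda>z. g (f z)) has_derivative h') (at z) \<and> (\<forall>c v. h' (c *s v) = c * h' v)"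
    by (intro exI[of _ "\<lambda>v. g' (f z) * f' v"]) (auto simp: algebra_simps)
qed

lemma entire_exp [intro]: "entire f \<Longrightarrow> entire (\<lambda>z. exp (f z))"
  by (rule entire_compose[where g=exp and g'=exp]) (auto intro: DERIV_exp)

lemma entire_minus [intro]: "entire f \<Longrightarrow> entire (\<lambda>z. - f z)"
  using entire_mult[OF entire_const[of "-1"]] by simp

lemma entire_diff [intro]: "entire f \<Longrightarrow> entire g \<Longrightarrow> entire (\<lambda>z. f z - g z)"
  using entire_add[OF _ entire_minus] by simp

lemma entire_sum [intro]: "(\<And>i. i \<in> I \<Longrightarrow> entire (f i)) \<Longrightarrow> entire (\<lambda>z. \<Sum>i\<in>I. f i z)"
  by (induction I rule: infinite_finite_induct) (auto intro!: entire_add)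

lemma entire_cdot [intro]:
  "(\<And>j. entire (\<lambda>z. f z $ j)) \<Longrightarrow> (\<And>j. entire (\<lambda>z. g z $ j)) \<Longrightarrow> entire (\<lambda>z. f z \<odot> g z)"
  unfolding cdot_def by (intro entire_sum entire_mult)

lemma entire_matrix_vector_mult [intro]:
  "(\<And>j. entire (\<lambda>z. f z $ j)) \<Longrightarrow> entire (\<lambda>z. (N *v f z) $ i)"
  by (simp add: matrix_vector_mult_def) (intro entire_sum entire_mult entire_const)

lemma entire_shift:
  assumes "entire f" shows "entire (\<lambda>v. f (a + v))"
  unfolding entire_def
proof
  fix z
  obtain f' where f': "(f has_derivative f') (at (a + z))" "\<forall>c v. f' (c *s v) = c * f' v"
    using assms unfolding entire_def by blast
  have "((\<lambda>v. a + v) has_derivative (\<lambda>v. v)) (at z)"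
    by (auto intro!: derivative_eq_intros)
  from has_derivative_compose[OF this, of f f'] f'
  show "\<exists>h'. ((\<lambda>v. f (a + v)) has_derivative h') (at z) \<and> (\<forall>c v. h' (c *s v) = c * h' v)"
    by auto
qed

lemma entire_continuous_on: "entire f \<Longrightarrow> continuous_on S f"
  unfolding entire_def
  by (intro continuous_at_imp_continuous_on) (auto dest: has_derivative_continuous)

lemma entire_borel_measurable: "entire f \<Longrightarrow> f \<in> borel_measurable borel"
  by (intro borel_measurable_continuous_onI entire_continuous_on)

text \<open>Complex homogeneity of the derivative makes the restriction to a complex line through 0
  holomorphic in one variable, so Cauchy's formula becomes available.\<close>

lemma entire_holomorphic_slice:
  assumes "entire f" shows "(\<lambda>\<zeta>. f (\<zeta> *s v)) holomorphic_on UNIV"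
  unfolding holomorphic_on_def field_differentiable_def
proof
  fix \<zeta>
  obtain f' where f': "(f has_derivative f') (at (\<zeta> *s v))" "\<forall>c v. f' (c *s v) = c * f' v"
    using assms unfolding entire_def by blast
  have "bounded_linear (\<lambda>\<zeta>. \<zeta> *s v)"
    by (rule bounded_linear_intro[where K="norm v"])
      (auto simp: vec_eq_iff distrib_right norm_vector_scalar_mult)
  then have "((\<lambda>\<zeta>. \<zeta> *s v) has_derivative (\<lambda>\<zeta>. \<zeta> *s v)) (at \<zeta>)"
    by (rule bounded_linear_imp_has_derivative)
  from has_derivative_compose[OF this f'(1)]
  have "((\<lambda>\<zeta>. f (\<zeta> *s v)) has_field_derivative f' v) (at \<zeta>)"
    using f'(2) by (simp add: has_field_derivative_def mult_commute_abs)
  then show "\<exists>f'. ((\<lambda>\<zeta>. f (\<zeta> *s v)) has_field_derivative f') (at \<zeta> within UNIV)"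
    by blast
qed

text \<open>The free constants \<open>C\<close> and \<open>b\<close> absorb polynomial factors,
  linear exponents and translations, so that the quadratic rate \<open>a\<close> alone decides
  integrability against \<open>gauss lam\<close>.\<close>

definition gauss_bounded :: "real \<Rightarrow> (complex^'n \<Rightarrow> complex) \<Rightarrow> bool"
  where "gauss_bounded a F \<longleftrightarrow> (\<exists>C b. \<forall>v. norm (F v) \<le> C * exp (a * (norm v)\<^sup>2 + b * norm v))"

lemma gauss_boundedI:
  "(\<And>v. norm (F v) \<le> C * exp (a * (norm v)\<^sup>2 + b * norm v)) \<Longrightarrow> gauss_bounded a F"
  unfolding gauss_bounded_def by blast

lemma gauss_boundedE:
  assumes "gauss_bounded a F"
  obtains C b where "C \<ge> 0" "b \<ge> 0" "\<And>v. norm (F v) \<le> C * exp (a * (norm v)\<^sup>2 + b * norm v)"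
proof -
  obtain C b where Cb: "\<And>v. norm (F v) \<le> C * exp (a * (norm v)\<^sup>2 + b * norm v)"
    using assms unfolding gauss_bounded_def by blast
  have "norm (F v) \<le> \<bar>C\<bar> * exp (a * (norm v)\<^sup>2 + \<bar>b\<bar> * norm v)" for v
  proof -
    have "C * exp (a * (norm v)\<^sup>2 + b * norm v) \<le> \<bar>C\<bar> * exp (a * (norm v)\<^sup>2 + \<bar>b\<bar> * norm v)"
      by (intro mult_mono) (auto intro!: mult_right_mono)
    with Cb[of v] show ?thesis by simp
  qed
  then show ?thesis by (intro that[of "\<bar>C\<bar>" "\<bar>b\<bar>"]) auto
qed

lemma gauss_bounded_mult:
  assumes "gauss_bounded a F" "gauss_bounded a' F'"
  shows "gauss_bounded (a + a') (\<lambda>v. F v * F' v)"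
proof -
  obtain C b where Cb: "C \<ge> 0" "b \<ge> 0" "\<And>v. norm (F v) \<le> C * exp (a * (norm v)\<^sup>2 + b * norm v)"
    using gauss_boundedE[OF assms(1)] by blast
  obtain C' b' where Cb': "C' \<ge> 0" "b' \<ge> 0" "\<And>v. norm (F' v) \<le> C' * exp (a' * (norm v)\<^sup>2 + b' * norm v)"
    using gauss_boundedE[OF assms(2)] by blast
  show ?thesis
  proof (rule gauss_boundedI)
    fix v
    have "norm (F v * F' v) \<le> (C * exp (a * (norm v)\<^sup>2 + b * norm v)) * (C' * exp (a' * (norm v)\<^sup>2 + b' * norm v))"
      unfolding norm_mult using Cb Cb' by (intro mult_mono) auto
    also have "\<dots> = (C * C') * exp ((a + a') * (norm v)\<^sup>2 + (b + b') * norm v)"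
      by (simp add: exp_add algebra_simps)
    finally show "norm (F v * F' v) \<le> (C * C') * exp ((a + a') * (norm v)\<^sup>2 + (b + b') * norm v)" .
  qed
qed

lemma gauss_bounded_add:
  assumes "gauss_bounded a F" "gauss_bounded a F'"
  shows "gauss_bounded a (\<lambda>v. F v + F' v)"
proof -
  obtain C b where Cb: "C \<ge> 0" "b \<ge> 0" "\<And>v. norm (F v) \<le> C * exp (a * (norm v)\<^sup>2 + b * norm v)"
    using gauss_boundedE[OF assms(1)] by blast
  obtain C' b' where Cb': "C' \<ge> 0" "b' \<ge> 0" "\<And>v. norm (F' v) \<le> C' * exp (a * (norm v)\<^sup>2 + b' * norm v)"
    using gauss_boundedE[OF assms(2)] by blast
  show ?thesis
  proof (rule gauss_boundedI)
    fix v
    have "norm (F v + F' v) \<le> norm (F v) + norm (F' v)" by (rule norm_triangle_ineq)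
    also have "\<dots> \<le> C * exp (a * (norm v)\<^sup>2 + b * norm v) + C' * exp (a * (norm v)\<^sup>2 + b' * norm v)"
      by (intro add_mono Cb Cb')
    also have "\<dots> \<le> C * exp (a * (norm v)\<^sup>2 + (b + b') * norm v) + C' * exp (a * (norm v)\<^sup>2 + (b + b') * norm v)"
      using Cb Cb' by (intro add_mono mult_left_mono) (auto simp: distrib_right)
    also have "\<dots> = (C + C') * exp (a * (norm v)\<^sup>2 + (b + b') * norm v)"
      by (simp add: distrib_right)
    finally show "norm (F v + F' v) \<le> (C + C') * exp (a * (norm v)\<^sup>2 + (b + b') * norm v)" .
  qed
qed

lemma gauss_bounded_const [simp]: "gauss_bounded 0 (\<lambda>_. c)"
  by (rule gauss_boundedI[of _ "norm c" _ 0]) simp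

lemma le_exp_self: "x \<le> exp (x::real)"
  using exp_ge_add_one_self[of x] by linarith

lemma gauss_bounded_nth [simp]: "gauss_bounded 0 (\<lambda>v. v $ i)"
proof (rule gauss_boundedI[of _ 1 _ 1])
  fix v :: "complex^'a"
  have "norm (v $ i) \<le> norm v" by (rule Finite_Cartesian_Product.norm_nth_le)
  with le_exp_self[of "norm v"] show "norm (v $ i) \<le> 1 * exp (0 * (norm v)\<^sup>2 + 1 * norm v)" by simp
qed

lemma gauss_bounded_exp:
  assumes "\<And>v. norm (h v) \<le> c + b * norm v + a * (norm v)\<^sup>2"
  shows "gauss_bounded a (\<lambda>v. exp (h v))"
proof (rule gauss_boundedI[of _ "exp c" _ b])
  fix v
  have "norm (exp (h v)) \<le> exp (norm (h v))" by (rule norm_exp)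
  also have "\<dots> \<le> exp (c + b * norm v + a * (norm v)\<^sup>2)" using assms by simp
  also have "\<dots> = exp c * exp (a * (norm v)\<^sup>2 + b * norm v)" by (simp add: exp_add)
  finally show "norm (exp (h v)) \<le> exp c * exp (a * (norm v)\<^sup>2 + b * norm v)" .
qed

text \<open>The cross term of the expanded square is linear in \<open>norm v\<close>, so the rate
  \<open>a\<close> is unchanged.\<close>

lemma gauss_bounded_shift:
  assumes "gauss_bounded a F" and "a \<ge> 0" shows "gauss_bounded a (\<lambda>v. F (z + v))"
proof -
  obtain C b where Cb: "C \<ge> 0" "b \<ge> 0" "\<And>v. norm (F v) \<le> C * exp (a * (norm v)\<^sup>2 + b * norm v)"
    using gauss_boundedE[OF assms(1)] by blast
  show ?thesis
  proof (rule gauss_boundedI[of _ "C * exp (a * (norm z)\<^sup>2 + b * norm z)" _ "2 * a * norm z + b"])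
    fix v
    have n: "norm (z + v) \<le> norm z + norm v" by (rule norm_triangle_ineq)
    then have "(norm (z + v))\<^sup>2 \<le> (norm z + norm v)\<^sup>2" by (rule power_mono) simp
    then have "a * (norm (z + v))\<^sup>2 + b * norm (z + v) \<le> a * (norm z + norm v)\<^sup>2 + b * (norm z + norm v)"
      using n assms(2) Cb(2) by (intro add_mono mult_left_mono) auto
    then have "norm (F (z + v)) \<le> C * exp (a * (norm z + norm v)\<^sup>2 + b * (norm z + norm v))"
      using Cb(1) by (intro order_trans[OF Cb(3)] mult_left_mono) auto
    also have "\<dots> = C * exp (a * (norm z)\<^sup>2 + b * norm z) * exp (a * (norm v)\<^sup>2 + (2 * a * norm z + b) * norm v)"
      by (simp add: exp_add[symmetric] power2_eq_square algebra_simps)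
    finally show "norm (F (z + v)) \<le> C * exp (a * (norm z)\<^sup>2 + b * norm z) * exp (a * (norm v)\<^sup>2 + (2 * a * norm z + b) * norm v)" .
  qed
qed

text \<open>Completing the square: the slack \<open>c - a\<close> in the quadratic coefficient
  absorbs the linear term at the price of a constant.\<close>

lemma exp_quadratic_linear_le:
  fixes a b c r :: real
  assumes "a < c"
  shows "exp (a * r\<^sup>2 + b * r) \<le> exp (b\<^sup>2 / (4 * (c - a))) * exp (c * r\<^sup>2)"
proof -
  have "0 \<le> (2 * (c - a) * r - b)\<^sup>2 / (4 * (c - a))" using assms by simp
  also have "\<dots> = (c - a) * r\<^sup>2 - b * r + b\<^sup>2 / (4 * (c - a))"
    using assms by (simp add: power2_eq_square field_simps)
  finally have "a * r\<^sup>2 + b * r \<le> b\<^sup>2 / (4 * (c - a)) + c * r\<^sup>2" by (simp add: algebra_simps)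
  then show ?thesis by (simp add: exp_add[symmetric])
qed

lemma integrable_gaussian:
  assumes "c > 0"
  shows "integrable lborel (\<lambda>x::'a::euclidean_space. exp (- c * (norm x)\<^sup>2))"
  by (rule integrableI_nonneg) (auto simp: nn_integral_gaussian[OF assms, simplified] ennreal_less_top)

lemma integrable_gauss_bounded:
  assumes F: "F \<in> borel_measurable borel" and b: "gauss_bounded a F" and a: "a < lam / 2"
  shows "integrable lborel (\<lambda>v. F v * of_real (gauss lam v))"
proof -
  obtain C b where Cb: "C \<ge> 0" "b \<ge> 0" "\<And>v. norm (F v) \<le> C * exp (a * (norm v)\<^sup>2 + b * norm v)"
    using gauss_boundedE[OF assms(2)] by blast
  \<comment> \<open>The midpoint of \<open>a\<close> and \<open>lam / 2\<close> leaves room on both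
    sides: to absorb the linear exponent, and to keep a decaying Gaussian as majorant.\<close>
  define c where "c = (a + lam / 2) / 2"
  define K where "K = C * exp (b\<^sup>2 / (4 * (c - a)))"
  have c: "a < c" "0 < lam / 2 - c" using a by (auto simp: c_def field_simps)
  have "integrable lborel (\<lambda>v::complex^'a. K * exp (- (lam / 2 - c) * (norm v)\<^sup>2))"
    using c(2) by (intro integrable_mult_right integrable_gaussian)
  then show ?thesis
  proof (rule Bochner_Integration.integrable_bound)
    show "AE v in lborel. norm (F v * of_real (gauss lam v)) \<le> norm (K * exp (- (lam / 2 - c) * (norm v)\<^sup>2))"
    proof (rule AE_I2)
      fix v
      have "norm (F v * of_real (gauss lam v)) \<le> (C * exp (a * (norm v)\<^sup>2 + b * norm v)) * gauss lam v"
        using Cb(3)[of v] by (simp add: norm_mult gauss_def)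
      also have "\<dots> \<le> (C * (exp (b\<^sup>2 / (4 * (c - a))) * exp (c * (norm v)\<^sup>2))) * gauss lam v"
        using Cb(1) c(1) by (intro mult_right_mono mult_left_mono exp_quadratic_linear_le) (auto simp: gauss_def)
      also have "\<dots> = K * exp (- (lam / 2 - c) * (norm v)\<^sup>2)"
        by (simp add: K_def gauss_def exp_add[symmetric] algebra_simps)
      finally show "norm (F v * of_real (gauss lam v)) \<le> norm (K * exp (- (lam / 2 - c) * (norm v)\<^sup>2))"
        using Cb(1) by (simp add: K_def)
    qed
    have "gauss lam \<in> borel_measurable borel"
      unfolding gauss_def by measurable
    then show "(\<lambda>v. F v * of_real (gauss lam v)) \<in> borel_measurable lborel"
      using F by measurable
  qed
qed

section \<open>The mean value and reproducing properties\<close>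

text \<open>Cauchy's integral formula at the centre of the unit circle: in the parametrisation of
  \<open>circlepath\<close>, \<open>du / u\<close> becomes \<open>2 * pi * \<i> * dx\<close>, and
  the formula turns into an average over \<open>{0..1}\<close>.\<close>

lemma circle_mean_value:
  assumes "g holomorphic_on UNIV"
  shows "((\<lambda>x. g (exp (2 * of_real pi * \<i> * of_real x))) has_integral g 0) {0..1::real}"
proof -
  have "((\<lambda>u. g u / (u - 0)) has_contour_integral (2 * of_real pi * \<i> * g 0)) (circlepath 0 1)"
    by (rule Cauchy_integral_circlepath_simple) (auto intro: holomorphic_on_subset[OF assms])
  then have "((\<lambda>x. (2 * of_real pi * \<i>) * g (exp (2 * of_real pi * \<i> * of_real x)))
      has_integral (2 * of_real pi * \<i> * g 0)) {0..1}"
    unfolding has_contour_integral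
    by (rule has_integral_eq[rotated]) (simp add: vector_derivative_circlepath, simp add: circlepath)
  from has_integral_mult_right[OF this, of "inverse (2 * of_real pi * \<i>)"]
  show ?thesis by (simp add: field_simps)
qed

text \<open>Multiplication by a unimodular scalar is a real-linear isometry, so
  \<open>lborel_distr_isometry\<close> applies.\<close>

lemma lborel_integral_phase_invariant:
  fixes f :: "complex^'n \<Rightarrow> 'a::{banach, second_countable_topology}"
  assumes f: "f \<in> borel_measurable borel" and c: "norm c = 1"
  shows "(\<integral>v. f (c *s v) \<partial>lborel) = (\<integral>v. f v \<partial>lborel)"
    and "integrable lborel (\<lambda>v. f (c *s v)) \<longleftrightarrow> integrable lborel f"
proof -
  have lin: "linear (\<lambda>v. c *s (v :: complex^'n))"
    by (rule linearI) (auto simp: vec_eq_iff distrib_left)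
  have d: "distr lborel borel (\<lambda>v. c *s (v :: complex^'n)) = lborel"
    by (rule lborel_distr_isometry[OF lin]) (simp add: norm_vector_scalar_mult c)
  have m: "(\<lambda>v. c *s (v :: complex^'n)) \<in> borel_measurable borel"
    using lin by (intro borel_measurable_continuous_onI linear_continuous_on linear_conv_bounded_linear[THEN iffD1])
  show "(\<integral>v. f (c *s v) \<partial>lborel) = (\<integral>v. f v \<partial>lborel)"
    by (subst (2) d[symmetric], subst integral_distr) (use f m in auto)
  show "integrable lborel (\<lambda>v. f (c *s v)) \<longleftrightarrow> integrable lborel f"
    by (subst (2) d[symmetric], subst integrable_distr_eq) (use f m in auto)
qed

lemma gauss_measurable [measurable]: "gauss lam \<in> borel_measurable borel"
  unfolding gauss_def by measurable

lemma gauss_phase_invariant: "norm c = 1 \<Longrightarrow> gauss lam (c *s v) = gauss lam v"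
  by (simp add: gauss_def norm_vector_scalar_mult)

text \<open>Averaging over the rotations \<open>v \<mapsto> e\<^sup>i\<^sup>\<theta> v\<close>, which preserve the Gaussian, replaces \<open>G v\<close>
  by the mean of an entire function of one variable over a circle around \<open>0\<close>.\<close>

lemma gaussian_mean_value_lborel:
  fixes G :: "complex^'n \<Rightarrow> complex"
  assumes G: "entire G" "gauss_bounded a G" and a: "a < lam / 2"
  shows "(\<integral>v. G v * of_real (gauss lam v) \<partial>lborel) = G 0 * of_real (\<integral>v. gauss lam (v::complex^'n) \<partial>lborel)"
proof -
  define e where "e x = exp (2 * of_real pi * \<i> * of_real x)" for x :: real
  have e: "norm (e x) = 1" for x by (simp add: e_def)
  have Gm[measurable]: "G \<in> borel_measurable borel" by (rule entire_borel_measurable[OF G(1)])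
  define F where "F v = G v * of_real (gauss lam v)" for v
  have Fm[measurable]: "F \<in> borel_measurable borel" unfolding F_def by measurable
  have Fi: "integrable lborel F"
    unfolding F_def by (rule integrable_gauss_bounded[OF Gm G(2) a])
  have Fe: "F (e x *s v) = G (e x *s v) * of_real (gauss lam v)" for x v
    by (simp add: F_def gauss_phase_invariant e)
  define H where "H x v = indicator {0..1} x *\<^sub>R F (e x *s v)" for x :: real and v
  \<comment> \<open>Joint continuity of the rotation action supplies the joint measurability that
    Fubini asks for.\<close>
  have "continuous_on UNIV (\<lambda>p::real \<times> (complex^'n). e (fst p) *s snd p)"
    unfolding e_def vector_scalar_mult_def by (intro continuous_intros)
  then have em[measurable]: "(\<lambda>p::real \<times> (complex^'n). e (fst p) *s snd p) \<in> borel_measurable borel"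
    by (rule borel_measurable_continuous_onI)
  have Hm: "case_prod H \<in> borel_measurable (lborel \<Otimes>\<^sub>M lborel)"
  proof -
    have "(\<lambda>p::real \<times> (complex^'n). indicator {0..1} (fst p) *\<^sub>R F (e (fst p) *s snd p))
        \<in> borel_measurable (borel \<Otimes>\<^sub>M borel)"
      using em by (intro borel_measurable_scaleR measurable_compose[OF _ Fm]) (measurable, simp add: borel_prod)
    then show ?thesis
      by (simp add: H_def case_prod_unfold lborel_prod borel_prod cong: measurable_cong_sets)
  qed
  have Hx: "integrable lborel (H x)" for x
    unfolding H_def using lborel_integral_phase_invariant(2)[OF Fm e[of x]] Fi by simp
  have nH: "(\<integral>v. norm (H x v) \<partial>lborel) = indicator {0..1} x *\<^sub>R (\<integral>v. norm (F v) \<partial>lborel)" for x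
    using lborel_integral_phase_invariant(1)[of "\<lambda>v. norm (F v)", OF _ e[of x]] Fm
    by (simp add: H_def indicator_def)
  have Hi: "integrable (lborel \<Otimes>\<^sub>M lborel) (case_prod H)"
    by (rule lborel_pair.Fubini_integrable[OF Hm]) (auto simp: nH Hx)
  have inner: "(\<integral>x. H x v \<partial>lborel) = G 0 * of_real (gauss lam v)" for v
  proof -
    have "((\<lambda>x. G (e x *s v)) has_integral G (0 *s v)) {0..1}"
      unfolding e_def by (rule circle_mean_value[OF entire_holomorphic_slice[OF G(1)]])
    then have hi: "((\<lambda>x. G (e x *s v)) has_integral G 0) {0..1}" by simp
    have "continuous_on {0..1} (\<lambda>x. e x *s v)"
      unfolding e_def vector_scalar_mult_def by (intro continuous_intros)
    then have "continuous_on {0..1} (\<lambda>x. G (e x *s v))"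
      by (rule continuous_on_compose2[OF entire_continuous_on[OF G(1), of UNIV]]) auto
    then have "set_integrable lborel {0..1} (\<lambda>x. G (e x *s v))"
      unfolding set_integrable_def by (rule borel_integrable_compact[OF compact_Icc])
    from set_borel_integral_eq_integral(2)[OF this] hi
    have "(LINT x:{0..1}|lborel. G (e x *s v)) = G 0"
      by (simp add: integral_unique)
    then have "(\<integral>x. (indicator {0..1} x *\<^sub>R G (e x *s v)) * of_real (gauss lam v) \<partial>lborel)
      = G 0 * of_real (gauss lam v)"
      by (simp only: integral_mult_left_zero set_lebesgue_integral_def)
    then show ?thesis by (simp add: H_def Fe scaleR_conv_of_real mult.assoc)
  qed
  have "(\<integral>v. F v \<partial>lborel) = (\<integral>x. indicator {0..1::real} x *\<^sub>R (\<integral>v. F v \<partial>lborel) \<partial>lborel)"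
    by (subst integral_scaleR_left) auto
  also have "\<dots> = (\<integral>x. (\<integral>v. H x v \<partial>lborel) \<partial>lborel)"
    by (simp add: H_def lborel_integral_phase_invariant(1)[OF Fm e])
  also have "\<dots> = (\<integral>v. (\<integral>x. H x v \<partial>lborel) \<partial>lborel)"
    by (rule lborel_pair.Fubini_integral[OF Hi, symmetric])
  also have "\<dots> = G 0 * of_real (\<integral>v. gauss lam (v::complex^'n) \<partial>lborel)"
    by (simp add: inner)
  finally show ?thesis by (simp add: F_def)
qed

lemma integral_gauss_lborel:
  assumes "lam > 0"
  shows "(\<integral>v. gauss lam (v::complex^'n) \<partial>lborel) = (2 * pi / lam) ^ CARD('n)"
proof -
  have "(\<integral>v. gauss lam (v::complex^'n) \<partial>lborel) = enn2real (\<integral>\<^sup>+v. ennreal (gauss lam (v::complex^'n)) \<partial>lborel)"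
    by (rule integral_eq_nn_integral) (auto simp: gauss_def)
  also have "(\<integral>\<^sup>+v. ennreal (gauss lam (v::complex^'n)) \<partial>lborel) = ennreal (sqrt (pi / (lam / 2)) ^ DIM(complex^'n))"
    using nn_integral_gaussian[of "lam / 2", where 'a="complex^'n"] assms by (simp add: gauss_def)
  \<comment> \<open>The real dimension is twice \<open>CARD('n)\<close>, which removes the square
    root.\<close>
  also have "sqrt (pi / (lam / 2)) ^ DIM(complex^'n) = (2 * pi / lam) ^ CARD('n)"
    using assms by (simp add: power_mult real_sqrt_power[symmetric] mult.commute)
  finally show ?thesis using assms by simp
qed

lemma integral_dm:
  fixes f :: "complex^'n \<Rightarrow> 'a::{banach, second_countable_topology}"
  assumes "lam > 0" "f \<in> borel_measurable borel"
  shows "(\<integral>v. f v \<partial>dm lam) = (lam / (2 * pi)) ^ CARD('n) *\<^sub>R (\<integral>v. f v \<partial>lborel)"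
    and "integrable (dm lam) f \<longleftrightarrow> integrable lborel f"
proof -
  show "(\<integral>v. f v \<partial>dm lam) = (lam / (2 * pi)) ^ CARD('n) *\<^sub>R (\<integral>v. f v \<partial>lborel)"
    unfolding dm_def using assms by (subst integral_density) auto
  define c where "c = (lam / (2 * pi)) ^ CARD('n)"
  have c: "c > 0" using assms(1) by (simp add: c_def)
  have "integrable (dm lam) f \<longleftrightarrow> integrable lborel (\<lambda>v. c *\<^sub>R f v)"
    unfolding dm_def c_def using assms by (subst integrable_density) auto
  also have "\<dots> \<longleftrightarrow> integrable lborel f"
  proof
    assume "integrable lborel (\<lambda>v. c *\<^sub>R f v)"
    from integrable_scaleR_right[OF this, of "inverse c"] c show "integrable lborel f" by simp
  qed simp
  finally show "integrable (dm lam) f \<longleftrightarrow> integrable lborel f" .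
qed

lemma gaussian_mean_value:
  fixes G :: "complex^'n \<Rightarrow> complex"
  assumes G: "entire G" "gauss_bounded a G" and a: "a < lam / 2" and lam: "lam > 0"
  shows "(\<integral>v. G v * of_real (gauss lam v) \<partial>dm lam) = G 0"
proof -
  have Gm[measurable]: "G \<in> borel_measurable borel" by (rule entire_borel_measurable[OF G(1)])
  have "(lam / (2 * pi)) ^ CARD('n) * (2 * pi / lam) ^ CARD('n) = 1"
    using lam by (simp add: power_mult_distrib[symmetric])
  then have "complex_of_real ((lam / (2 * pi)) ^ CARD('n)) * complex_of_real ((2 * pi / lam) ^ CARD('n)) = 1"
    by (metis of_real_1 of_real_mult)
  then show ?thesis
    using lam by (subst integral_dm)
      (auto simp: gaussian_mean_value_lborel[OF G a] integral_gauss_lborel scaleR_conv_of_real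
         simp del: of_real_power)
qed

lemma entire_coh [simp]: "entire (coh lam z)"
proof -
  have "coh lam z = (\<lambda>w. exp (of_real lam / 2 * (vcnj z \<odot> w)))"
    by (simp add: coh_def fun_eq_iff)
  then show ?thesis
    by (simp only:) (intro entire_exp entire_mult entire_cdot entire_const entire_nth)
qed

text \<open>After translating the integration variable by z, the antiholomorphic factor
  \<open>cnj (coh lam z (z + v))\<close> cancels against the cross terms of the Gaussian up to a
  factor holomorphic in v. What remains is \<open>G v * gauss lam v\<close> with \<open>G\<close>
  entire and \<open>G 0 = F z\<close>, so the mean value property finishes the argument.\<close>

lemma reproducing:
  fixes F :: "complex^'n \<Rightarrow> complex"
  assumes F: "entire F" "gauss_bounded a F" and a: "0 \<le> a" "a < lam / 2" and lam: "lam > 0"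
  shows "fock_inner lam F (coh lam z) = F z"
proof -
  define G where "G v = F (z + v) * exp (- (of_real lam / 2 * (v \<odot> vcnj z)))" for v
  have Fm[measurable]: "F \<in> borel_measurable borel" by (rule entire_borel_measurable[OF F(1)])
  have cohm[measurable]: "(\<lambda>w. cnj (coh lam z w)) \<in> borel_measurable borel"
    by (intro borel_measurable_continuous_onI continuous_on_cnj entire_continuous_on entire_coh)
  have Ge: "entire G"
    unfolding G_def
    by (intro entire_mult entire_shift[OF F(1)] entire_exp entire_minus entire_const entire_cdot entire_nth)
  have "gauss_bounded 0 (\<lambda>v. exp (- (of_real lam / 2 * (v \<odot> vcnj z))))"
  proof (rule gauss_bounded_exp[of _ 0 "lam / 2 * norm z"])
    fix v :: "complex^'n"
    have "norm (v \<odot> vcnj z) \<le> norm v * norm z" using norm_cdot_le[of v "vcnj z"] by simp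
    then have "lam / 2 * norm (v \<odot> vcnj z) \<le> lam / 2 * (norm v * norm z)"
      using lam by (intro mult_left_mono) auto
    then show "norm (- (of_real lam / 2 * (v \<odot> vcnj z))) \<le> 0 + lam / 2 * norm z * norm v + 0 * (norm v)\<^sup>2"
      using lam by (simp add: norm_mult mult.commute mult.left_commute)
  qed
  from gauss_bounded_mult[OF gauss_bounded_shift[OF F(2) a(1)] this]
  have Gb: "gauss_bounded a G" by (simp add: G_def[abs_def])
  have key: "F (z + v) * cnj (coh lam z (z + v)) * of_real (gauss lam (z + v)) = G v * of_real (gauss lam v)" for v
  proof -
    have g: "of_real (gauss lam u) = exp (- of_real lam / 2 * (u \<odot> vcnj u))" for u :: "complex^'n"
      by (simp add: gauss_def cdot_vcnj_self exp_of_real[symmetric])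
    have "cnj (coh lam z (z + v)) * of_real (gauss lam (z + v))
      = exp (- (of_real lam / 2 * (v \<odot> vcnj z))) * of_real (gauss lam v)"
      unfolding g coh_def exp_cnj exp_add[symmetric]
      by (rule arg_cong[where f=exp])
        (simp add: cnj_cdot vcnj_add cdot_add_left cdot_add_right cdot_commute field_simps)
    then show ?thesis by (simp add: G_def mult.assoc)
  qed
  have m: "(\<lambda>w. F w * cnj (coh lam z w) * of_real (gauss lam w)) \<in> borel_measurable borel"
    by measurable
  have "fock_inner lam F (coh lam z) = (lam / (2 * pi)) ^ CARD('n) *\<^sub>R
      (\<integral>w. F w * cnj (coh lam z w) * of_real (gauss lam w) \<partial>lborel)"
    unfolding fock_inner_def by (rule integral_dm(1)[OF lam m])
  also have "(\<integral>w. F w * cnj (coh lam z w) * of_real (gauss lam w) \<partial>lborel)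
     = (\<integral>w. F w * cnj (coh lam z w) * of_real (gauss lam w) \<partial>distr lborel borel ((+) z))"
    by (simp add: lborel_distr_plus)
  also have "\<dots> = (\<integral>v. F (z + v) * cnj (coh lam z (z + v)) * of_real (gauss lam (z + v)) \<partial>lborel)"
    by (subst integral_distr) (use m in auto)
  also have "\<dots> = (\<integral>v. G v * of_real (gauss lam v) \<partial>lborel)" unfolding key ..
  also have "(lam / (2 * pi)) ^ CARD('n) *\<^sub>R \<dots> = (\<integral>v. G v * of_real (gauss lam v) \<partial>dm lam)"
    using entire_borel_measurable[OF Ge] by (subst integral_dm(1)[OF lam]) auto
  also have "\<dots> = F z"
    using gaussian_mean_value[OF Ge Gb a(2) lam] by (simp add: G_def)
  finally show ?thesis .
qed

section \<open>Differentiation in the Fock norm\<close>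

lemma has_vector_derivative_iff_quotient:
  fixes f :: "real \<Rightarrow> 'a::real_normed_vector"
  shows "(f has_vector_derivative D) (at x) \<longleftrightarrow> ((\<lambda>h. (f (x + h) - f x) /\<^sub>R h) \<longlongrightarrow> D) (at 0)"
proof -
  have "\<forall>\<^sub>F h in at 0. norm (f (x + h) - f x - h *\<^sub>R D) / norm h = norm ((f (x + h) - f x) /\<^sub>R h - D)"
  proof (rule eventually_mono[OF eventually_neq_at_within[of 0]])
    fix h :: real assume h: "h \<noteq> 0"
    then have "(f (x + h) - f x) /\<^sub>R h - D = (f (x + h) - f x - h *\<^sub>R D) /\<^sub>R h"
      by (simp add: scaleR_right_diff_distrib)
    then show "norm (f (x + h) - f x - h *\<^sub>R D) / norm h = norm ((f (x + h) - f x) /\<^sub>R h - D)"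
      by (simp add: divide_inverse mult.commute)
  qed
  from tendsto_cong[OF this, of 0]
  have "((\<lambda>h. norm (f (x + h) - f x - h *\<^sub>R D) / norm h) \<longlongrightarrow> 0) (at 0)
      \<longleftrightarrow> ((\<lambda>h. (f (x + h) - f x) /\<^sub>R h) \<longlongrightarrow> D) (at 0)"
    by (simp only: tendsto_norm_zero_iff LIM_zero_iff)
  then show ?thesis
    unfolding has_vector_derivative_def has_derivative_at by (simp add: bounded_linear_scaleR_left)
qed

lemmas has_vector_derivative_quotient = has_vector_derivative_iff_quotient[THEN iffD1]
lemmas has_vector_derivativeI_quotient = has_vector_derivative_iff_quotient[THEN iffD2]

lemma sets_dm [simp, measurable_cong]: "sets (dm lam) = sets borel"
  by (simp add: dm_def)

lemma nn_integral_dm: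
  fixes f :: "complex^'n \<Rightarrow> ennreal"
  assumes "f \<in> borel_measurable borel"
  shows "(\<integral>\<^sup>+z. f z \<partial>dm lam) = ennreal ((lam / (2 * pi)) ^ CARD('n)) * (\<integral>\<^sup>+z. f z \<partial>lborel)"
  unfolding dm_def using assms by (subst nn_integral_density) (auto intro: nn_integral_cmult)

text \<open>The threshold is \<open>lam / 4\<close> because squaring \<open>F\<close> doubles its
  rate, which has to stay below \<open>lam / 2\<close>. The product \<open>F v * F v\<close> stands
  in for the squared modulus, having the same norm.\<close>

lemma fock_nrm2_gauss_bounded:
  assumes "F \<in> borel_measurable borel" "gauss_bounded a F" "a < lam / 4" "lam > 0"
  shows "fock_nrm2 lam F < \<infinity>"
proof -
  have "integrable lborel (\<lambda>v. F v * F v * of_real (gauss lam v))"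
    using assms gauss_bounded_mult[OF assms(2,2)] by (intro integrable_gauss_bounded) auto
  then have "integrable (dm lam) (\<lambda>v. F v * F v * of_real (gauss lam v))"
    using assms by (subst integral_dm(2)) auto
  then have "(\<integral>\<^sup>+v. ennreal (norm (F v * F v * of_real (gauss lam v))) \<partial>dm lam) < \<infinity>"
    by (simp add: integrable_iff_bounded)
  then show ?thesis
    by (simp add: fock_nrm2_def norm_mult power2_eq_square gauss_def)
qed

lemma fock_gauss_bounded:
  assumes "entire F" "gauss_bounded a F" "a < lam / 4" "lam > 0"
  shows "F \<in> fock lam"
  using fock_nrm2_gauss_bounded[OF entire_borel_measurable[OF assms(1)] assms(2-4)] assms(1)
  by (simp add: fock_def)

text \<open>The set where f does not vanish is open and null, hence empty.\<close>

lemma continuous_AE_zero: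
  fixes f :: "'a::euclidean_space \<Rightarrow> 'b::real_normed_vector"
  assumes "AE x in lborel. f x = 0" and "continuous_on UNIV f"
  shows "f x = 0"
proof -
  have "open {x. f x \<noteq> 0}"
    using open_Collect_neq[OF assms(2) continuous_on_const] by simp
  moreover have "{x. f x \<noteq> 0} \<in> null_sets lborel"
    using AE_iff_null_sets[of "{x. f x \<noteq> 0}" lborel] assms(1) borel_open[OF calculation] by simp
  then have "negligible {x. f x \<noteq> 0}"
    using null_sets_completionI negligible_iff_null_sets by blast
  ultimately show ?thesis
    using open_not_negligible by fastforce
qed

lemma fock_nrm2_eq_0:
  assumes "fock_nrm2 lam f = 0" and "entire f" and "lam > 0"
  shows "f z = 0"
proof -
  have [measurable]: "f \<in> borel_measurable borel" by (rule entire_borel_measurable[OF assms(2)])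
  have "(\<integral>\<^sup>+ z. ennreal ((norm (f z))\<^sup>2 * gauss lam z) \<partial>lborel) = 0"
    using assms(1,3) by (simp add: fock_nrm2_def nn_integral_dm ennreal_zero_less_mult_iff)
  then have "AE z in lborel. ennreal ((norm (f z))\<^sup>2 * gauss lam z) = 0"
    by (subst (asm) nn_integral_0_iff_AE) auto
  then have "AE z in lborel. f z = 0"
    by eventually_elim (simp add: gauss_def)
  then show ?thesis
    by (rule continuous_AE_zero) (rule entire_continuous_on[OF assms(2)])
qed

text \<open>This resolves the definite description in \<open>d_ext_harm\<close>. Since
  \<open>fock_nrm2\<close> is a squared norm with extended real values, the triangle inequality is
  replaced by the pointwise bound \<open>(x + y)^2 \<le> 2 x^2 + 2 y^2\<close> under the integral.
  Measurability of \<open>q t\<close> is asked eventually because the quotients are made explicit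
  only near \<open>t = 0\<close>.\<close>

lemma fock_limit_unique:
  assumes lam: "lam > 0" and g: "entire g" "entire h"
    and q: "\<forall>\<^sub>F t in at (0::real). q t \<in> borel_measurable borel"
    and lim: "((\<lambda>t. fock_nrm2 lam (\<lambda>z. q t z - g z)) \<longlongrightarrow> 0) (at 0)"
      "((\<lambda>t. fock_nrm2 lam (\<lambda>z. q t z - h z)) \<longlongrightarrow> 0) (at 0)"
  shows "g = h"
proof -
  have [measurable]: "g \<in> borel_measurable borel" "h \<in> borel_measurable borel"
    using g by (auto intro: entire_borel_measurable)
  have "\<forall>\<^sub>F t in at (0::real). fock_nrm2 lam (\<lambda>z. g z - h z)
      \<le> 2 * fock_nrm2 lam (\<lambda>z. q t z - g z) + 2 * fock_nrm2 lam (\<lambda>z. q t z - h z)"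
    using q
  proof eventually_elim
    case (elim t)
    note [measurable] = elim
    have pw: "(norm (g z - h z))\<^sup>2 * gauss lam z \<le>
      2 * ((norm (q t z - g z))\<^sup>2 * gauss lam z) + 2 * ((norm (q t z - h z))\<^sup>2 * gauss lam z)" for z
    proof -
      have "norm (g z - h z) \<le> norm (q t z - g z) + norm (q t z - h z)"
        using norm_triangle_ineq4[of "q t z - h z" "q t z - g z"] by simp
      then have "(norm (g z - h z))\<^sup>2 \<le> (norm (q t z - g z) + norm (q t z - h z))\<^sup>2"
        by (rule power_mono) simp
      also have "\<dots> \<le> 2 * (norm (q t z - g z))\<^sup>2 + 2 * (norm (q t z - h z))\<^sup>2"
        using zero_le_power2[of "norm (q t z - g z) - norm (q t z - h z)"]
        by (simp add: power2_eq_square algebra_simps)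
      finally have "(norm (g z - h z))\<^sup>2 * gauss lam z
        \<le> (2 * (norm (q t z - g z))\<^sup>2 + 2 * (norm (q t z - h z))\<^sup>2) * gauss lam z"
        by (rule mult_right_mono) (simp add: gauss_def)
      then show ?thesis by (simp add: algebra_simps)
    qed
    have "ennreal ((norm (g z - h z))\<^sup>2 * gauss lam z) \<le>
      2 * ennreal ((norm (q t z - g z))\<^sup>2 * gauss lam z) + 2 * ennreal ((norm (q t z - h z))\<^sup>2 * gauss lam z)" for z
    proof -
      have "ennreal (2 * x + 2 * y) = 2 * ennreal x + 2 * ennreal y" if "x \<ge> 0" "y \<ge> 0" for x y
        using that by (simp add: ennreal_plus ennreal_mult')
      then show ?thesis
        using ennreal_leI[OF pw[of z]] by (simp add: gauss_def)
    qed
    then have "fock_nrm2 lam (\<lambda>z. g z - h z) \<le> (\<integral>\<^sup>+z. 2 * ennreal ((norm (q t z - g z))\<^sup>2 * gauss lam z)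
        + 2 * ennreal ((norm (q t z - h z))\<^sup>2 * gauss lam z) \<partial>dm lam)"
      unfolding fock_nrm2_def by (intro nn_integral_mono)
    also have "\<dots> = 2 * fock_nrm2 lam (\<lambda>z. q t z - g z) + 2 * fock_nrm2 lam (\<lambda>z. q t z - h z)"
      unfolding fock_nrm2_def by (subst nn_integral_add) (auto simp: nn_integral_cmult)
    finally show ?case .
  qed
  moreover have "((\<lambda>t. 2 * fock_nrm2 lam (\<lambda>z. q t z - g z) + 2 * fock_nrm2 lam (\<lambda>z. q t z - h z)) \<longlongrightarrow> 2 * 0 + 2 * 0) (at 0)"
    using lim by (intro tendsto_add ennreal_tendsto_cmult) auto
  ultimately have "fock_nrm2 lam (\<lambda>z. g z - h z) \<le> 2 * 0 + 2 * 0"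
    by (intro tendsto_lowerbound) auto
  then have "g z - h z = 0" for z
    using g lam by (intro fock_nrm2_eq_0[of lam "\<lambda>z. g z - h z"]) auto
  then show ?thesis by auto
qed

text \<open>Factor out \<open>exp b\<close> and estimate \<open>exp (a - b) - 1\<close> by Taylor's
  formula. The factor \<open>norm (a - b)\<close> is kept because it is of first order in the
  increment and survives division by it.\<close>

lemma norm_exp_diff_le:
  fixes a b :: complex
  shows "norm (exp a - exp b) \<le> norm (a - b) * exp (norm (a - b) + norm b)"
proof -
  have "norm (exp (a - b) - 1) \<le> exp \<bar>Re (a - b)\<bar> * norm (a - b)"
    using Taylor_exp[of "a - b" 0] by simp
  also have "\<dots> \<le> exp (norm (a - b)) * norm (a - b)"
    using abs_Re_le_cmod[of "a - b"] by (intro mult_right_mono) simp_all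
  finally have 1: "norm (exp (a - b) - 1) \<le> exp (norm (a - b)) * norm (a - b)" .
  have "norm (exp a - exp b) = norm (exp b) * norm (exp (a - b) - 1)"
  proof -
    have "exp a - exp b = exp b * (exp (a - b) - 1)" by (simp add: exp_diff field_simps)
    then show ?thesis by (simp only: norm_mult)
  qed
  also have "\<dots> \<le> exp (norm b) * (exp (norm (a - b)) * norm (a - b))"
    using 1 by (intro mult_mono norm_exp) auto
  finally show ?thesis by (simp add: exp_add mult.commute mult.left_commute)
qed

text \<open>Dominated convergence. The linear bound on \<open>E 0\<close> costs nothing against the
  Gaussian weight, and for small t the quadratic part of \<open>E t - E 0\<close> has a small
  coefficient, so all difference quotients lie below one function whose square is integrable against
  the weight.\<close>

lemma fock_derivative_exp:
  fixes E :: "real \<Rightarrow> complex^'n \<Rightarrow> complex"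
  assumes lam: "lam > 0"
    and bound: "\<forall>\<^sub>F t in at 0. \<forall>z. norm (E t z - E 0 z) \<le> K * \<bar>t\<bar> * (1 + norm z)\<^sup>2"
    and bound0: "\<And>z. norm (E 0 z) \<le> M * (1 + norm z)"
    and deriv: "\<And>z. ((\<lambda>t. E t z) has_vector_derivative E' z) (at 0)"
    and meas: "\<forall>\<^sub>F t in at 0. E t \<in> borel_measurable borel"
      "E 0 \<in> borel_measurable borel" "E' \<in> borel_measurable borel"
  shows "((\<lambda>t. fock_nrm2 lam (\<lambda>z. (exp (E t z) - exp (E 0 z)) / of_real t - E' z * exp (E 0 z)))
    \<longlongrightarrow> 0) (at 0)"
proof -
  define K' where "K' = \<bar>K\<bar> + 1"
  define M' where "M' = \<bar>M\<bar>"
  \<comment> \<open>This makes \<open>\<kappa> = lam / 16\<close>, so that the square of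
    \<open>D\<close> has rate \<open>2 * \<kappa> = lam / 8\<close>, safely below
    \<open>lam / 2\<close>.\<close>
  define \<delta> where "\<delta> = lam / (16 * K')"
  have K': "K' > 0" "K \<le> K'" and M': "M' \<ge> 0" "M \<le> M'"
    by (auto simp: K'_def M'_def)
  have \<delta>: "\<delta> > 0" "K' * \<delta> = lam / 16"
    using lam K'(1) by (auto simp: \<delta>_def)
  define q where "q t z = (exp (E t z) - exp (E 0 z)) / of_real t" for t z
  define g where "g z = E' z * exp (E 0 z)" for z
  define \<kappa> where "\<kappa> = K' * \<delta>"
  \<comment> \<open>Obtained from \<open>norm_exp_diff_le\<close> with
    \<open>\<kappa> * (1 + r)^2\<close> for the difference of exponents and
    \<open>M' * (1 + r)\<close> for \<open>E 0\<close>; the polynomial factor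
    \<open>(1 + r)^2\<close> is replaced by \<open>exp (2 * r)\<close>, whence the summand 2 in the
    linear coefficient.\<close>
  define D where "D z = K' * exp (\<kappa> + M') * exp (\<kappa> * (norm z)\<^sup>2 + (2 + 2 * \<kappa> + M') * norm z)" for z :: "complex^'n"
  have qD: "norm (q t z) \<le> D z"
    if "\<forall>z. norm (E t z - E 0 z) \<le> K * \<bar>t\<bar> * (1 + norm z)\<^sup>2" "t \<noteq> 0" "\<bar>t\<bar> < \<delta>" for t z
  proof -
    define r where "r = norm z"
    have r: "r \<ge> 0" by (simp add: r_def)
    have d: "norm (E t z - E 0 z) \<le> K' * \<bar>t\<bar> * (1 + r)\<^sup>2"
    proof -
      have "K * \<bar>t\<bar> * (1 + r)\<^sup>2 \<le> K' * \<bar>t\<bar> * (1 + r)\<^sup>2"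
        using K' by (intro mult_right_mono) auto
      with that(1) show ?thesis by (metis order_trans r_def)
    qed
    have "K' * \<bar>t\<bar> * (1 + r)\<^sup>2 \<le> \<kappa> * (1 + r)\<^sup>2"
      unfolding \<kappa>_def using K' that(3) by (intro mult_right_mono mult_left_mono) auto
    with d have d': "norm (E t z - E 0 z) \<le> \<kappa> * (1 + r)\<^sup>2" by simp
    have e0: "norm (E 0 z) \<le> M' * (1 + r)"
      using bound0[of z] M' r mult_right_mono[of M M' "1 + r"] by (simp add: r_def)
    have "(1 + r)\<^sup>2 \<le> (exp r)\<^sup>2" using r exp_ge_add_one_self[of r] by (intro power_mono) auto
    then have sq: "(1 + r)\<^sup>2 \<le> exp (2 * r)" by (simp add: exp_double)
    have "norm (exp (E t z) - exp (E 0 z)) \<le> (K' * \<bar>t\<bar> * exp (2 * r)) * exp (\<kappa> * (1 + r)\<^sup>2 + M' * (1 + r))"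
    proof (rule order_trans[OF norm_exp_diff_le mult_mono])
      show "norm (E t z - E 0 z) \<le> K' * \<bar>t\<bar> * exp (2 * r)"
        using K' sq by (intro order_trans[OF d] mult_left_mono) auto
    qed (use d' e0 K' in auto)
    also have "\<dots> = \<bar>t\<bar> * D z"
      by (simp add: D_def r_def exp_add[symmetric] power2_eq_square algebra_simps)
    finally show ?thesis
      using that(2) by (simp add: q_def norm_divide field_simps)
  qed
  have ev: "\<forall>\<^sub>F t in at 0. (\<forall>z. norm (q t z) \<le> D z) \<and> E t \<in> borel_measurable borel"
    using bound meas(1) eventually_at_ball[OF \<delta>(1), of "0::real" UNIV] eventually_neq_at_within[of 0 0 UNIV]
    by eventually_elim (auto intro!: qD simp: dist_norm)
  have lim: "((\<lambda>t. q t z) \<longlongrightarrow> g z) (at 0)" for z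
  proof -
    have "((\<lambda>t. exp (E t z)) has_vector_derivative E' z * exp (E 0 z)) (at 0)"
      using field_vector_diff_chain_at[OF deriv[of z], of exp "exp (E 0 z)"] by (simp add: o_def DERIV_exp)
    from has_vector_derivative_quotient[OF this] show ?thesis
      by (simp add: q_def g_def scaleR_conv_of_real divide_inverse mult.commute)
  qed
  have gD: "norm (g z) \<le> D z" for z
  proof (rule Lim_norm_ubound[OF _ lim])
    show "\<forall>\<^sub>F t in at 0. norm (q t z) \<le> D z" using ev by eventually_elim auto
  qed simp
  have [measurable]: "E 0 \<in> borel_measurable borel" "E' \<in> borel_measurable borel" using meas by auto
  have gm[measurable]: "g \<in> borel_measurable borel" unfolding g_def by measurable
  have Dm[measurable]: "D \<in> borel_measurable borel" unfolding D_def by measurable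
  have Dpos: "D z \<ge> 0" for z using K' by (simp add: D_def)
  have "gauss_bounded (2 * \<kappa>) (\<lambda>z. of_real (4 * (D z)\<^sup>2))"
  proof (rule gauss_boundedI)
    fix z
    show "norm (complex_of_real (4 * (D z)\<^sup>2)) \<le> 4 * (K' * exp (\<kappa> + M'))\<^sup>2 * exp (2 * \<kappa> * (norm z)\<^sup>2 + 2 * (2 + 2 * \<kappa> + M') * norm z)"
      by (simp add: D_def power_mult_distrib norm_mult norm_power exp_double[symmetric] algebra_simps)
  qed
  then have "integrable lborel (\<lambda>z. complex_of_real (4 * (D z)\<^sup>2) * of_real (gauss lam z))"
    using lam \<delta> by (intro integrable_gauss_bounded[where a="2 * \<kappa>"]) (auto simp: \<kappa>_def)
  then have "integrable (dm lam) (\<lambda>z. complex_of_real (4 * (D z)\<^sup>2) * of_real (gauss lam z))"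
    using lam by (subst integral_dm(2)) auto
  then have Dfin: "(\<integral>\<^sup>+z. ennreal (4 * (D z)\<^sup>2 * gauss lam z) \<partial>dm lam) < \<infinity>"
    by (simp add: integrable_iff_bounded norm_mult gauss_def norm_power)
  show ?thesis
    unfolding q_def[symmetric] g_def[symmetric] tendsto_at_iff_sequentially
  proof (intro allI impI)
    fix X :: "nat \<Rightarrow> real"
    assume X: "\<forall>i. X i \<in> UNIV - {0}" "X \<longlonglongrightarrow> 0"
    then have "filterlim X (at 0) sequentially"
      by (auto simp: filterlim_at)
    \<comment> \<open>The majorant holds only for small t, so dominated convergence is applied to
      the sequence with its first \<open>N\<close> terms cut off.\<close>
    from eventually_compose_filterlim[OF ev this]
    obtain N where N: "\<And>i. i \<ge> N \<Longrightarrow> (\<forall>z. norm (q (X i) z) \<le> D z) \<and> E (X i) \<in> borel_measurable borel"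
      by (auto simp: eventually_sequentially)
    have qm: "q (X (i + N)) \<in> borel_measurable borel" for i
    proof -
      have [measurable]: "E (X (i + N)) \<in> borel_measurable borel" using N by auto
      show ?thesis unfolding q_def by measurable
    qed
    have "(\<lambda>i. \<integral>\<^sup>+z. ennreal ((norm (q (X (i + N)) z - g z))\<^sup>2 * gauss lam z) \<partial>dm lam) \<longlonglongrightarrow> (\<integral>\<^sup>+z. 0 \<partial>(dm lam :: (complex^'n) measure))"
    proof (rule nn_integral_dominated_convergence[where w="\<lambda>z. ennreal (4 * (D z)\<^sup>2 * gauss lam z)"])
      show "(\<lambda>z. ennreal ((norm (q (X (j + N)) z - g z))\<^sup>2 * gauss lam z)) \<in> borel_measurable (dm lam)" for j
        using qm[of j] by measurable
      show "AE z in dm lam. ennreal ((norm (q (X (j + N)) z - g z))\<^sup>2 * gauss lam z) \<le> ennreal (4 * (D z)\<^sup>2 * gauss lam z)" for j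
      proof (rule AE_I2)
        fix z
        have "norm (q (X (j + N)) z - g z) \<le> 2 * D z"
          using N[of "j + N"] gD[of z] norm_triangle_ineq4[of "q (X (j + N)) z" "g z"] by (smt (verit) le_add2)
        then have "(norm (q (X (j + N)) z - g z))\<^sup>2 \<le> (2 * D z)\<^sup>2" by (rule power_mono) simp
        then show "ennreal ((norm (q (X (j + N)) z - g z))\<^sup>2 * gauss lam z) \<le> ennreal (4 * (D z)\<^sup>2 * gauss lam z)"
          by (intro ennreal_leI mult_right_mono) (auto simp: gauss_def power_mult_distrib)
      qed
      show "(\<integral>\<^sup>+z. ennreal (4 * (D z)\<^sup>2 * gauss lam z) \<partial>dm lam) < \<infinity>" by (rule Dfin)
      show "AE z in dm lam. (\<lambda>i. ennreal ((norm (q (X (i + N)) z - g z))\<^sup>2 * gauss lam z)) \<longlonglongrightarrow> 0"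
      proof (rule AE_I2)
        fix z
        have "(\<lambda>i. q (X i) z) \<longlonglongrightarrow> g z"
          using lim[of z, unfolded tendsto_at_iff_sequentially] X by (auto simp: o_def)
        from LIMSEQ_ignore_initial_segment[OF this, of N]
        have "(\<lambda>i. ennreal ((norm (q (X (i + N)) z - g z))\<^sup>2 * gauss lam z)) \<longlonglongrightarrow> ennreal ((norm (g z - g z))\<^sup>2 * gauss lam z)"
          by (intro tendsto_intros)
        then show "(\<lambda>i. ennreal ((norm (q (X (i + N)) z - g z))\<^sup>2 * gauss lam z)) \<longlonglongrightarrow> 0" by simp
      qed
    qed auto
    then have "(\<lambda>i. fock_nrm2 lam (\<lambda>z. q (X (i + N)) z - g z)) \<longlonglongrightarrow> 0"
      by (simp add: fock_nrm2_def)
    then show "((\<lambda>t. fock_nrm2 lam (\<lambda>z. q t z - g z)) \<circ> X) \<longlonglongrightarrow> 0"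
      unfolding o_def by (rule LIMSEQ_offset)
  qed
qed

text \<open>Difference quotients at \<open>t = 0\<close> bounded by a polynomial of degree d in
  \<open>norm z\<close>, uniformly for small t. The bound on \<open>f 0\<close> is included because
  the product rule needs it; with it the class is closed under sums and bounded bilinear maps, and
  the estimate for a polynomial exponent can be assembled term by term.\<close>

definition quot_bounded ::
  "nat \<Rightarrow> (real \<Rightarrow> 'v::real_normed_vector \<Rightarrow> 'w::real_normed_vector) \<Rightarrow> bool"
  where "quot_bounded d f \<longleftrightarrow> (\<exists>K. (\<forall>\<^sub>F t in at 0. \<forall>z. norm (f t z - f 0 z) \<le> K * \<bar>t\<bar> * (1 + norm z) ^ d)
    \<and> (\<forall>z. norm (f 0 z) \<le> K * (1 + norm z) ^ d))"

lemma quot_boundedI: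
  assumes "\<forall>\<^sub>F t in at 0. \<forall>z. norm (f t z - f 0 z) \<le> K * \<bar>t\<bar> * (1 + norm z) ^ d"
    and "\<And>z. norm (f 0 z) \<le> L * (1 + norm z) ^ d"
  shows "quot_bounded d f"
  unfolding quot_bounded_def
proof (intro exI[of _ "max K L"] conjI allI)
  show "\<forall>\<^sub>F t in at 0. \<forall>z. norm (f t z - f 0 z) \<le> max K L * \<bar>t\<bar> * (1 + norm z) ^ d"
    using assms(1)
  proof eventually_elim
    case (elim t)
    have "K * \<bar>t\<bar> * (1 + norm z) ^ d \<le> max K L * \<bar>t\<bar> * (1 + norm z) ^ d" for z :: 'a
      by (intro mult_right_mono) auto
    with elim show ?case by (meson order_trans)
  qed
  have "L * (1 + norm z) ^ d \<le> max K L * (1 + norm z) ^ d" for z :: 'a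
    by (intro mult_right_mono) auto
  with assms(2) show "norm (f 0 z) \<le> max K L * (1 + norm z) ^ d" for z by (meson order_trans)
qed

lemma quot_boundedE:
  assumes "quot_bounded d f"
  obtains K where "K \<ge> 0" "\<forall>\<^sub>F t in at 0. \<forall>z. norm (f t z - f 0 z) \<le> K * \<bar>t\<bar> * (1 + norm z) ^ d"
    "\<And>z. norm (f 0 z) \<le> K * (1 + norm z) ^ d"
proof -
  obtain K where K: "\<forall>\<^sub>F t in at 0. \<forall>z. norm (f t z - f 0 z) \<le> K * \<bar>t\<bar> * (1 + norm z) ^ d"
    "\<And>z. norm (f 0 z) \<le> K * (1 + norm z) ^ d"
    using assms unfolding quot_bounded_def by blast
  have "0 \<le> norm (f 0 0)" by simp
  also have "\<dots> \<le> K" using K(2)[of 0] by simp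
  finally show ?thesis using K that by blast
qed

lemma quot_bounded_mono:
  assumes "quot_bounded d f" "d \<le> e" shows "quot_bounded e f"
proof -
  obtain K where K: "K \<ge> 0" "\<forall>\<^sub>F t in at 0. \<forall>z. norm (f t z - f 0 z) \<le> K * \<bar>t\<bar> * (1 + norm z) ^ d"
    "\<And>z. norm (f 0 z) \<le> K * (1 + norm z) ^ d"
    using quot_boundedE[OF assms(1)] by blast
  have p: "(1 + norm z) ^ d \<le> (1 + norm z) ^ e" for z :: 'a
    using assms(2) by (intro power_increasing) auto
  show ?thesis
  proof (rule quot_boundedI)
    show "\<forall>\<^sub>F t in at 0. \<forall>z. norm (f t z - f 0 z) \<le> K * \<bar>t\<bar> * (1 + norm z) ^ e"
      using K(2)
    proof eventually_elim
      case (elim t)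
      then show ?case
        using mult_left_mono[OF p, of "K * \<bar>t\<bar>"] K(1) by (meson abs_ge_zero mult_nonneg_nonneg order_trans)
    qed
    show "norm (f 0 z) \<le> K * (1 + norm z) ^ e" for z
      using K(3)[of z] mult_left_mono[OF p[of z] K(1)] by linarith
  qed
qed

lemma quot_bounded_add:
  assumes "quot_bounded d f" "quot_bounded d g" shows "quot_bounded d (\<lambda>t z. f t z + g t z)"
proof -
  obtain K where K: "K \<ge> 0" "\<forall>\<^sub>F t in at 0. \<forall>z. norm (f t z - f 0 z) \<le> K * \<bar>t\<bar> * (1 + norm z) ^ d"
    "\<And>z. norm (f 0 z) \<le> K * (1 + norm z) ^ d"
    using quot_boundedE[OF assms(1)] by blast
  obtain L where L: "L \<ge> 0" "\<forall>\<^sub>F t in at 0. \<forall>z. norm (g t z - g 0 z) \<le> L * \<bar>t\<bar> * (1 + norm z) ^ d"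
    "\<And>z. norm (g 0 z) \<le> L * (1 + norm z) ^ d"
    using quot_boundedE[OF assms(2)] by blast
  show ?thesis
  proof (rule quot_boundedI)
    show "\<forall>\<^sub>F t in at 0. \<forall>z. norm (f t z + g t z - (f 0 z + g 0 z)) \<le> (K + L) * \<bar>t\<bar> * (1 + norm z) ^ d"
      using K(2) L(2)
    proof eventually_elim
      case (elim t)
      show ?case
      proof
        fix z
        have "norm (f t z + g t z - (f 0 z + g 0 z)) \<le> norm (f t z - f 0 z) + norm (g t z - g 0 z)"
          using norm_triangle_ineq[of "f t z - f 0 z" "g t z - g 0 z"] by (simp add: algebra_simps)
        also have "\<dots> \<le> K * \<bar>t\<bar> * (1 + norm z) ^ d + L * \<bar>t\<bar> * (1 + norm z) ^ d"
          using elim by (intro add_mono) auto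
        finally show "norm (f t z + g t z - (f 0 z + g 0 z)) \<le> (K + L) * \<bar>t\<bar> * (1 + norm z) ^ d"
          by (simp add: algebra_simps)
      qed
    qed
    show "norm (f 0 z + g 0 z) \<le> (K + L) * (1 + norm z) ^ d" for z
      using norm_triangle_ineq[of "f 0 z" "g 0 z"] K(3)[of z] L(3)[of z] by (simp add: algebra_simps)
  qed
qed

text \<open>The increment of \<open>h (f t z) (g t z)\<close> splits into three bilinear terms,
  which accounts for the constant 3. The term containing both increments is of second order;
  \<open>\<bar>t\<bar> \<le> 1\<close> brings it down to first order.\<close>

lemma quot_bounded_bilinear:
  fixes f :: "real \<Rightarrow> 'v::real_normed_vector \<Rightarrow> 'a::real_normed_vector"
    and g :: "real \<Rightarrow> 'v \<Rightarrow> 'b::real_normed_vector"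
  assumes "bounded_bilinear h" and "quot_bounded d f" "quot_bounded e g"
  shows "quot_bounded (d + e) (\<lambda>t z. h (f t z) (g t z))"
proof -
  interpret h: bounded_bilinear h by fact
  obtain B where B: "B > 0" "\<And>x y. norm (h x y) \<le> norm x * norm y * B" using h.pos_bounded by blast
  obtain K where K: "K \<ge> 0" "\<forall>\<^sub>F t in at 0. \<forall>z. norm (f t z - f 0 z) \<le> K * \<bar>t\<bar> * (1 + norm z) ^ d"
    "\<And>z. norm (f 0 z) \<le> K * (1 + norm z) ^ d"
    using quot_boundedE[OF assms(2)] by blast
  obtain L where L: "L \<ge> 0" "\<forall>\<^sub>F t in at 0. \<forall>z. norm (g t z - g 0 z) \<le> L * \<bar>t\<bar> * (1 + norm z) ^ e"
    "\<And>z. norm (g 0 z) \<le> L * (1 + norm z) ^ e"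
    using quot_boundedE[OF assms(3)] by blast
  show ?thesis
  proof (rule quot_boundedI)
    show "\<forall>\<^sub>F t in at 0. \<forall>z. norm (h (f t z) (g t z) - h (f 0 z) (g 0 z)) \<le> (3 * K * L * B) * \<bar>t\<bar> * (1 + norm z) ^ (d + e)"
      using K(2) L(2) eventually_at_ball[OF zero_less_one, of "0::real" UNIV]
    proof eventually_elim
      case (elim t)
      then have t: "\<bar>t\<bar> \<le> 1" by (simp add: dist_norm)
      show ?case
      proof
        fix z :: 'v
        define r where "r = 1 + norm z"
        have r: "r ^ d \<ge> 0" "r ^ e \<ge> 0" by (auto simp: r_def)
        have f: "norm (f t z - f 0 z) \<le> K * \<bar>t\<bar> * r ^ d" and g: "norm (g t z - g 0 z) \<le> L * \<bar>t\<bar> * r ^ e"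
          and f0: "norm (f 0 z) \<le> K * r ^ d" and g0: "norm (g 0 z) \<le> L * r ^ e"
          using elim(1)[rule_format, of z] elim(2)[rule_format, of z] K(3)[of z] L(3)[of z] by (simp_all only: r_def)
        have f1: "norm (f t z - f 0 z) \<le> K * r ^ d"
        proof (rule order_trans[OF f mult_right_mono])
          show "K * \<bar>t\<bar> \<le> K" using mult_left_mono[OF t K(1)] by simp
        qed (rule r)
        have "h (f t z) (g t z) - h (f 0 z) (g 0 z) =
          h (f t z - f 0 z) (g t z - g 0 z) + h (f 0 z) (g t z - g 0 z) + h (f t z - f 0 z) (g 0 z)"
          by (simp add: h.diff_left h.diff_right)
        then have "norm (h (f t z) (g t z) - h (f 0 z) (g 0 z)) \<le> norm (h (f t z - f 0 z) (g t z - g 0 z))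
            + norm (h (f 0 z) (g t z - g 0 z)) + norm (h (f t z - f 0 z) (g 0 z))"
          by (simp only:) (intro order_trans[OF norm_triangle_ineq] add_right_mono norm_triangle_ineq)
        also have "\<dots> \<le> (K * r ^ d) * (L * \<bar>t\<bar> * r ^ e) * B + (K * r ^ d) * (L * \<bar>t\<bar> * r ^ e) * B
            + (K * \<bar>t\<bar> * r ^ d) * (L * r ^ e) * B"
          using f g f0 g0 f1 B(1) K(1) L(1) r
          by (intro add_mono order_trans[OF B(2)] mult_right_mono mult_mono) auto
        also have "\<dots> = (3 * K * L * B) * \<bar>t\<bar> * r ^ (d + e)"
          by (simp add: power_add algebra_simps)
        finally show "norm (h (f t z) (g t z) - h (f 0 z) (g 0 z)) \<le> (3 * K * L * B) * \<bar>t\<bar> * (1 + norm z) ^ (d + e)"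
          by (simp add: r_def)
      qed
    qed
    fix z
    have "norm (h (f 0 z) (g 0 z)) \<le> (K * (1 + norm z) ^ d) * (L * (1 + norm z) ^ e) * B"
      using K L B(1) by (intro order_trans[OF B(2)] mult_right_mono mult_mono) auto
    then show "norm (h (f 0 z) (g 0 z)) \<le> (K * L * B) * (1 + norm z) ^ (d + e)"
      by (simp add: power_add algebra_simps)
  qed
qed

text \<open>The quotients converge to \<open>D\<close>, hence are eventually below
  \<open>norm D + 1\<close>. Curves enter the calculus as families of degree 0, constant in
  z.\<close>

lemma quot_bounded_has_vector_derivative:
  assumes "(f has_vector_derivative D) (at 0)" shows "quot_bounded 0 (\<lambda>t _. f t)"
proof (rule quot_boundedI[where L="norm (f 0)"])
  have "((\<lambda>h. norm ((f (0 + h) - f 0) /\<^sub>R h)) \<longlongrightarrow> norm D) (at 0)"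
    by (intro tendsto_norm has_vector_derivative_quotient assms)
  then have "\<forall>\<^sub>F h in at 0. norm ((f (0 + h) - f 0) /\<^sub>R h) < norm D + 1"
    by (rule order_tendstoD) simp
  then show "\<forall>\<^sub>F t in at 0. \<forall>z::'b. norm (f t - f 0) \<le> (norm D + 1) * \<bar>t\<bar> * (1 + norm z) ^ 0"
    using eventually_neq_at_within[of 0 0 UNIV]
  proof eventually_elim
    case (elim t)
    then have "norm (f t - f 0) / \<bar>t\<bar> < norm D + 1"
      by (simp add: divide_inverse mult.commute)
    with elim(2) show ?case by (simp add: pos_divide_less_eq less_imp_le)
  qed
qed simp

lemma quot_bounded_const: "quot_bounded 0 (\<lambda>_ _. c)"
  by (rule quot_bounded_has_vector_derivative[where D=0]) simp

lemma quot_bounded_bounded_linear: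
  assumes "bounded_linear L" shows "quot_bounded 1 (\<lambda>_. L)"
proof -
  obtain K where "\<And>x. norm (L x) \<le> norm x * K" "K \<ge> 0"
    using bounded_linear.nonneg_bounded[OF assms] by blast
  then have "norm (L z) \<le> K * (1 + norm z) ^ 1" for z
    by (simp add: algebra_simps add_increasing)
  then show ?thesis by (intro quot_boundedI[where K=0 and L=K]) simp_all
qed

section \<open>Matrix norms and the derivatives of determinant and inverse at the identity\<close>

lemma norm_matrix_vector_mult_le: "norm (N *v x) \<le> norm N * norm (x::complex^'n)"
proof -
  have "norm (N *v x) = L2_set (\<lambda>i. norm (N $ i \<odot> x)) UNIV"
    unfolding norm_vec_def[of "N *v x"] by (simp add: matrix_vector_mult_def cdot_def)
  also have "\<dots> \<le> L2_set (\<lambda>i. norm (N $ i) * norm x) UNIV"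
    by (intro L2_set_mono norm_cdot_le) auto
  also have "\<dots> = norm N * norm x"
    unfolding norm_vec_def[of N] by (simp add: L2_set_left_distrib)
  finally show ?thesis .
qed

lemma bounded_bilinear_matrix_vector_mult:
  "bounded_bilinear ((*v) :: complex^'n^'m \<Rightarrow> complex^'n \<Rightarrow> complex^'m)"
proof
  show "\<exists>K. \<forall>(a::complex^'n^'m) b. norm (a *v b) \<le> norm a * norm b * K"
    by (intro exI[of _ 1]) (simp add: norm_matrix_vector_mult_le)
qed (auto simp: matrix_vector_mult_def vec_eq_iff sum.distrib algebra_simps scaleR_sum_right)

lemma norm_transpose: "norm (transpose (N::complex^'n^'m)) = norm N"
proof -
  have n: "norm M = sqrt (\<Sum>i\<in>UNIV. \<Sum>j\<in>UNIV. (norm (M $ i $ j))\<^sup>2)" for M :: "complex^'k^'l"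
    by (simp add: norm_vec_def L2_set_def sum_nonneg)
  show ?thesis
    unfolding n by (subst sum.swap) (simp add: transpose_def)
qed

text \<open>On nested vectors \<open>norm\<close> is the Frobenius norm. Row i of
  \<open>A ** B\<close> is \<open>transpose B\<close> applied to row i of \<open>A\<close>, so the
  matrix-vector estimate is summed over the rows.\<close>

lemma norm_matrix_mult_le: "norm (A ** B) \<le> norm A * norm (B::complex^'n^'k)"
proof -
  have "(A ** B) $ i = transpose B *v (A $ i)" for i
    by (simp add: matrix_matrix_mult_def matrix_vector_mult_def transpose_def vec_eq_iff mult.commute)
  then have "norm (A ** B) = L2_set (\<lambda>i. norm (transpose B *v (A $ i))) UNIV"
    unfolding norm_vec_def[of "A ** B"] by simp
  also have "\<dots> \<le> L2_set (\<lambda>i. norm B * norm (A $ i)) UNIV"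
    using norm_matrix_vector_mult_le[of "transpose B"] by (intro L2_set_mono) (auto simp: norm_transpose)
  also have "\<dots> = norm A * norm B"
    unfolding norm_vec_def[of A] by (simp add: L2_set_right_distrib mult.commute)
  finally show ?thesis .
qed

lemma bounded_bilinear_matrix_mult:
  "bounded_bilinear ((**) :: complex^'k^'m \<Rightarrow> complex^'n^'k \<Rightarrow> complex^'n^'m)"
proof
  show "\<exists>K. \<forall>(a::complex^'k^'m) (b::complex^'n^'k). norm (a ** b) \<le> norm a * norm b * K"
    by (intro exI[of _ 1]) (simp add: norm_matrix_mult_le)
qed (auto simp: matrix_matrix_mult_def vec_eq_iff sum.distrib algebra_simps scaleR_sum_right)

text \<open>Jacobi's formula at the identity, from the Leibniz expansion. The product rule removes
  one factor i from each product; a permutation other than \<open>id\<close> moves at least two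
  points (with i it also moves \<open>p i\<close>), so an off-diagonal entry of \<open>mat 1\<close>
  remains and only \<open>id\<close> contributes.\<close>

lemma has_vector_derivative_det_one:
  fixes M :: "real \<Rightarrow> complex^'n^'n"
  assumes M: "(M has_vector_derivative D) (at 0)" and M0: "M 0 = mat 1"
  shows "((\<lambda>t. det (M t)) has_vector_derivative trace D) (at 0)"
proof -
  let ?P = "{p. p permutes (UNIV :: 'n set)}"
  have e: "((\<lambda>t. M t $ i $ j) has_derivative (\<lambda>y. y *\<^sub>R (D $ i $ j))) (at 0)" for i j
    using bounded_linear.has_vector_derivative[OF bounded_linear_vec_nth
        bounded_linear.has_vector_derivative[OF bounded_linear_vec_nth M, of i], of j]
    by (simp add: has_vector_derivative_def)
  have "((\<lambda>t. det (M t)) has_derivative (\<lambda>y. \<Sum>p\<in>?P. of_int (sign p) *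
      (\<Sum>i\<in>UNIV. (y *\<^sub>R (D $ i $ p i)) * (\<Prod>j\<in>UNIV - {i}. M 0 $ j $ p j)))) (at 0)"
    unfolding det_def
    by (intro has_derivative_sum has_derivative_mult_right has_derivative_prod e)
  moreover have "(\<Sum>p\<in>?P. of_int (sign p) *
      (\<Sum>i\<in>UNIV. (y *\<^sub>R (D $ i $ p i)) * (\<Prod>j\<in>UNIV - {i}. M 0 $ j $ p j))) = y *\<^sub>R trace D" for y
  proof -
    have z: "(\<Prod>j\<in>UNIV - {i}. M 0 $ j $ p j) = 0" if "p \<in> ?P - {id}" for p i
    proof -
      have inj: "inj p" using that permutes_inj by auto
      from that have "p \<noteq> id" by simp
      then obtain k where k: "p k \<noteq> k" unfolding fun_eq_iff by auto
      have "\<exists>j. j \<noteq> i \<and> p j \<noteq> j"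
      proof (cases "k = i")
        case True
        then have "p (p i) \<noteq> p i" "p i \<noteq> i" using k inj by (auto dest: injD)
        then show ?thesis by blast
      qed (use k in blast)
      then obtain j where "j \<noteq> i" "j \<noteq> p j" by metis
      then show ?thesis
        by (intro prod_zero) (auto simp: M0 mat_def intro!: bexI[of _ j])
    qed
    have "(\<Sum>p\<in>?P. of_int (sign p) *
      (\<Sum>i\<in>UNIV. (y *\<^sub>R (D $ i $ p i)) * (\<Prod>j\<in>UNIV - {i}. M 0 $ j $ p j))) =
      (\<Sum>p\<in>{id}. of_int (sign p) *
      (\<Sum>i\<in>UNIV. (y *\<^sub>R (D $ i $ p i)) * (\<Prod>j\<in>UNIV - {i}. M 0 $ j $ p j)))"
    proof (rule sum.mono_neutral_right)
      show "finite ?P" "{id} \<subseteq> ?P" by (auto simp: permutes_id)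
      show "\<forall>p\<in>?P - {id}. of_int (sign p) *
        (\<Sum>i\<in>UNIV. (y *\<^sub>R (D $ i $ p i)) * (\<Prod>j\<in>UNIV - {i}. M 0 $ j $ p j)) = 0"
      proof
        fix p assume "p \<in> ?P - {id}"
        from z[OF this] show "of_int (sign p) *
          (\<Sum>i\<in>UNIV. (y *\<^sub>R (D $ i $ p i)) * (\<Prod>j\<in>UNIV - {i}. M 0 $ j $ p j)) = 0"
          by (simp only: mult_zero_right sum.neutral_const)
      qed
    qed
    also have "\<dots> = y *\<^sub>R trace D"
      by (simp add: sign_id M0 mat_def trace_def scaleR_sum_right)
    finally show ?thesis .
  qed
  ultimately show ?thesis by (simp add: has_vector_derivative_def)
qed

lemma matrix_inv_inverse:
  assumes "invertible A" shows "A ** matrix_inv A = mat 1" "matrix_inv A ** A = mat 1"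
  using someI_ex[OF assms[unfolded invertible_def]] by (auto simp: matrix_inv_def)

lemma matrix_inv_one: "matrix_inv (mat 1) = mat 1"
  using matrix_inv_inverse(1)[of "mat 1"] by (simp add: invertible_def)

text \<open>Everything follows from \<open>N t - I = - (N t ** (M t - I))\<close>. Once
  \<open>norm (M t - I) < 1/2\<close> it bounds \<open>norm (N t)\<close> by
  \<open>2 * norm I\<close>; then it shows that \<open>N t\<close> tends to \<open>I\<close>; and
  divided by t it gives the derivative.\<close>

lemma has_vector_derivative_matrix_inv_one:
  fixes M :: "real \<Rightarrow> complex^'n^'n"
  assumes M: "(M has_vector_derivative D) (at 0)" and M0: "M 0 = mat 1"
  shows "((\<lambda>t. matrix_inv (M t)) has_vector_derivative - D) (at 0)"
proof -
  let ?I = "mat 1 :: complex^'n^'n"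
  define N where "N t = matrix_inv (M t)" for t
  interpret mm: bounded_bilinear "(**) :: complex^'n^'n \<Rightarrow> complex^'n^'n \<Rightarrow> complex^'n^'n"
    by (rule bounded_bilinear_matrix_mult)
  have N0: "N 0 = ?I" by (simp add: N_def M0 matrix_inv_one)
  have "((\<lambda>t. det (M t)) \<longlongrightarrow> det (M 0)) (at 0)"
    using has_vector_derivative_continuous[OF has_vector_derivative_det_one[OF M M0]] isContD continuous_within by blast
  then have "\<forall>\<^sub>F t in at 0. det (M t) \<noteq> 0"
    by (rule tendsto_imp_eventually_ne) (simp add: M0)
  then have diff: "\<forall>\<^sub>F t in at 0. N t - ?I = - (N t ** (M t - ?I))"
  proof eventually_elim
    case (elim t)
    then have "N t ** M t = ?I" using matrix_inv_inverse(2)[of "M t"] by (simp add: N_def invertible_det_nz)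
    then show ?case by (simp add: mm.diff_right)
  qed
  have M1: "((\<lambda>t. norm (M t - ?I)) \<longlongrightarrow> 0) (at 0)"
    using has_vector_derivative_continuous[OF M] M0
    by (simp add: continuous_within tendsto_norm_zero_iff LIM_zero_iff)
  from order_tendstoD(2)[OF M1, of "1/2"]
  have "\<forall>\<^sub>F t in at 0. norm (M t - ?I) < 1 / 2" by simp
  with diff have Nb: "\<forall>\<^sub>F t in at 0. norm (N t - ?I) \<le> 2 * norm ?I * norm (M t - ?I)"
  proof eventually_elim
    case (elim t)
    have d: "norm (N t - ?I) \<le> norm (N t) * norm (M t - ?I)"
      using elim norm_matrix_mult_le[of "N t" "M t - ?I"] by simp
    have "norm (N t) \<le> 2 * norm ?I"
    proof -
      have "norm (N t) \<le> norm ?I + norm (N t - ?I)"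
        using norm_triangle_ineq[of ?I "N t - ?I"] by simp
      also have "\<dots> \<le> norm ?I + norm (N t) * (1 / 2)"
        using d elim(2) mult_left_mono[of "norm (M t - ?I)" "1/2" "norm (N t)"] by simp
      finally show ?thesis by simp
    qed
    then have "norm (N t) * norm (M t - ?I) \<le> 2 * norm ?I * norm (M t - ?I)"
      by (rule mult_right_mono) simp
    with d show ?case by linarith
  qed
  have "((\<lambda>t. N t - ?I) \<longlongrightarrow> 0) (at 0)"
  proof (rule Lim_null_comparison[OF Nb])
    show "((\<lambda>t. 2 * norm ?I * norm (M t - ?I)) \<longlongrightarrow> 0) (at 0)"
      using tendsto_mult_right_zero[OF M1] by simp
  qed
  then have N1: "(N \<longlongrightarrow> ?I) (at 0)" by (simp add: LIM_zero_iff)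
  have "((\<lambda>h. - (N h ** ((M (0 + h) - M 0) /\<^sub>R h))) \<longlongrightarrow> - (?I ** D)) (at 0)"
    by (intro tendsto_minus mm.tendsto N1 has_vector_derivative_quotient M)
  moreover have "\<forall>\<^sub>F h in at 0. - (N h ** ((M (0 + h) - M 0) /\<^sub>R h)) = (N (0 + h) - N 0) /\<^sub>R h"
    using diff by eventually_elim (simp add: N0 M0 mm.scaleR_right)
  ultimately have "((\<lambda>h. (N (0 + h) - N 0) /\<^sub>R h) \<longlongrightarrow> - (?I ** D)) (at 0)"
    by (rule Lim_transform_eventually)
  then show ?thesis
    unfolding N_def by (intro has_vector_derivativeI_quotient) simp
qed

section \<open>One-parameter subgroups\<close>

lemma sum_UNIV_Plus: "(\<Sum>i\<in>(UNIV::('a::finite + 'b::finite) set). f i) = (\<Sum>a\<in>UNIV. f (Inl a)) + (\<Sum>b\<in>UNIV. f (Inr b))"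
  by (subst UNIV_Plus_UNIV[symmetric], subst sum.Plus) (auto simp: o_def)

lemma vjoin_nth [simp]: "vjoin u v $ Inl a = u $ a" "vjoin u v $ Inr b = v $ b"
  by (simp_all add: vjoin_def)

lemma mblock_nth [simp]:
  "mblock A B C D $ Inl a $ Inl a' = A $ a $ a'" "mblock A B C D $ Inl a $ Inr b = B $ a $ b"
  "mblock A B C D $ Inr b $ Inl a = C $ b $ a" "mblock A B C D $ Inr b $ Inr b' = D $ b $ b'"
  by (simp_all add: mblock_def)

lemma mstar_nth [simp]: "mstar N $ i $ j = cnj (N $ j $ i)"
  by (simp add: mstar_def transpose_def mcnj_def)

definition Jsign :: "'p + 'q \<Rightarrow> complex"
  where "Jsign i = (case i of Inl _ \<Rightarrow> 1 | Inr _ \<Rightarrow> -1)"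

lemma Jsign_simps [simp]: "Jsign (Inl a) = 1" "Jsign (Inr b) = -1" "Jsign i * Jsign i = 1"
  "Jsign i * (Jsign i * x) = x" "cnj (Jsign i) = Jsign i"
  by (auto simp: Jsign_def split: sum.splits)

lemma J0_nth: "J0 $ i $ j = (if i = j then Jsign i else 0)"
  by (cases i; cases j) (auto simp: J0_def mat_def)

lemma J0_mult_nth: "(J0 ** M) $ i $ j = Jsign i * M $ i $ j"
  by (simp add: matrix_matrix_mult_def J0_nth if_distrib[of "\<lambda>x. x * _"] cong: if_cong)

lemma mult_J0_nth: "(M ** J0) $ i $ j = M $ i $ j * Jsign j"
  by (simp add: matrix_matrix_mult_def J0_nth if_distrib[of "\<lambda>x. _ * x"] cong: if_cong)

lemma J0_vec_nth: "(J0 *v x) $ i = Jsign i * x $ i"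
  by (simp add: matrix_vector_mult_def J0_nth if_distrib[of "\<lambda>x. x * _"] cong: if_cong)

text \<open>The defining equation says that \<open>J0 ** mstar k ** J0\<close> is a right inverse of
  k; for square matrices it is then a left inverse.\<close>

lemma SUpq_star:
  assumes "k \<in> SUpq" shows "mstar k ** J0 ** k = J0"
proof -
  have k: "k ** J0 ** mstar k = J0" using assms by (simp add: SUpq_def)
  have JJ: "J0 ** J0 = (mat 1 :: complex^('a + 'b)^('a + 'b))"
    by (simp add: vec_eq_iff J0_mult_nth) (simp add: J0_nth mat_def)
  have "k ** (J0 ** mstar k ** J0) = mat 1"
    using k JJ by (simp add: matrix_mul_assoc)
  then have "(J0 ** mstar k ** J0) ** k = mat 1"
    by (simp add: matrix_left_right_inverse)
  then have "J0 ** ((J0 ** mstar k ** J0) ** k) = J0" by simp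
  then show ?thesis using JJ by (simp add: matrix_mul_assoc)
qed

lemma cdot_matrix_vector_mult: "(N *v x) \<odot> y = x \<odot> (transpose N *v y)"
proof -
  have "(N *v x) \<odot> y = (\<Sum>i\<in>UNIV. \<Sum>j\<in>UNIV. N $ i $ j * x $ j * y $ i)"
    by (simp add: cdot_def matrix_vector_mult_def sum_distrib_right)
  also have "\<dots> = (\<Sum>j\<in>UNIV. \<Sum>i\<in>UNIV. x $ j * (N $ i $ j * y $ i))"
    by (subst sum.swap) (simp add: mult_ac)
  also have "\<dots> = x \<odot> (transpose N *v y)"
    by (simp add: cdot_def matrix_vector_mult_def transpose_def sum_distrib_left)
  finally show ?thesis .
qed

lemma vcnj_matrix_vector_mult: "vcnj (N *v x) = mcnj N *v vcnj x"
  by (simp add: vec_eq_iff matrix_vector_mult_def mcnj_def)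

lemma mcnj_matrix_mult: "mcnj (M ** N) = mcnj M ** mcnj N"
  by (simp add: vec_eq_iff matrix_matrix_mult_def mcnj_def)

text \<open>Invariance of the indefinite Hermitian form: collecting the matrices in the middle
  leaves \<open>transpose k ** J0 ** mcnj k\<close>, which is \<open>J0\<close> by the conjugate of
  \<open>SUpq_star\<close>.\<close>

lemma cdot_J0_SUpq:
  assumes "k \<in> SUpq"
  shows "(k *v x) \<odot> (J0 *v vcnj (k *v y)) = x \<odot> (J0 *v vcnj y)"
proof -
  have "mcnj J0 = (J0 :: complex^('a + 'b)^('a + 'b))"
    by (simp add: vec_eq_iff mcnj_def J0_nth)
  moreover have "mcnj (mstar k) = transpose k"
    by (simp add: vec_eq_iff mcnj_def transpose_def)
  ultimately have "transpose k ** J0 ** mcnj k = J0"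
    using arg_cong[OF SUpq_star[OF assms], of mcnj] by (simp add: mcnj_matrix_mult)
  then show ?thesis
    by (simp add: cdot_matrix_vector_mult vcnj_matrix_vector_mult matrix_vector_mul_assoc matrix_mul_assoc)
qed

text \<open>The symplectic form in the coordinate z alone; as a real bounded bilinear map it can be
  differentiated along curves.\<close>

definition omega_real :: "complex^('p::finite + 'q::finite) \<Rightarrow> complex^('p + 'q) \<Rightarrow> real"
  where "omega_real z w = Re (omega (z, vcnj z) (w, vcnj w))"

lemma omega_real_SUpq: "k \<in> SUpq \<Longrightarrow> omega_real (k *v z) (k *v w) = omega_real z w"
  by (simp add: omega_real_def omega_def cdot_J0_SUpq)

lemma bounded_bilinear_omega_real: "bounded_bilinear omega_real"
proof -
  have J: "J0 *v (x + y) = J0 *v x + J0 *v y" "J0 *v (r *\<^sub>R x) = r *\<^sub>R (J0 *v x)"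
    for x y :: "complex^('a + 'b)" and r :: real
    by (simp_all add: vec_eq_iff J0_vec_nth distrib_left)
  show ?thesis
    unfolding bilinear_conv_bounded_bilinear[symmetric] bilinear_def
    by (intro conjI allI linearI)
      (simp_all add: omega_real_def omega_def vcnj_add vcnj_scaleR J cdot_add_left cdot_add_right
        cdot_scaleR_left cdot_scaleR_right add_divide_distrib diff_divide_distrib right_diff_distrib)
qed

lemma G_mult_vcnj:
  "G_mult ((z, vcnj z), c, k) ((z', vcnj z'), c', k') =
    ((z + k *v z', vcnj (z + k *v z')), c + c' + omega_real z (k *v z') / 2, k ** k')"
  by (simp add: G_mult_def heis_mult_def SU_act_def omega_real_def vcnj_add)

section \<open>One-parameter subgroups as solutions of initial value problems\<close>

lemma has_vector_derivative_unique_primitive: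
  fixes f g :: "real \<Rightarrow> 'a::real_normed_vector"
  assumes "\<And>t. (f has_vector_derivative d t) (at t)" "\<And>t. (g has_vector_derivative d t) (at t)"
    and "f 0 = g 0"
  shows "f t = g t"
proof -
  have "((\<lambda>t. f t - g t) has_vector_derivative 0) (at t within UNIV)" for t
    using has_vector_derivative_diff[OF assms(1)[of t] assms(2)[of t]] by simp
  then obtain c where "\<And>t. f t - g t = c"
    using has_vector_derivative_zero_constant[of UNIV "\<lambda>t. f t - g t"] by auto
  from this[of t] this[of 0] assms(3) show ?thesis by simp
qed

text \<open>The homomorphism property transports the derivative from 0 to t. Both forms are used in
  the uniqueness proof, where \<open>Y\<close> has to appear between two factors coming from
  different subgroups.\<close>

lemma matrix_subgroup_derivative:
  fixes K :: "real \<Rightarrow> complex^'n^'n"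
  assumes add: "\<And>s t. K (s + t) = K s ** K t" and K0: "K 0 = mat 1"
    and d: "(K has_vector_derivative Y) (at 0)"
  shows "(K has_vector_derivative K t ** Y) (at t)" "(K has_vector_derivative Y ** K t) (at t)"
proof -
  interpret mm: bounded_bilinear "(**) :: complex^'n^'n \<Rightarrow> complex^'n^'n \<Rightarrow> complex^'n^'n"
    by (rule bounded_bilinear_matrix_mult)
  have q: "((\<lambda>h. (K h - mat 1) /\<^sub>R h) \<longlongrightarrow> Y) (at 0)"
    using has_vector_derivative_quotient[OF d] by (simp add: K0)
  have "(K (t + h) - K t) /\<^sub>R h = K t ** ((K h - mat 1) /\<^sub>R h)" for h
    by (simp add: add mm.diff_right mm.scaleR_right)
  then show "(K has_vector_derivative K t ** Y) (at t)"
    by (intro has_vector_derivativeI_quotient) (simp only:, intro mm.tendsto tendsto_const q)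
  have "(K (t + h) - K t) /\<^sub>R h = ((K h - mat 1) /\<^sub>R h) ** K t" for h
    by (simp add: add[of h t] add.commute[of t h] mm.diff_left mm.scaleR_left)
  then show "(K has_vector_derivative Y ** K t) (at t)"
    by (intro has_vector_derivativeI_quotient) (simp only:, intro mm.tendsto tendsto_const q)
qed

text \<open>\<open>K 0\<close> is idempotent and invertible.\<close>

lemma one_param_subgroup_SUpq_0:
  assumes "one_param_subgroup SUpq (**) Y K" shows "K 0 = mat 1"
proof -
  have "invertible (K 0)"
    using assms by (simp add: one_param_subgroup_def SUpq_def invertible_det_nz)
  then obtain L where L: "L ** K 0 = mat 1" by (auto simp: invertible_def)
  have "K 0 = K 0 ** K 0" using assms unfolding one_param_subgroup_def by (metis add_0)
  then have "L ** K 0 = L ** K 0 ** K 0" by (metis matrix_mul_assoc)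
  then show ?thesis by (simp add: L)
qed

text \<open>The derivative of \<open>K s ** L (- s)\<close> is \<open>K s ** Y ** L (- s)\<close>
  minus itself, so the product stays at its initial value \<open>mat 1\<close>.\<close>

lemma one_param_subgroup_SUpq_unique:
  assumes "one_param_subgroup SUpq (**) Y K" "one_param_subgroup SUpq (**) Y L"
  shows "K = L"
proof
  fix t
  interpret mm: bounded_bilinear "(**) :: complex^('a+'b)^('a+'b) \<Rightarrow> complex^('a+'b)^('a+'b) \<Rightarrow> complex^('a+'b)^('a+'b)"
    by (rule bounded_bilinear_matrix_mult)
  have K: "\<And>s t. K (s + t) = K s ** K t" "K 0 = mat 1" "(K has_vector_derivative Y) (at 0)"
    and L: "\<And>s t. L (s + t) = L s ** L t" "L 0 = mat 1" "(L has_vector_derivative Y) (at 0)"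
    using assms one_param_subgroup_SUpq_0 by (auto simp: one_param_subgroup_def)
  have Lm: "((\<lambda>s. L (- s)) has_vector_derivative - (Y ** L (- s))) (at s)" for s
    using vector_diff_chain_at[OF has_vector_derivative_minus[OF has_vector_derivative_id]
        matrix_subgroup_derivative(2)[OF L], of s]
    by (simp add: o_def)
  have "((\<lambda>s. K s ** L (- s)) has_vector_derivative 0) (at s)" for s
    using mm.has_vector_derivative[OF matrix_subgroup_derivative(1)[OF K, of s] Lm[of s]]
    by (simp add: mm.minus_right matrix_mul_assoc)
  from has_vector_derivative_unique_primitive[OF this, of "\<lambda>_. mat 1" t]
  have "K t ** L (- t) = mat 1" by (simp add: K L)
  moreover have "L (- t) ** L t = mat 1" using L(1)[of "- t" t] L(2) by simp
  ultimately show "K t = L t"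
    by (metis matrix_mul_assoc matrix_mul_lid matrix_mul_rid)
qed

text \<open>The semidirect group law, differentiated in its second argument at 0, becomes a
  triangular system: \<open>K\<close> is a subgroup by itself, the derivative of z involves only
  \<open>K\<close>, and that of c only \<open>K\<close> and z.\<close>

lemma one_param_subgroup_Gpq_components:
  assumes "one_param_subgroup Gpq G_mult ((a, b), c0, Y) \<gamma>"
  obtains z c K where "\<And>t. \<gamma> t = ((z t, vcnj (z t)), c t, K t)"
    "one_param_subgroup SUpq (**) Y K"
    "z 0 = 0" "\<And>t. (z has_vector_derivative K t *v a) (at t)"
    "c 0 = 0" "\<And>t. (c has_vector_derivative c0 + omega_real (z t) (K t *v a) / 2) (at t)"
proof -
  define z where "z t = fst (fst (\<gamma> t))" for t
  define c where "c t = fst (snd (\<gamma> t))" for t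
  define K where "K t = snd (snd (\<gamma> t))" for t
  interpret mv: bounded_bilinear "(*v) :: complex^('a+'b)^('a+'b) \<Rightarrow> complex^('a+'b) \<Rightarrow> complex^('a+'b)"
    by (rule bounded_bilinear_matrix_vector_mult)
  interpret om: bounded_bilinear "omega_real :: complex^('a+'b) \<Rightarrow> complex^('a+'b) \<Rightarrow> real"
    by (rule bounded_bilinear_omega_real)
  have \<gamma>: "\<gamma> t = ((z t, vcnj (z t)), c t, K t)" and KS: "K t \<in> SUpq" for t
  proof -
    have "\<gamma> t \<in> Gpq" using assms unfolding one_param_subgroup_def by blast
    then show "\<gamma> t = ((z t, vcnj (z t)), c t, K t)" "K t \<in> SUpq"
      by (auto simp: Gpq_def Heis_def z_def c_def K_def)
  qed
  have mult: "((z (s + t), vcnj (z (s + t))), c (s + t), K (s + t)) =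
      ((z s + K s *v z t, vcnj (z s + K s *v z t)), c s + c t + omega_real (z s) (K s *v z t) / 2, K s ** K t)" for s t
  proof -
    have "\<gamma> (s + t) = G_mult (\<gamma> s) (\<gamma> t)" using assms unfolding one_param_subgroup_def by blast
    then show ?thesis by (simp only: \<gamma> G_mult_vcnj)
  qed
  have d: "(\<gamma> has_vector_derivative ((a, b), c0, Y)) (at 0)"
    using assms unfolding one_param_subgroup_def by blast
  have dz: "(z has_vector_derivative a) (at 0)" and dc: "(c has_vector_derivative c0) (at 0)"
    and dK: "(K has_vector_derivative Y) (at 0)"
    unfolding z_def c_def K_def
    using bounded_linear.has_vector_derivative[OF bounded_linear_fst bounded_linear.has_vector_derivative[OF bounded_linear_fst d]]
      bounded_linear.has_vector_derivative[OF bounded_linear_fst bounded_linear.has_vector_derivative[OF bounded_linear_snd d]]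
      bounded_linear.has_vector_derivative[OF bounded_linear_snd bounded_linear.has_vector_derivative[OF bounded_linear_snd d]]
    by (simp_all only: fst_conv snd_conv)
  have K: "one_param_subgroup SUpq (**) Y K"
    unfolding one_param_subgroup_def
  proof (intro conjI allI KS dK)
    show "K (s + t) = K s ** K t" for s t using mult[of s t] by (simp only: prod.inject)
  qed
  have K0: "K 0 = mat 1" by (rule one_param_subgroup_SUpq_0[OF K])
  \<comment> \<open>With \<open>K 0 = mat 1\<close> the group law at \<open>s = t = 0\<close> reads
    \<open>z 0 = z 0 + z 0\<close>, and then similarly for c.\<close>
  have z0: "z 0 = 0" using mult[of 0 0] by (simp add: K0)
  have c0: "c 0 = 0" using mult[of 0 0] by (simp add: K0 z0 om.zero_left)
  have zd: "(z has_vector_derivative K t *v a) (at t)" for t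
  proof (rule has_vector_derivativeI_quotient)
    have "(z (t + h) - z t) /\<^sub>R h = K t *v ((z (0 + h) - z 0) /\<^sub>R h)" for h
      using mult[of t h] by (simp add: z0 mv.scaleR_right)
    then show "((\<lambda>h. (z (t + h) - z t) /\<^sub>R h) \<longlongrightarrow> K t *v a) (at 0)"
      by (simp only:) (intro mv.tendsto tendsto_const has_vector_derivative_quotient[OF dz])
  qed
  have cd: "(c has_vector_derivative c0 + omega_real (z t) (K t *v a) / 2) (at t)" for t
  proof (rule has_vector_derivativeI_quotient)
    have "(c (t + h) - c t) /\<^sub>R h = (c (0 + h) - c 0) /\<^sub>R h + omega_real (z t) (K t *v ((z (0 + h) - z 0) /\<^sub>R h)) / 2" for h
      using mult[of t h] by (simp add: z0 c0 mv.scaleR_right om.scaleR_right distrib_left)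
    then show "((\<lambda>h. (c (t + h) - c t) /\<^sub>R h) \<longlongrightarrow> c0 + omega_real (z t) (K t *v a) / 2) (at 0)"
      by (simp only:) (intro tendsto_add tendsto_divide om.tendsto mv.tendsto tendsto_const
          has_vector_derivative_quotient[OF dz] has_vector_derivative_quotient[OF dc] | simp)+
  qed
  show ?thesis using that[OF \<gamma> K z0 zd c0 cd] .
qed

text \<open>By triangularity \<open>K\<close> determines z, and both determine c.\<close>

lemma one_param_subgroup_Gpq_unique:
  assumes "one_param_subgroup Gpq G_mult X \<gamma>" "one_param_subgroup Gpq G_mult X \<eta>"
  shows "\<gamma> = \<eta>"
proof -
  obtain a b c0 Y where X: "X = ((a, b), c0, Y)" by (metis surj_pair)
  obtain z c K where 1: "\<And>t. \<gamma> t = ((z t, vcnj (z t)), c t, K t)"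
    "one_param_subgroup SUpq (**) Y K"
    "z 0 = 0" "\<And>t. (z has_vector_derivative K t *v a) (at t)"
    "c 0 = 0" "\<And>t. (c has_vector_derivative c0 + omega_real (z t) (K t *v a) / 2) (at t)"
    using one_param_subgroup_Gpq_components[OF assms(1)[unfolded X]] by blast
  obtain z' c' K' where 2: "\<And>t. \<eta> t = ((z' t, vcnj (z' t)), c' t, K' t)"
    "one_param_subgroup SUpq (**) Y K'"
    "z' 0 = 0" "\<And>t. (z' has_vector_derivative K' t *v a) (at t)"
    "c' 0 = 0" "\<And>t. (c' has_vector_derivative c0 + omega_real (z' t) (K' t *v a) / 2) (at t)"
    using one_param_subgroup_Gpq_components[OF assms(2)[unfolded X]] by blast
  have K: "K = K'" by (rule one_param_subgroup_SUpq_unique[OF 1(2) 2(2)])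
  have z: "z t = z' t" for t
    by (rule has_vector_derivative_unique_primitive[of _ "\<lambda>t. K t *v a"]) (use 1 2 K in auto)
  have c: "c t = c' t" for t
    by (rule has_vector_derivative_unique_primitive[of _ "\<lambda>t. c0 + omega_real (z t) (K t *v a) / 2"])
      (use 1 2 K z in auto)
  show ?thesis by (simp add: fun_eq_iff 1(1) 2(1) z c K)
qed

lemma continuous_primitive:
  fixes f :: "real \<Rightarrow> 'a::euclidean_space"
  assumes "\<And>x. isCont f x"
  obtains F where "F 0 = 0" "\<And>x. (F has_vector_derivative f x) (at x)"
proof -
  obtain F where F: "\<And>x. (F has_vector_derivative f x) (at x)"
    using einterval_antiderivative[of "-\<infinity>" "\<infinity>" f] assms by auto
  have "((\<lambda>x. F x - F 0) has_vector_derivative f x) (at x)" for x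
    using has_vector_derivative_diff[OF F[of x] has_vector_derivative_const[of "F 0"]] by simp
  then show ?thesis by (intro that[of "\<lambda>x. F x - F 0"]) auto
qed

text \<open>The triangular system is solved by taking primitives. The group law is recovered by
  fixing s: both sides have the same derivative in t and agree at \<open>t = 0\<close>.\<close>

lemma one_param_subgroup_Gpq_exists:
  assumes K: "one_param_subgroup SUpq (**) Y K"
  shows "\<exists>\<gamma>. one_param_subgroup Gpq G_mult ((a, vcnj a), c0, Y) \<gamma>"
proof -
  interpret mv: bounded_bilinear "(*v) :: complex^('a+'b)^('a+'b) \<Rightarrow> complex^('a+'b) \<Rightarrow> complex^('a+'b)"
    by (rule bounded_bilinear_matrix_vector_mult)
  interpret om: bounded_bilinear "omega_real :: complex^('a+'b) \<Rightarrow> complex^('a+'b) \<Rightarrow> real"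
    by (rule bounded_bilinear_omega_real)
  have K0: "K 0 = mat 1" by (rule one_param_subgroup_SUpq_0[OF K])
  have KS: "K t \<in> SUpq" and Kadd: "K (s + t) = K s ** K t" and dK: "(K has_vector_derivative Y) (at 0)" for s t
    using K by (auto simp: one_param_subgroup_def)
  have Kc: "isCont K t" for t
    using matrix_subgroup_derivative(1)[OF Kadd K0 dK, of t] by (rule has_vector_derivative_continuous)
  have "isCont (\<lambda>t. K t *v a) t" for t
    using mv.continuous[OF Kc[of t], of "\<lambda>_. a"] by simp
  from continuous_primitive[OF this]
  obtain z where z: "z 0 = 0" "\<And>t. (z has_vector_derivative K t *v a) (at t)" by blast
  have zc: "isCont z t" for t using z(2) by (rule has_vector_derivative_continuous)
  have "isCont (\<lambda>t. c0 + omega_real (z t) (K t *v a) / 2) t" for t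
    by (intro continuous_intros om.continuous mv.continuous zc Kc) simp_all
  from continuous_primitive[OF this]
  obtain c where c: "c 0 = 0" "\<And>t. (c has_vector_derivative c0 + omega_real (z t) (K t *v a) / 2) (at t)" by blast
  have shift: "((\<lambda>t. f (s + t)) has_vector_derivative d) (at t)" if "(f has_vector_derivative d) (at (s + t))"
    for f :: "real \<Rightarrow> 'x::real_normed_vector" and s t d
    using vector_diff_chain_at[of "(+) s" 1 t f d] that
      has_vector_derivative_add[OF has_vector_derivative_const[of s] has_vector_derivative_id]
    by (simp add: o_def)
  have zadd: "z (s + t) = z s + K s *v z t" for s t
  proof (rule has_vector_derivative_unique_primitive[of "\<lambda>t. z (s + t)" "\<lambda>t. K (s + t) *v a"])
    show "((\<lambda>t. z (s + t)) has_vector_derivative K (s + t) *v a) (at t)" for t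
      by (rule shift) (rule z)
    have "((\<lambda>t. z s + K s *v z t) has_vector_derivative K s *v (K t *v a)) (at t)" for t
      by (auto intro!: derivative_eq_intros bounded_linear.has_vector_derivative[OF mv.bounded_linear_right] z)
    then show "((\<lambda>t. z s + K s *v z t) has_vector_derivative K (s + t) *v a) (at t)" for t
      by (simp add: Kadd matrix_vector_mul_assoc)
  qed (simp add: z)
  have cadd: "c (s + t) = c s + c t + omega_real (z s) (K s *v z t) / 2" for s t
  proof (rule has_vector_derivative_unique_primitive[of "\<lambda>t. c (s + t)" "\<lambda>t. c0 + omega_real (z (s + t)) (K (s + t) *v a) / 2"])
    show "((\<lambda>t. c (s + t)) has_vector_derivative c0 + omega_real (z (s + t)) (K (s + t) *v a) / 2) (at t)" for t
      by (rule shift) (rule c)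
    fix t
    have "bounded_linear (\<lambda>x. omega_real (z s) (K s *v x) / 2)"
      by (intro bounded_linear_divide bounded_linear_compose[OF om.bounded_linear_right] mv.bounded_linear_right
          bounded_linear_compose[OF bounded_linear_divide])
    from bounded_linear.has_vector_derivative[OF this z(2)[of t]]
    have "((\<lambda>t. c s + c t + omega_real (z s) (K s *v z t) / 2) has_vector_derivative
        (c0 + omega_real (z t) (K t *v a) / 2) + omega_real (z s) (K s *v (K t *v a)) / 2) (at t)"
      using has_vector_derivative_add[OF has_vector_derivative_add[OF has_vector_derivative_const[of "c s"] c(2)[of t]]]
      by simp
    \<comment> \<open>Expanding \<open>z (s + t) = z s + K s *v z t\<close> gives a second term in
      which both arguments carry \<open>K s\<close>; invariance of the symplectic form under
      \<open>K s\<close> removes it.\<close>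
    moreover have "omega_real (z (s + t)) (K (s + t) *v a) =
        omega_real (z s) (K s *v (K t *v a)) + omega_real (z t) (K t *v a)"
      by (simp add: zadd Kadd om.add_left omega_real_SUpq[OF KS] flip: matrix_vector_mul_assoc)
    ultimately show "((\<lambda>t. c s + c t + omega_real (z s) (K s *v z t) / 2) has_vector_derivative
        c0 + omega_real (z (s + t)) (K (s + t) *v a) / 2) (at t)"
      by (simp add: add_divide_distrib algebra_simps)
  qed (simp add: z c om.zero_right)
  have "one_param_subgroup Gpq G_mult ((a, vcnj a), c0, Y) (\<lambda>t. ((z t, vcnj (z t)), c t, K t))"
    unfolding one_param_subgroup_def
  proof (intro conjI allI)
    show "((z t, vcnj (z t)), c t, K t) \<in> Gpq" for t
      using KS by (auto simp: Gpq_def Heis_def)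
    show "((z (s + t), vcnj (z (s + t))), c (s + t), K (s + t)) =
        G_mult ((z s, vcnj (z s)), c s, K s) ((z t, vcnj (z t)), c t, K t)" for s t
      by (simp add: G_mult_vcnj zadd cadd Kadd)
    have "(z has_vector_derivative a) (at 0)" "(c has_vector_derivative c0) (at 0)"
      using z(2)[of 0] c(2)[of 0] by (simp_all add: K0 z(1) om.zero_left)
    then show "((\<lambda>t. ((z t, vcnj (z t)), c t, K t)) has_vector_derivative ((a, vcnj a), c0, Y)) (at 0)"
      by (intro has_vector_derivative_Pair bounded_linear.has_vector_derivative[OF bounded_linear_vcnj] dK)
  qed
  then show ?thesis by blast
qed

lemma one_param_subgroup_scale:
  assumes "one_param_subgroup S m X \<gamma>"
  shows "one_param_subgroup S m (r *\<^sub>R X) (\<lambda>t. \<gamma> (r * t))"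
proof -
  have "((\<lambda>t. \<gamma> (r * t)) has_vector_derivative r *\<^sub>R X) (at 0)"
    using vector_diff_chain_at[of "(*) r" r 0 \<gamma> X] assms
      has_vector_derivative_mult_right[OF has_vector_derivative_id, of r]
    by (simp add: o_def one_param_subgroup_def)
  then show ?thesis using assms by (simp add: one_param_subgroup_def distrib_left)
qed

text \<open>The subgroup with velocity \<open>t *\<^sub>R X\<close> is \<open>\<gamma>\<close> run
  at speed t, so its value at time 1 is \<open>\<gamma> t\<close>.\<close>

lemma lie_exp_Gpq:
  assumes "one_param_subgroup Gpq G_mult X \<gamma>"
  shows "lie_exp Gpq G_mult (t *\<^sub>R X) = \<gamma> t"
proof -
  have "(THE \<gamma>. one_param_subgroup Gpq G_mult (t *\<^sub>R X) \<gamma>) = (\<lambda>s. \<gamma> (t * s))"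
    by (rule the_equality, rule one_param_subgroup_scale[OF assms])
      (erule one_param_subgroup_Gpq_unique, rule one_param_subgroup_scale[OF assms])
  then show ?thesis by (simp add: lie_exp_def)
qed

text \<open>Both defining equations are differentiated along a subgroup with velocity
  \<open>Y\<close>. The determinant gives \<open>trace A + trace D = 0\<close>; the diagonal entries
  of \<open>K t ** J0 ** mstar (K t) = J0\<close> in the second block show that the diagonal of
  \<open>D\<close> is purely imaginary.\<close>

lemma supq_trace:
  assumes "mblock A B C D \<in> supq"
  shows "trace (mcnj D) = trace A"
proof -
  obtain K where K: "one_param_subgroup SUpq (**) (mblock A B C D) K"
    using assms by (auto simp: supq_def lie_algebra_def)
  let ?Y = "mblock A B C D"
  have K0: "K 0 = mat 1" by (rule one_param_subgroup_SUpq_0[OF K])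
  have dK: "(K has_vector_derivative ?Y) (at 0)" and KS: "K t \<in> SUpq" for t
    using K by (auto simp: one_param_subgroup_def)
  have "((\<lambda>t. det (K t)) has_vector_derivative trace ?Y) (at 0)"
    by (rule has_vector_derivative_det_one[OF dK K0])
  moreover have "((\<lambda>t. det (K t)) has_vector_derivative 0) (at 0)"
    using KS by (simp add: SUpq_def)
  ultimately have "trace ?Y = 0" by (rule vector_derivative_unique_at)
  then have tr: "trace A + trace D = 0" by (simp add: trace_def sum_UNIV_Plus)
  have D: "D $ b $ b + cnj (D $ b $ b) = 0" for b
  proof -
    let ?i = "Inr b :: 'a + 'b"
    have e: "((\<lambda>t. K t $ ?i $ j) has_vector_derivative ?Y $ ?i $ j) (at 0)" for j
      using bounded_linear.has_vector_derivative[OF bounded_linear_vec_nth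
        bounded_linear.has_vector_derivative[OF bounded_linear_vec_nth dK, of ?i], of j] .
    then have e': "((\<lambda>t. cnj (K t $ ?i $ j)) has_vector_derivative cnj (?Y $ ?i $ j)) (at 0)" for j
      by (rule bounded_linear.has_vector_derivative[OF bounded_linear_cnj])
    have "(K t ** J0 ** mstar (K t)) $ ?i $ ?i = J0 $ ?i $ ?i" for t
      using KS[of t] by (simp add: SUpq_def)
    then have const: "(\<Sum>j\<in>UNIV. K t $ ?i $ j * Jsign j * cnj (K t $ ?i $ j)) = -1" for t
      by (simp add: matrix_matrix_mult_def[of "_ ** J0"] mult_J0_nth J0_nth)
    have "((\<lambda>t. \<Sum>j\<in>UNIV. K t $ ?i $ j * Jsign j * cnj (K t $ ?i $ j)) has_vector_derivative
      (\<Sum>j\<in>UNIV. (K 0 $ ?i $ j * Jsign j) * cnj (?Y $ ?i $ j) + (?Y $ ?i $ j * Jsign j) * cnj (K 0 $ ?i $ j))) (at 0)"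
      by (intro has_vector_derivative_sum has_vector_derivative_mult e e'
         bounded_linear.has_vector_derivative[OF bounded_linear_mult_left])
    moreover have "((\<lambda>t. \<Sum>j\<in>UNIV. K t $ ?i $ j * Jsign j * cnj (K t $ ?i $ j)) has_vector_derivative 0) (at 0)"
      unfolding const by simp
    ultimately have "(\<Sum>j\<in>UNIV. (K 0 $ ?i $ j * Jsign j) * cnj (?Y $ ?i $ j) + (?Y $ ?i $ j * Jsign j) * cnj (K 0 $ ?i $ j)) = 0"
      by (rule vector_derivative_unique_at)
    then have "- cnj (D $ b $ b) = D $ b $ b"
      by (simp add: sum_UNIV_Plus K0 mat_def sum.distrib if_distrib[of "\<lambda>x. _ * x"] if_distrib[of "\<lambda>x. x * _"]
        if_distrib[of cnj] if_distrib[of uminus] add_eq_0_iff cong: if_cong)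
    then show ?thesis by (metis add.left_inverse)
  qed
  have "trace D + trace (mcnj D) = 0"
    using D by (simp add: trace_def mcnj_def sum.distrib[symmetric])
  with tr have "trace D + trace (mcnj D) = trace D + trace A" by (simp only: add.commute)
  then show ?thesis by (simp only: add_left_cancel)
qed

section \<open>The harmonic representation on coherent states\<close>

lemma mcnj_nth [simp]: "mcnj N $ i $ j = cnj (N $ i $ j)"
  by (simp add: mcnj_def)

lemma vfst_nth [simp]: "vfst z $ a = z $ Inl a" and vsnd_nth [simp]: "vsnd z $ b = z $ Inr b"
  by (simp_all add: vfst_def vsnd_def)

lemma norm_power2_vfst_vsnd: "(norm z)\<^sup>2 = (norm (vfst z))\<^sup>2 + (norm (vsnd z))\<^sup>2"
  by (simp add: norm_vec_def L2_set_def sum_nonneg sum_UNIV_Plus)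

lemma norm_vfst_le: "norm (vfst z) \<le> norm z" and norm_vsnd_le: "norm (vsnd z) \<le> norm z"
  by (rule power2_le_imp_le; simp add: norm_power2_vfst_vsnd[of z])+

lemma bounded_linear_vfst: "bounded_linear vfst" and bounded_linear_vsnd: "bounded_linear vsnd"
  by (rule bounded_linear_intro[where K=1]; simp add: vec_eq_iff norm_vfst_le norm_vsnd_le)+

lemma vjoin_vfst_vsnd [simp]: "vfst (vjoin u v) = u" "vsnd (vjoin u v) = v"
  by (simp_all add: vec_eq_iff)

lemma smap_nth [simp]: "smap z $ Inl a = z $ Inl a" "smap z $ Inr b = cnj (z $ Inr b)"
  by (simp_all add: smap_def)

lemma norm_smap [simp]: "norm (smap z) = norm z"
  by (simp add: norm_vec_def L2_set_def sum_UNIV_Plus)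

lemma bounded_linear_smap: "bounded_linear smap"
proof (rule bounded_linear_intro[where K=1])
  show "smap (x + y) = smap x + smap y" for x y :: "complex^('a + 'b)"
    unfolding vec_eq_iff by (rule allI) (case_tac i; simp)
  show "smap (r *\<^sub>R x) = r *\<^sub>R smap x" for r and x :: "complex^('a + 'b)"
    unfolding vec_eq_iff by (rule allI) (case_tac i; simp)
qed simp

lemma norm_mcnj [simp]: "norm (mcnj N) = norm N"
  by (simp add: norm_vec_def)

lemma bounded_linear_mcnj: "bounded_linear mcnj"
  by (rule bounded_linear_intro[where K=1]) (simp_all add: vec_eq_iff)

lemma vfst_vcnj: "vfst (vcnj z) = vcnj (vfst z)" and vsnd_vcnj: "vsnd (vcnj z) = vcnj (vsnd z)"
  by (simp_all add: vec_eq_iff)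

lemma vfst_diff: "vfst (x - y) = vfst x - vfst y" and vsnd_diff: "vsnd (x - y) = vsnd x - vsnd y"
  and vfst_add: "vfst (x + y) = vfst x + vfst y" and vsnd_add: "vsnd (x + y) = vsnd x + vsnd y"
  by (simp_all add: vec_eq_iff)

lemma cdot_vfst_vsnd: "x \<odot> y = vfst x \<odot> vfst y + vsnd x \<odot> vsnd y"
  by (simp add: cdot_def sum_UNIV_Plus)

text \<open>Rate 0 lies below every threshold, so integrability, the mean value and the reproducing
  property hold for all positive parameters. The class contains coordinates and coherent states and
  is closed under sums and products.\<close>

definition tame :: "(complex^'n \<Rightarrow> complex) \<Rightarrow> bool"
  where "tame F \<longleftrightarrow> entire F \<and> gauss_bounded 0 F"

lemma tame_const [intro]: "tame (\<lambda>_. c)"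
  and tame_nth [intro]: "tame (\<lambda>z. z $ i)"
  by (simp_all add: tame_def)

lemma tame_add [intro]: "tame f \<Longrightarrow> tame g \<Longrightarrow> tame (\<lambda>z. f z + g z)"
  by (auto simp: tame_def gauss_bounded_add)

lemma tame_mult [intro]: "tame f \<Longrightarrow> tame g \<Longrightarrow> tame (\<lambda>z. f z * g z)"
  using gauss_bounded_mult[of 0 f 0 g] by (auto simp: tame_def)

lemma tame_minus [intro]: "tame f \<Longrightarrow> tame (\<lambda>z. - f z)"
  using tame_mult[OF tame_const[of "-1"]] by simp

lemma tame_diff [intro]: "tame f \<Longrightarrow> tame g \<Longrightarrow> tame (\<lambda>z. f z - g z)"
  using tame_add[OF _ tame_minus] by simp

lemma tame_sum: "(\<And>i. i \<in> I \<Longrightarrow> tame (f i)) \<Longrightarrow> tame (\<lambda>z. \<Sum>i\<in>I. f i z)"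
  by (induction I rule: infinite_finite_induct) auto

lemma tame_cdot [intro]:
  "(\<And>j. tame (\<lambda>z. f z $ j)) \<Longrightarrow> (\<And>j. tame (\<lambda>z. g z $ j)) \<Longrightarrow> tame (\<lambda>z. f z \<odot> g z)"
  unfolding cdot_def by (intro tame_sum tame_mult)

lemma tame_matrix_vector_mult [intro]:
  "(\<And>j. tame (\<lambda>z. f z $ j)) \<Longrightarrow> tame (\<lambda>z. (N *v f z) $ i)"
  by (simp add: matrix_vector_mult_def) (intro tame_sum tame_mult tame_const)

lemma tame_coh [intro]: assumes "lam > 0" shows "tame (coh lam z)"
proof -
  have "gauss_bounded 0 (\<lambda>w. exp (of_real lam * (vcnj z \<odot> w) / 2))"
  proof (rule gauss_bounded_exp[of _ 0 "lam / 2 * norm z"])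
    fix w :: "complex^'a"
    have "lam * norm (vcnj z \<odot> w) \<le> lam * (norm z * norm w)"
      using norm_cdot_le[of "vcnj z" w] assms by (intro mult_left_mono) auto
    then show "norm (of_real lam * (vcnj z \<odot> w) / 2) \<le> 0 + lam / 2 * norm z * norm w + 0 * (norm w)\<^sup>2"
      using assms by (simp add: norm_mult norm_divide)
  qed
  then show ?thesis
    using entire_coh[of lam z] by (simp only: tame_def coh_def[abs_def])
qed

lemma tame_fock: "tame F \<Longrightarrow> lam > 0 \<Longrightarrow> F \<in> fock lam"
  unfolding tame_def by (intro fock_gauss_bounded[of F 0]) auto

lemma tame_reproducing: "tame F \<Longrightarrow> lam > 0 \<Longrightarrow> fock_inner lam F (coh lam z) = F z"
  unfolding tame_def by (intro reproducing[of F 0]) auto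

lemma tame_measurable: "tame F \<Longrightarrow> F \<in> borel_measurable borel"
  unfolding tame_def by (blast intro: entire_borel_measurable)

lemma cnj_fock_inner: "cnj (fock_inner lam f g) = fock_inner lam g f"
  unfolding fock_inner_def by (subst Bochner_Integration.integral_cnj[symmetric]) (simp add: mult.commute)

text \<open>The exponent of the kernel is a small quadratic form plus a linear one in \<open>cnj w\<close>, so the
  reproducing property applies in the second variable.\<close>

lemma sigma_coh:
  assumes lam: "lam > 0" and Q: "norm (matrix_inv (mcnj (blockD k)) ** mcnj (blockC k)) < 1"
  shows "sigma lam k (coh lam w) z = harm_kernel lam k z w"
proof -
  \<comment> \<open>\<open>sigma\<close> pairs \<open>coh lam w\<close> with \<open>F\<close>; its
    conjugate pairs \<open>F\<close>, entire in v, with \<open>coh lam w\<close>, and this is the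
    order in which the reproducing property applies.\<close>
  define F where "F v = cnj (harm_kernel lam k z v)" for v
  define Q where "Q = matrix_inv (mcnj (blockD k)) ** mcnj (blockC k)"
  define x where "x = vcnj (matrix_inv (mcnj (blockD k)) *v vsnd z)"
  define y where "y = vcnj (matrix_inv (blockA k) *v vfst z)"
  define c where "c = cnj (vfst z \<odot> ((mcnj (blockB k) ** matrix_inv (mcnj (blockD k))) *v vsnd z))"
  define h where "h v = of_real lam / 2 * (- ((mcnj Q *v vfst v) \<odot> vsnd v) + x \<odot> vsnd v + y \<odot> vfst v + c)"
    for v :: "complex^('a + 'b)"
  have F: "F v = inverse (cnj (det (blockA k))) * exp (h v)" for v
    by (simp add: F_def harm_kernel_def Let_def exp_cnj cnj_cdot vcnj_matrix_vector_mult
        h_def Q_def x_def y_def c_def)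
  have "entire F"
    unfolding F[abs_def] h_def
    by (intro entire_mult entire_const entire_exp entire_add entire_minus entire_cdot
        entire_matrix_vector_mult; simp)
  \<comment> \<open>Only the form with matrix \<open>Q\<close> is quadratic in v;
    \<open>norm Q < 1\<close> keeps its rate below the critical value
    \<open>lam / 2\<close>.\<close>
  moreover have "gauss_bounded (lam / 2 * norm Q) F"
  proof -
    have "gauss_bounded (lam / 2 * norm Q) (\<lambda>v. exp (h v))"
    proof (rule gauss_bounded_exp[of _ "lam / 2 * norm c" "lam / 2 * (norm x + norm y)"])
      fix v :: "complex^('a + 'b)"
      have 1: "norm ((mcnj Q *v vfst v) \<odot> vsnd v) \<le> norm Q * (norm v)\<^sup>2"
      proof -
        have "norm ((mcnj Q *v vfst v) \<odot> vsnd v) \<le> norm (mcnj Q *v vfst v) * norm (vsnd v)"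
          by (rule norm_cdot_le)
        also have "\<dots> \<le> (norm Q * norm (vfst v)) * norm (vsnd v)"
          using norm_matrix_vector_mult_le[of "mcnj Q" "vfst v"] by (intro mult_right_mono) auto
        also have "\<dots> \<le> (norm Q * norm v) * norm v"
          by (intro mult_mono norm_vfst_le norm_vsnd_le) auto
        finally show ?thesis by (simp add: power2_eq_square mult.assoc)
      qed
      have 2: "norm (x \<odot> vsnd v) \<le> norm x * norm v"
        by (intro order_trans[OF norm_cdot_le] mult_left_mono norm_vsnd_le) auto
      have 3: "norm (y \<odot> vfst v) \<le> norm y * norm v"
        by (intro order_trans[OF norm_cdot_le] mult_left_mono norm_vfst_le) auto
      have "norm (- ((mcnj Q *v vfst v) \<odot> vsnd v) + x \<odot> vsnd v + y \<odot> vfst v + c)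
        \<le> norm Q * (norm v)\<^sup>2 + norm x * norm v + norm y * norm v + norm c"
        using 1 2 3 by (intro norm_triangle_mono) auto
      then have "lam / 2 * norm (- ((mcnj Q *v vfst v) \<odot> vsnd v) + x \<odot> vsnd v + y \<odot> vfst v + c)
        \<le> lam / 2 * (norm Q * (norm v)\<^sup>2 + norm x * norm v + norm y * norm v + norm c)"
        using lam by (intro mult_left_mono) auto
      moreover have "norm (h v) = lam / 2 * norm (- ((mcnj Q *v vfst v) \<odot> vsnd v) + x \<odot> vsnd v + y \<odot> vfst v + c)"
        using lam unfolding h_def norm_mult by simp
      ultimately have "norm (h v) \<le> lam / 2 * (norm Q * (norm v)\<^sup>2 + norm x * norm v + norm y * norm v + norm c)"
        by simp
      then show "norm (h v) \<le> lam / 2 * norm c + lam / 2 * (norm x + norm y) * norm v + lam / 2 * norm Q * (norm v)\<^sup>2"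
        by (simp add: algebra_simps add_divide_distrib)
    qed
    from gauss_bounded_mult[OF gauss_bounded_const this] show ?thesis by (simp add: F[abs_def])
  qed
  ultimately have "fock_inner lam F (coh lam w) = F w"
    using lam assms(2) by (intro reproducing[of F "lam / 2 * norm Q"]) (auto simp: Q_def)
  then have "cnj (fock_inner lam F (coh lam w)) = harm_kernel lam k z w"
    by (simp add: F_def)
  then show ?thesis
    unfolding cnj_fock_inner by (simp add: sigma_def F_def[abs_def])
qed

text \<open>The polynomial \<open>P\<close>, with \<open>v\<close> in the place of \<open>vcnj w\<close>.\<close>

definition pi_symbol ::
  "real \<Rightarrow> complex^('p::finite + 'q::finite) \<Rightarrow> real \<Rightarrow> complex^('p + 'q)^('p + 'q)
    \<Rightarrow> complex^('p + 'q) \<Rightarrow> complex^('p + 'q) \<Rightarrow> complex"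
  where "pi_symbol lam a c0 Y z v =
    of_real lam / 2 * (vcnj (smap a) \<odot> z - v \<odot> smap a) + \<i> * of_real lam * of_real c0 - trace (blockA Y)
    - of_real lam / 2 * ((mcnj (blockC Y) *v vfst v) \<odot> vsnd v + (mcnj (blockD Y) *v vsnd z) \<odot> vsnd v
        + (blockA Y *v vfst z) \<odot> vfst v - vfst z \<odot> (mcnj (blockB Y) *v vsnd z))"

lemma tame_pi_symbol: "tame (\<lambda>z. pi_symbol lam a c0 Y z v)"
  unfolding pi_symbol_def
  by (intro tame_add tame_diff tame_mult tame_const tame_cdot tame_matrix_vector_mult;
      (simp only: vfst_nth vsnd_nth)?; (rule tame_const tame_nth)?)

lemma bounded_linear_blocks:
  "bounded_linear blockA" "bounded_linear blockB" "bounded_linear blockC" "bounded_linear blockD"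
  unfolding linear_conv_bounded_linear[symmetric]
  by (rule linearI; simp add: vec_eq_iff blockA_def blockB_def blockC_def blockD_def)+

lemma blocks_mat_1 [simp]:
  "blockA (mat 1) = mat 1" "blockB (mat 1) = 0" "blockC (mat 1) = 0" "blockD (mat 1) = mat 1"
  by (simp_all add: vec_eq_iff blockA_def blockB_def blockC_def blockD_def mat_def)

lemma mcnj_0 [simp]: "mcnj 0 = 0" and mcnj_mat_1 [simp]: "mcnj (mat 1) = mat 1"
  by (simp_all add: vec_eq_iff mat_def)

lemma smap_0 [simp]: "smap 0 = 0" and vfst_0 [simp]: "vfst 0 = 0" and vsnd_0 [simp]: "vsnd 0 = 0"
  using linear_0 bounded_linear.linear bounded_linear_smap bounded_linear_vfst bounded_linear_vsnd by blast+

lemma has_vector_derivative_tendsto: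
  "(f has_vector_derivative D) (at x) \<Longrightarrow> (f \<longlongrightarrow> f x) (at x)"
  using has_vector_derivative_continuous continuous_within by blast

text \<open>Near \<open>t = 0\<close> the curve applied to a coherent state is
  \<open>exp (E t z)\<close>, where every coefficient of \<open>E\<close> is a curve whose
  derivative at 0 is known. The derivative of the exponent is \<open>pi_symbol\<close>, and
  \<open>fock_limit_unique\<close> identifies the Fock-norm limit with the value of the definite
  description.\<close>

lemma d_ext_harm_coh:
  fixes Y :: "complex^('p::finite + 'q::finite)^('p + 'q)"
  assumes lam: "lam > 0" and Y: "Y \<in> supq"
  shows "d_ext_harm lam ((a, vcnj a), c0, Y) (coh lam w) = (\<lambda>z. pi_symbol lam a c0 Y z (vcnj w) * coh lam w z)"
proof -
  let ?X = "((a, vcnj a), c0, Y)"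
  obtain K0 where "one_param_subgroup SUpq (**) Y K0"
    using Y by (auto simp: supq_def lie_algebra_def)
  then obtain \<gamma> where \<gamma>: "one_param_subgroup Gpq G_mult ?X \<gamma>"
    using one_param_subgroup_Gpq_exists by blast
  obtain u c K where \<gamma>_eq: "\<And>t. \<gamma> t = ((u t, vcnj (u t)), c t, K t)"
    and K: "one_param_subgroup SUpq (**) Y K"
    and u: "u 0 = 0" "\<And>t. (u has_vector_derivative K t *v a) (at t)"
    and c: "c 0 = 0" "\<And>t. (c has_vector_derivative c0 + omega_real (u t) (K t *v a) / 2) (at t)"
    using one_param_subgroup_Gpq_components[OF \<gamma>] by blast
  have K0: "K 0 = mat 1" by (rule one_param_subgroup_SUpq_0[OF K])
  have dK: "(K has_vector_derivative Y) (at 0)" using K by (simp add: one_param_subgroup_def)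
  have du: "(u has_vector_derivative a) (at 0)" using u(2)[of 0] by (simp add: K0)
  have dc: "(c has_vector_derivative c0) (at 0)"
    using c(2)[of 0] by (simp add: K0 u(1) bounded_bilinear.zero_left[OF bounded_bilinear_omega_real])
  note bl = bounded_linear.has_vector_derivative
  note bb = bounded_bilinear.has_vector_derivative
  define A where "A t = blockA (K t)" for t
  define N where "N t = matrix_inv (mcnj (blockD (K t)))" for t
  define R where "R t = matrix_inv (A t)" for t
  define Q where "Q t = N t ** mcnj (blockC (K t))" for t
  define P where "P t = mcnj (blockB (K t)) ** N t" for t
  define s1 where "s1 t = vfst (smap (u t))" for t
  define s2 where "s2 t = vsnd (smap (u t))" for t
  define v1 where "v1 = vcnj (vfst w)"
  define v2 where "v2 = vcnj (vsnd w)"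
  \<comment> \<open>The logarithm moves the prefactor \<open>inverse (det A)\<close> into the
    exponent. It is differentiable at \<open>t = 0\<close> because \<open>det (A 0) = 1\<close> lies
    off the branch cut.\<close>
  define L where "L t = Ln (inverse (det (A t)))" for t
  define n where "n t = (norm (u t))\<^sup>2" for t
  have at0: "A 0 = mat 1" "N 0 = mat 1" "R 0 = mat 1" "Q 0 = 0" "P 0 = 0" "s1 0 = 0" "s2 0 = 0" "n 0 = 0" "L 0 = 0"
    by (simp_all add: A_def N_def R_def Q_def P_def s1_def s2_def L_def n_def K0 u(1) matrix_inv_one)
  have dA: "(A has_vector_derivative blockA Y) (at 0)"
    unfolding A_def by (intro bl[OF bounded_linear_blocks(1)] dK)
  have dN: "(N has_vector_derivative - mcnj (blockD Y)) (at 0)"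
    unfolding N_def
    by (rule has_vector_derivative_matrix_inv_one) (simp_all add: K0 bl[OF bounded_linear_mcnj] bl[OF bounded_linear_blocks(4)] dK)
  have dR: "(R has_vector_derivative - blockA Y) (at 0)"
    unfolding R_def by (rule has_vector_derivative_matrix_inv_one[OF dA at0(1)])
  have dQ: "(Q has_vector_derivative mcnj (blockC Y)) (at 0)"
    using bb[OF bounded_bilinear_matrix_mult dN bl[OF bounded_linear_mcnj bl[OF bounded_linear_blocks(3) dK]]]
    by (simp add: Q_def[abs_def] at0 K0)
  have dP: "(P has_vector_derivative mcnj (blockB Y)) (at 0)"
    using bb[OF bounded_bilinear_matrix_mult bl[OF bounded_linear_mcnj bl[OF bounded_linear_blocks(2) dK]] dN]
    by (simp add: P_def[abs_def] at0 K0)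
  have ds1: "(s1 has_vector_derivative vfst (smap a)) (at 0)" and ds2: "(s2 has_vector_derivative vsnd (smap a)) (at 0)"
    unfolding s1_def s2_def
    by (intro bl[OF bounded_linear_vfst] bl[OF bounded_linear_vsnd] bl[OF bounded_linear_smap] du)+
  \<comment> \<open>Since \<open>u 0 = 0\<close>, the squared norm is of second order, so the
    Gaussian factor of \<open>rho\<close> leaves no trace in the derivative.\<close>
  have dn: "(n has_vector_derivative 0) (at 0)"
    using bb[OF bounded_bilinear_inner du du] by (simp add: n_def[abs_def] power2_norm_eq_inner u(1))
  have ddet: "((\<lambda>t. det (A t)) has_vector_derivative trace (blockA Y)) (at 0)"
    by (rule has_vector_derivative_det_one[OF dA at0(1)])
  have dL: "(L has_vector_derivative - trace (blockA Y)) (at 0)"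
  proof -
    have "((\<lambda>x. Ln (inverse x)) has_field_derivative - 1) (at (det (A 0)))"
      by (auto intro!: derivative_eq_intros simp: at0)
    from field_vector_diff_chain_at[OF ddet this] show ?thesis by (simp add: L_def[abs_def] o_def)
  qed
  \<comment> \<open>The shifted arguments \<open>vfst z - s1 t\<close> and
    \<open>vsnd z - s2 t\<close> arise because \<open>rho\<close> translates the output of
    \<open>sigma\<close> by \<open>smap (u t)\<close>.\<close>
  define E where "E t z = \<i> * of_real lam * of_real (c t)
      + of_real lam * (1/2 * (vcnj (smap (u t)) \<odot> z) - 1/4 * of_real (n t)) + L t
      + of_real lam / 2 * (- ((Q t *v v1) \<odot> v2) + (N t *v (vsnd z - s2 t)) \<odot> v2
        + (R t *v (vfst z - s1 t)) \<odot> v1 + (vfst z - s1 t) \<odot> (P t *v (vsnd z - s2 t)))" for t z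
  define E' where "E' z = pi_symbol lam a c0 Y z (vcnj w)" for z
  have E0: "E 0 z = of_real lam * (vcnj w \<odot> z) / 2" for z
    by (simp add: E_def at0 c(1) u(1) v1_def v2_def cdot_vfst_vsnd[of z "vcnj w"] vfst_vcnj vsnd_vcnj cdot_commute
        matrix_vector_mult_0 algebra_simps)
  have expE0: "exp (E 0 z) = coh lam w z" for z by (simp add: E0 coh_def)
  \<comment> \<open>Closeness to the identity enters twice: \<open>det (A t)\<close> must not vanish
    for \<open>L\<close> to be a logarithm, and \<open>norm (Q t) < 1\<close> is what
    \<open>sigma_coh\<close> requires.\<close>
  have "\<forall>\<^sub>F t in at 0. det (A t) \<noteq> 0"
    by (rule tendsto_imp_eventually_ne[OF has_vector_derivative_tendsto[OF ddet]]) (simp add: at0)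
  moreover have "\<forall>\<^sub>F t in at 0. norm (Q t) < 1"
    using order_tendstoD(2)[OF tendsto_norm[OF has_vector_derivative_tendsto[OF dQ]], of 1] by (simp add: at0)
  ultimately have expE: "\<forall>\<^sub>F t in at 0. \<forall>z. ext_harm lam (\<gamma> t) (coh lam w) z = exp (E t z)"
  proof eventually_elim
    case (elim t)
    have L: "exp (L t) = inverse (det (A t))" using elim(1) by (simp add: L_def)
    have "sigma lam (K t) (coh lam w) z = harm_kernel lam (K t) z w" for z
      using elim(2) by (intro sigma_coh lam) (simp add: Q_def N_def)
    then show ?case
      by (simp add: ext_harm_def rho_def \<gamma>_eq E_def exp_add L harm_kernel_def Let_def n_def
          Q_def N_def R_def P_def A_def s1_def s2_def v1_def v2_def vfst_diff vsnd_diff)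
  qed
  have dE: "((\<lambda>t. E t z) has_vector_derivative E' z) (at 0)" for z
  proof -
    have 1: "((\<lambda>t. \<i> * of_real lam * of_real (c t)) has_vector_derivative \<i> * of_real lam * of_real c0) (at 0)"
      by (intro has_vector_derivative_mult_right bl[OF bounded_linear_of_real] dc)
    have 2: "((\<lambda>t. of_real lam * (1/2 * (vcnj (smap (u t)) \<odot> z) - 1/4 * of_real (n t)))
        has_vector_derivative of_real lam * (1/2 * (vcnj (smap a) \<odot> z) - 1/4 * of_real 0)) (at 0)"
      by (intro has_vector_derivative_mult_right has_vector_derivative_diff bl[OF bounded_linear_of_real] dn
          bl[OF bounded_bilinear.bounded_linear_left[OF bounded_bilinear_cdot]] bl[OF bounded_linear_vcnj]
          bl[OF bounded_linear_smap] du)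
    have d1: "((\<lambda>t. vfst z - s1 t) has_vector_derivative - vfst (smap a)) (at 0)"
      and d2: "((\<lambda>t. vsnd z - s2 t) has_vector_derivative - vsnd (smap a)) (at 0)"
      using has_vector_derivative_diff[OF has_vector_derivative_const ds1]
        has_vector_derivative_diff[OF has_vector_derivative_const ds2] by simp_all
    have 3: "((\<lambda>t. (Q t *v v1) \<odot> v2) has_vector_derivative (mcnj (blockC Y) *v v1) \<odot> v2) (at 0)"
      by (intro bl[OF bounded_bilinear.bounded_linear_left[OF bounded_bilinear_cdot]]
          bl[OF bounded_bilinear.bounded_linear_left[OF bounded_bilinear_matrix_vector_mult]] dQ)
    have 4: "((\<lambda>t. (N t *v (vsnd z - s2 t)) \<odot> v2) has_vector_derivative
        (N 0 *v (- vsnd (smap a)) + (- mcnj (blockD Y)) *v (vsnd z - s2 0)) \<odot> v2) (at 0)"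
      by (intro bl[OF bounded_bilinear.bounded_linear_left[OF bounded_bilinear_cdot]]
          bb[OF bounded_bilinear_matrix_vector_mult] dN d2)
    have 5: "((\<lambda>t. (R t *v (vfst z - s1 t)) \<odot> v1) has_vector_derivative
        (R 0 *v (- vfst (smap a)) + (- blockA Y) *v (vfst z - s1 0)) \<odot> v1) (at 0)"
      by (intro bl[OF bounded_bilinear.bounded_linear_left[OF bounded_bilinear_cdot]]
          bb[OF bounded_bilinear_matrix_vector_mult] dR d1)
    have 6: "((\<lambda>t. (vfst z - s1 t) \<odot> (P t *v (vsnd z - s2 t))) has_vector_derivative
        (vfst z - s1 0) \<odot> (P 0 *v (- vsnd (smap a)) + mcnj (blockB Y) *v (vsnd z - s2 0))
        + (- vfst (smap a)) \<odot> (P 0 *v (vsnd z - s2 0))) (at 0)"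
      by (intro bb[OF bounded_bilinear_cdot] bb[OF bounded_bilinear_matrix_vector_mult] dP d1 d2)
    have mvneg: "(- M) *v x = - (M *v x)" for M :: "complex^'k^'m" and x
      by (simp add: vec_eq_iff matrix_vector_mult_def sum_negf)
    have "((\<lambda>t. E t z) has_vector_derivative
        \<i> * of_real lam * of_real c0 + of_real lam * (1/2 * (vcnj (smap a) \<odot> z) - 1/4 * of_real 0)
        + - trace (blockA Y) + of_real lam / 2 * (- ((mcnj (blockC Y) *v v1) \<odot> v2)
        + (N 0 *v (- vsnd (smap a)) + (- mcnj (blockD Y)) *v (vsnd z - s2 0)) \<odot> v2
        + (R 0 *v (- vfst (smap a)) + (- blockA Y) *v (vfst z - s1 0)) \<odot> v1
        + ((vfst z - s1 0) \<odot> (P 0 *v (- vsnd (smap a)) + mcnj (blockB Y) *v (vsnd z - s2 0))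
        + (- vfst (smap a)) \<odot> (P 0 *v (vsnd z - s2 0))))) (at 0)"
      (is "(_ has_vector_derivative ?D) _")
      unfolding E_def
      by (intro has_vector_derivative_add has_vector_derivative_minus has_vector_derivative_mult_right 1 2 dL 3 4 5 6)
    moreover have "?D = E' z"
      by (simp add: E'_def pi_symbol_def at0 mvneg v1_def v2_def cdot_vfst_vsnd[of "vcnj w"] vfst_vcnj vsnd_vcnj
          cdot_add_left cdot_diff_left cdot_minus_left cdot_commute[of "vfst (smap a)"] cdot_commute[of "vsnd (smap a)"] field_simps)
    ultimately show ?thesis by simp
  qed
  have qE: "quot_bounded 2 E"
  proof -
    note qb = quot_bounded_bilinear
    have z1: "quot_bounded 1 (\<lambda>t z. vfst z - s1 t)" and z2: "quot_bounded 1 (\<lambda>t z. vsnd z - s2 t)"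
    proof -
      have "quot_bounded 1 (\<lambda>t z. vfst z + - s1 t)"
        by (intro quot_bounded_add quot_bounded_bounded_linear bounded_linear_vfst quot_bounded_mono[of 0 _ 1]
            quot_bounded_has_vector_derivative[OF has_vector_derivative_minus[OF ds1]]) simp
      then show "quot_bounded 1 (\<lambda>t z. vfst z - s1 t)" by simp
      have "quot_bounded 1 (\<lambda>t z. vsnd z + - s2 t)"
        by (intro quot_bounded_add quot_bounded_bounded_linear bounded_linear_vsnd quot_bounded_mono[of 0 _ 1]
            quot_bounded_has_vector_derivative[OF has_vector_derivative_minus[OF ds2]]) simp
      then show "quot_bounded 1 (\<lambda>t z. vsnd z - s2 t)" by simp
    qed
    have cm: "quot_bounded d (\<lambda>t z. k * f t z)" if "quot_bounded d f" for d k and f :: "real \<Rightarrow> complex^('p+'q) \<Rightarrow> complex"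
      using qb[OF bounded_bilinear_mult quot_bounded_const that] by simp
    have 1: "quot_bounded 0 (\<lambda>t (z::complex^('p+'q)). \<i> * of_real lam * of_real (c t))"
      by (intro cm quot_bounded_has_vector_derivative[OF bl[OF bounded_linear_of_real dc]])
    have 2: "quot_bounded 1 (\<lambda>t z. vcnj (smap (u t)) \<odot> z)"
      using qb[OF bounded_bilinear_cdot quot_bounded_has_vector_derivative[OF bl[OF bounded_linear_vcnj bl[OF bounded_linear_smap du]]]
        quot_bounded_bounded_linear[OF bounded_linear_ident]] by simp
    have n2: "quot_bounded 0 (\<lambda>t (z::complex^('p+'q)). complex_of_real (n t))"
      by (rule quot_bounded_has_vector_derivative[OF bl[OF bounded_linear_of_real dn]])
    have "quot_bounded 1 (\<lambda>t z. of_real lam * (1/2 * (vcnj (smap (u t)) \<odot> z) + (- 1/4) * of_real (n t)))"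
      by (intro cm quot_bounded_add 2 quot_bounded_mono[OF n2]) simp
    then have 2: "quot_bounded 1 (\<lambda>t z. of_real lam * (1/2 * (vcnj (smap (u t)) \<odot> z) - 1/4 * of_real (n t)))" by simp
    have 3: "quot_bounded 0 (\<lambda>t (z::complex^('p+'q)). - ((Q t *v v1) \<odot> v2))"
      by (rule quot_bounded_has_vector_derivative[OF has_vector_derivative_minus[OF
          bl[OF bounded_bilinear.bounded_linear_left[OF bounded_bilinear_cdot]
            bl[OF bounded_bilinear.bounded_linear_left[OF bounded_bilinear_matrix_vector_mult] dQ]]]])
    have 4: "quot_bounded 1 (\<lambda>t z. (N t *v (vsnd z - s2 t)) \<odot> v2)"
      using qb[OF bounded_bilinear_cdot qb[OF bounded_bilinear_matrix_vector_mult quot_bounded_has_vector_derivative[OF dN] z2]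
        quot_bounded_const[of v2]] by simp
    have 5: "quot_bounded 1 (\<lambda>t z. (R t *v (vfst z - s1 t)) \<odot> v1)"
      using qb[OF bounded_bilinear_cdot qb[OF bounded_bilinear_matrix_vector_mult quot_bounded_has_vector_derivative[OF dR] z1]
        quot_bounded_const[of v1]] by simp
    have 6: "quot_bounded 2 (\<lambda>t z. (vfst z - s1 t) \<odot> (P t *v (vsnd z - s2 t)))"
      using qb[OF bounded_bilinear_cdot z1 qb[OF bounded_bilinear_matrix_vector_mult quot_bounded_has_vector_derivative[OF dP] z2]]
      by (simp add: numeral_2_eq_2)
    show ?thesis
      unfolding E_def
      by (intro quot_bounded_add cm 6 quot_bounded_mono[OF 1] quot_bounded_mono[OF 2] quot_bounded_mono[OF 3]
          quot_bounded_mono[OF 4] quot_bounded_mono[OF 5] quot_bounded_mono[OF quot_bounded_has_vector_derivative[OF dL]]) auto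
  qed
  obtain B where B: "\<forall>\<^sub>F t in at 0. \<forall>z. norm (E t z - E 0 z) \<le> B * \<bar>t\<bar> * (1 + norm z)\<^sup>2"
    using quot_boundedE[OF qE] by blast
  have entE: "entire (E t)" for t
    unfolding E_def
    by (intro entire_add entire_mult entire_const entire_diff entire_minus entire_cdot entire_matrix_vector_mult;
        (simp only: vector_minus_component vfst_nth vsnd_nth)?; (intro entire_diff entire_const entire_nth)?)
  have tE': "tame E'"
    unfolding E'_def by (rule tame_pi_symbol)
  have lim: "((\<lambda>t. fock_nrm2 lam (\<lambda>z. (exp (E t z) - exp (E 0 z)) / of_real t - E' z * exp (E 0 z))) \<longlongrightarrow> 0) (at 0)"
  proof (rule fock_derivative_exp[OF lam B _ dE])
    fix z
    \<comment> \<open>The bound on \<open>E 0\<close> contained in \<open>quot_bounded 2\<close> is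
      only quadratic; the linear one comes from the explicit form of \<open>E 0\<close>.\<close>
    have "norm (E 0 z) \<le> lam / 2 * (norm w * norm z)"
      using norm_cdot_le[of "vcnj w" z] lam by (simp add: E0 norm_mult norm_divide)
    also have "\<dots> \<le> lam / 2 * norm w * (1 + norm z)"
      using lam by (simp add: algebra_simps)
    finally show "norm (E 0 z) \<le> lam / 2 * norm w * (1 + norm z)" .
  qed (use entE tE' in \<open>auto intro: entire_borel_measurable tame_measurable always_eventually\<close>)
  define q where "q t z = (ext_harm lam (lie_exp Gpq G_mult (t *\<^sub>R ?X)) (coh lam w) z - coh lam w z) / of_real t" for t z
  define g where "g z = E' z * coh lam w z" for z
  have qe: "\<forall>\<^sub>F t in at 0. q t = (\<lambda>z. (exp (E t z) - exp (E 0 z)) / of_real t)"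
    using expE by eventually_elim (simp only: q_def[abs_def] lie_exp_Gpq[OF \<gamma>] expE0)
  have qm: "\<forall>\<^sub>F t in at 0. q t \<in> borel_measurable borel"
    using qe
  proof eventually_elim
    case (elim t)
    have [measurable]: "E t \<in> borel_measurable borel" "E 0 \<in> borel_measurable borel"
      using entE by (auto intro: entire_borel_measurable)
    show ?case unfolding elim by measurable
  qed
  have tg: "tame g" unfolding g_def by (intro tame_mult tE' tame_coh lam)
  have qlim: "((\<lambda>t. fock_nrm2 lam (\<lambda>z. q t z - g z)) \<longlongrightarrow> 0) (at 0)"
  proof (rule Lim_transform_eventually[OF lim])
    show "\<forall>\<^sub>F t in at 0. fock_nrm2 lam (\<lambda>z. (exp (E t z) - exp (E 0 z)) / of_real t - E' z * exp (E 0 z)) = fock_nrm2 lam (\<lambda>z. q t z - g z)"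
      using qe by eventually_elim (simp add: g_def expE0)
  qed
  have "d_ext_harm lam ?X (coh lam w) = g"
    unfolding d_ext_harm_def q_def[symmetric]
  proof (rule the_equality)
    show "g \<in> fock lam \<and> ((\<lambda>t. fock_nrm2 lam (\<lambda>z. q t z - g z)) \<longlongrightarrow> 0) (at 0)"
      using tame_fock[OF tg lam] qlim by simp
    fix h assume h: "h \<in> fock lam \<and> ((\<lambda>t. fock_nrm2 lam (\<lambda>z. q t z - h z)) \<longlongrightarrow> 0) (at 0)"
    show "h = g"
      using h tg by (intro fock_limit_unique[OF lam _ _ qm _ qlim]) (auto simp: fock_def tame_def)
  qed
  then show ?thesis by (simp add: g_def[abs_def] E'_def)
qed

section \<open>Second moments and the symbols\<close>

text \<open>Phrasing the moments with \<open>has_bochner_integral\<close> carries integrability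
  along with the value, so the Weyl integrand can be treated summand by summand.\<close>

lemma has_bochner_integral_dm_gauss:
  fixes F :: "complex^'n \<Rightarrow> complex"
  assumes "F \<in> borel_measurable borel" "gauss_bounded a F" "a < \<mu> / 2" "\<mu> > 0"
  shows "has_bochner_integral (dm \<mu>) (\<lambda>w. F w * of_real (gauss \<mu> w)) (\<integral>w. F w * of_real (gauss \<mu> w) \<partial>dm \<mu>)"
  using integrable_gauss_bounded[OF assms(1-3)] assms
  by (intro has_bochner_integral_integrable) (subst integral_dm(2), auto)

lemma has_bochner_integral_tame:
  fixes F :: "complex^'n \<Rightarrow> complex"
  assumes F: "tame F" and \<mu>: "\<mu> > 0"
  shows "has_bochner_integral (dm \<mu>) (\<lambda>w. F w * of_real (gauss \<mu> w)) (F 0)"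
  using has_bochner_integral_dm_gauss[OF tame_measurable[OF F], of 0 \<mu>] gaussian_mean_value[of F 0 \<mu>] F \<mu>
  by (simp add: tame_def)

text \<open>Conjugation is a real-linear isometry preserving the Gaussian, which reduces the
  antiholomorphic case to the holomorphic one.\<close>

lemma has_bochner_integral_tame_vcnj:
  fixes F :: "complex^'n \<Rightarrow> complex"
  assumes F: "tame F" and \<mu>: "\<mu> > 0"
  shows "has_bochner_integral (dm \<mu>) (\<lambda>w. F (vcnj w) * of_real (gauss \<mu> w)) (F 0)"
proof -
  have vm: "vcnj \<in> borel_measurable borel"
    by (intro borel_measurable_continuous_onI linear_continuous_on bounded_linear_vcnj)
  have d: "distr lborel borel vcnj = (lborel :: (complex^'n) measure)"
    by (rule lborel_distr_isometry) (simp_all add: bounded_linear.linear[OF bounded_linear_vcnj])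
  have gm: "gauss \<mu> \<in> borel_measurable borel" by (rule gauss_measurable)
  have Fm: "F \<in> borel_measurable borel" by (rule tame_measurable[OF F])
  have m: "(\<lambda>w. F w * of_real (gauss \<mu> w)) \<in> borel_measurable borel"
    using Fm gm by measurable
  have m': "(\<lambda>w. F (vcnj w) * of_real (gauss \<mu> w)) \<in> borel_measurable borel"
    using measurable_compose[OF vm Fm] gm by measurable
  have g: "gauss \<mu> (vcnj w) = gauss \<mu> w" for w :: "complex^'n" by (simp add: gauss_def)
  note hb = has_bochner_integral_tame[OF F \<mu>, unfolded has_bochner_integral_iff]
  have "integrable lborel (\<lambda>w. F w * of_real (gauss \<mu> w))"
    using hb integral_dm(2)[OF \<mu> m] by blast
  then have i: "integrable lborel (\<lambda>w. F (vcnj w) * of_real (gauss \<mu> w))"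
    by (subst (asm) d[symmetric], subst (asm) integrable_distr_eq) (use vm m g in auto)
  have "(\<integral>w. F w * of_real (gauss \<mu> w) \<partial>lborel) = (\<integral>w. F (vcnj w) * of_real (gauss \<mu> w) \<partial>lborel)"
    by (subst d[symmetric], subst integral_distr) (use vm m g in auto)
  then show ?thesis
    using hb i by (simp add: has_bochner_integral_iff integral_dm[OF \<mu> m] integral_dm[OF \<mu> m'])
qed

text \<open>Differentiating the reproducing identity for the coordinate \<open>w $ i\<close> at the point \<open>0\<close> in the
  direction \<open>axis j 1\<close>.\<close>

lemma has_bochner_integral_gauss_covariance:
  fixes i j :: "'n::finite"
  assumes \<mu>: "\<mu> > 0"
  shows "has_bochner_integral (dm \<mu>) (\<lambda>w::complex^'n. w $ i * cnj (w $ j) * of_real (gauss \<mu> w))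
    (if i = j then of_real (2 / \<mu>) else 0)"
proof -
  \<comment> \<open>The logarithmic derivative at 0, in the direction \<open>axis j 1\<close>, of
    the conjugated coherent state.\<close>
  define y where "y w = of_real (\<mu> / 2) * cnj (w $ j)" for w :: "complex^'n"
  \<comment> \<open>Positive step sizes tending to 0 and at most 1; the bound 1 makes the majorant
    \<open>D\<close> independent of k.\<close>
  define X where "X k = inverse (real (Suc k))" for k
  define s where "s k w = w $ i * ((exp (of_real (X k) * y w) - 1) / of_real (X k)) * of_real (gauss \<mu> w)" for k w
  define f where "f w = w $ i * y w * of_real (gauss \<mu> w)" for w
  \<comment> \<open>The exponent collects one \<open>norm w\<close> from the coordinate
    \<open>w $ i\<close>, one from \<open>y w\<close>, both estimated by
    \<open>exp (norm w)\<close>, and \<open>\<mu> / 2 * norm w\<close> from the exponential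
    factor.\<close>
  define D where "D w = \<mu> / 2 * exp ((2 + \<mu> / 2) * norm w) * gauss \<mu> w" for w :: "complex^'n"
  have X: "X k > 0" "X k \<le> 1" for k by (simp_all add: X_def field_simps)
  have X0: "X \<longlonglongrightarrow> 0" unfolding X_def by (rule LIMSEQ_inverse_real_of_nat)
  have nthm[measurable]: "(\<lambda>w::complex^'n. w $ l) \<in> borel_measurable borel" for l
    by (rule tame_measurable[OF tame_nth])
  have [measurable]: "(cnj :: complex \<Rightarrow> complex) \<in> borel_measurable borel"
    by (intro borel_measurable_continuous_onI continuous_intros)
  have ym[measurable]: "y \<in> borel_measurable borel" unfolding y_def by measurable
  have ynorm: "norm (y w) \<le> \<mu> / 2 * norm w" for w
    using \<mu> Finite_Cartesian_Product.norm_nth_le[of w j] by (simp add: y_def norm_mult)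
  have lim: "(\<lambda>k. s k w) \<longlonglongrightarrow> f w" for w
  proof -
    have "((\<lambda>h. exp (of_real h * y w)) has_vector_derivative (1 * y w) * exp (of_real 0 * y w)) (at 0)"
      using field_vector_diff_chain_at[of "\<lambda>h. of_real h * y w" "1 * y w" 0 exp "exp (of_real 0 * y w)"]
        has_vector_derivative_mult_left[OF bounded_linear.has_vector_derivative[OF bounded_linear_of_real has_vector_derivative_id], of "y w"]
        DERIV_exp[of "0::complex"]
      by (simp add: o_def)
    from has_vector_derivative_quotient[OF this]
    have "((\<lambda>h. (exp (of_real h * y w) - 1) /\<^sub>R h) \<longlongrightarrow> y w) (at 0)" by simp
    then have "(\<lambda>k. (exp (of_real (X k) * y w) - 1) /\<^sub>R X k) \<longlonglongrightarrow> y w"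
      using X0 X(1) unfolding tendsto_at_iff_sequentially by (auto simp: o_def less_imp_neq[symmetric])
    then have "(\<lambda>k. w $ i * ((exp (of_real (X k) * y w) - 1) /\<^sub>R X k) * of_real (gauss \<mu> w)) \<longlonglongrightarrow> w $ i * y w * of_real (gauss \<mu> w)"
      by (intro tendsto_intros)
    then show ?thesis by (simp add: s_def f_def scaleR_conv_of_real divide_inverse mult.commute)
  qed
  have bound: "norm (s k w) \<le> D w" for k w
  proof -
    have "norm (exp (of_real (X k) * y w) - 1) \<le> X k * norm (y w) * exp (X k * norm (y w))"
      using norm_exp_diff_le[of "of_real (X k) * y w" 0] X(1)[of k] by (simp add: norm_mult)
    also have "\<dots> \<le> X k * (\<mu> / 2 * norm w) * exp (\<mu> / 2 * norm w)"
    proof -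
      have "X k * norm (y w) \<le> 1 * (\<mu> / 2 * norm w)"
        using X[of k] ynorm[of w] by (intro mult_mono) auto
      then show ?thesis
        using X(1)[of k] ynorm[of w] \<mu> by (intro mult_mono) auto
    qed
    finally have "norm ((exp (of_real (X k) * y w) - 1) / of_real (X k)) \<le> (\<mu> / 2 * norm w) * exp (\<mu> / 2 * norm w)"
      using X(1)[of k] by (simp add: norm_divide field_simps)
    then have "norm (s k w) \<le> norm w * ((\<mu> / 2 * norm w) * exp (\<mu> / 2 * norm w)) * gauss \<mu> w"
      unfolding s_def norm_mult using Finite_Cartesian_Product.norm_nth_le[of w i] \<mu>
      by (intro mult_mono) (auto simp: gauss_def)
    also have "\<dots> \<le> exp (norm w) * ((\<mu> / 2 * exp (norm w)) * exp (\<mu> / 2 * norm w)) * gauss \<mu> w"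
      using \<mu> le_exp_self[of "norm w"] by (intro mult_mono mult_left_mono) (auto simp: gauss_def)
    also have "\<dots> = D w"
      by (simp add: D_def exp_add[symmetric] algebra_simps)
    finally show ?thesis .
  qed
  have "gauss_bounded 0 (\<lambda>w::complex^'n. complex_of_real (\<mu> / 2 * exp ((2 + \<mu> / 2) * norm w)))"
    using \<mu> by (intro gauss_boundedI[of _ "\<mu> / 2" _ "2 + \<mu> / 2"]) (simp add: norm_mult norm_divide)
  then have "integrable (dm \<mu>) (\<lambda>w::complex^'n. complex_of_real (\<mu> / 2 * exp ((2 + \<mu> / 2) * norm w)) * of_real (gauss \<mu> w))"
    using \<mu> has_bochner_integral_dm_gauss[of "\<lambda>w::complex^'n. complex_of_real (\<mu> / 2 * exp ((2 + \<mu> / 2) * norm w))" 0 \<mu>]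
    by (auto simp: has_bochner_integral_iff)
  then have "integrable (dm \<mu>) (\<lambda>w. norm (complex_of_real (\<mu> / 2 * exp ((2 + \<mu> / 2) * norm w)) * of_real (gauss \<mu> (w::complex^'n))))"
    by (rule integrable_norm)
  then have Di: "integrable (dm \<mu>) D"
    using \<mu> by (simp add: D_def[abs_def] norm_mult norm_divide gauss_def)
  have sm: "s k \<in> borel_measurable (dm \<mu>)" for k unfolding s_def by measurable
  have fm: "f \<in> borel_measurable (dm \<mu>)" unfolding f_def by measurable
  have dc: "integrable (dm \<mu>) f" "(\<lambda>k. \<integral>w. s k w \<partial>dm \<mu>) \<longlonglongrightarrow> (\<integral>w. f w \<partial>dm \<mu>)"
  proof -
    show "integrable (dm \<mu>) f"
      by (rule integrable_dominated_convergence[where s=s, OF fm sm Di]) (simp_all add: lim bound)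
    show "(\<lambda>k. \<integral>w. s k w \<partial>dm \<mu>) \<longlonglongrightarrow> (\<integral>w. f w \<partial>dm \<mu>)"
      by (rule integral_dominated_convergence[where s=s, OF fm sm Di]) (simp_all add: lim bound)
  qed
  \<comment> \<open>The integrals do not depend on k: by the reproducing property each is a
    difference quotient of the linear function \<open>x $ i\<close> along
    \<open>axis j\<close>.\<close>
  have "(\<integral>w. s k w \<partial>dm \<mu>) = (if i = j then 1 else 0)" for k
  proof -
    have rep: "(\<integral>w. w $ i * cnj (coh \<mu> x w) * of_real (gauss \<mu> w) \<partial>dm \<mu>) = x $ i" for x :: "complex^'n"
      using tame_reproducing[OF tame_nth \<mu>, of i x] by (simp add: fock_inner_def)
    have int: "integrable (dm \<mu>) (\<lambda>w. w $ i * cnj (coh \<mu> x w) * of_real (gauss \<mu> w))" for x :: "complex^'n"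
    proof -
      have "gauss_bounded 0 (\<lambda>w. w $ i * cnj (coh \<mu> x w))"
        using gauss_bounded_mult[OF gauss_bounded_nth[of i], of 0 "coh \<mu> x"] tame_coh[OF \<mu>, of x]
        by (simp add: tame_def gauss_bounded_def norm_mult)
      moreover have "(\<lambda>w. w $ i * cnj (coh \<mu> x w)) \<in> borel_measurable borel"
        using tame_measurable[OF tame_coh[OF \<mu>, of x]] by measurable
      ultimately show ?thesis
        using has_bochner_integral_dm_gauss[of "\<lambda>w. w $ i * cnj (coh \<mu> x w)" 0 \<mu>] \<mu>
        by (auto simp: has_bochner_integral_iff)
    qed
    define x where "x = axis j (complex_of_real (X k))"
    have cx: "cnj (coh \<mu> x w) = exp (of_real (X k) * y w)" and c0: "coh \<mu> 0 w = 1" for w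
    proof -
      have "vcnj x = x" by (simp add: x_def vec_eq_iff axis_def)
      then show "cnj (coh \<mu> x w) = exp (of_real (X k) * y w)"
        by (simp add: coh_def x_def y_def exp_cnj mult_ac)
    qed (simp add: coh_def)
    have "s k w = (w $ i * cnj (coh \<mu> x w) * of_real (gauss \<mu> w) - w $ i * cnj (coh \<mu> 0 w) * of_real (gauss \<mu> w)) / of_real (X k)" for w
      by (simp add: s_def cx c0 diff_divide_distrib algebra_simps)
    then have "(\<integral>w. s k w \<partial>dm \<mu>) = (x $ i - (0::complex^'n) $ i) / of_real (X k)"
      by (simp only: integral_divide_zero Bochner_Integration.integral_diff[OF int int] rep)
    then show ?thesis using X(1)[of k] by (simp add: x_def axis_def)
  qed
  with dc(2) have "(\<integral>w. f w \<partial>dm \<mu>) = (if i = j then 1 else 0)"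
    by (simp add: LIMSEQ_const_iff)
  with dc(1) have "has_bochner_integral (dm \<mu>) f (if i = j then 1 else 0)"
    by (simp add: has_bochner_integral_iff)
  from has_bochner_integral_mult_right[of "of_real (2 / \<mu>)", OF this] \<mu>
  show ?thesis by (simp add: f_def y_def field_simps if_distrib cong: if_cong)
qed

section \<open>Evaluation of the Berezin and Weyl symbols\<close>

lemma berezin_symbol_eq:
  assumes lam: "lam > 0" and T: "T (coh lam z) = (\<lambda>x. f x * coh lam z x)" and f: "tame f"
  shows "berezin_symbol lam T z = f z"
proof -
  have "fock_inner lam (\<lambda>x. f x * coh lam z x) (coh lam z) = f z * coh lam z z"
    by (rule tame_reproducing[OF tame_mult[OF f tame_coh[OF lam]] lam])
  moreover have "fock_inner lam (coh lam z) (coh lam z) = coh lam z z"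
    by (rule tame_reproducing[OF tame_coh[OF lam] lam])
  moreover have "coh lam z z \<noteq> 0" by (simp add: coh_def)
  ultimately show ?thesis by (simp add: berezin_symbol_def T)
qed

text \<open>Distinct coordinates are uncorrelated, so only the diagonal of \<open>M\<close>
  survives. The injection \<open>\<iota>\<close> selects a block of coordinates; it is used as
  \<open>Inl\<close> with \<open>vfst\<close> and as \<open>Inr\<close> with
  \<open>vsnd\<close>.\<close>

lemma has_bochner_integral_gauss_form:
  fixes M :: "complex^'m^'m" and \<iota> :: "'m \<Rightarrow> 'n::finite"
  assumes \<mu>: "\<mu> > 0" and "inj \<iota>"
    and p: "\<And>w::complex^'n. \<And>i. p w $ i = w $ \<iota> i"
  shows "has_bochner_integral (dm \<mu>) (\<lambda>w. ((M *v p w) \<odot> vcnj (p w)) * of_real (gauss \<mu> w)) (of_real (2 / \<mu>) * trace M)"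
proof -
  have "has_bochner_integral (dm \<mu>)
      (\<lambda>w. \<Sum>i\<in>UNIV. \<Sum>j\<in>UNIV. M $ i $ j * (w $ \<iota> j * cnj (w $ \<iota> i) * of_real (gauss \<mu> w)))
      (\<Sum>i\<in>UNIV. \<Sum>j\<in>UNIV. M $ i $ j * (if \<iota> j = \<iota> i then of_real (2 / \<mu>) else 0))"
    by (intro has_bochner_integral_sum has_bochner_integral_mult_right has_bochner_integral_gauss_covariance \<mu>)
  moreover have "(\<Sum>j\<in>UNIV. M $ i $ j * (if \<iota> j = \<iota> i then of_real (2 / \<mu>) else 0)) = of_real (2 / \<mu>) * M $ i $ i" for i
    using \<open>inj \<iota>\<close> by (simp add: inj_eq if_distrib[of "\<lambda>x. _ * x"] cong: if_cong)
  moreover have "(\<lambda>w. \<Sum>i\<in>UNIV. \<Sum>j\<in>UNIV. M $ i $ j * (w $ \<iota> j * cnj (w $ \<iota> i) * of_real (gauss \<mu> w)))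
      = (\<lambda>w. ((M *v p w) \<odot> vcnj (p w)) * of_real (gauss \<mu> w))"
    by (simp add: fun_eq_iff cdot_def matrix_vector_mult_def p sum_distrib_right sum_distrib_left mult_ac)
  ultimately show ?thesis
    by (simp add: trace_def sum_distrib_left)
qed

text \<open>The weight \<open>exp (- lam * (norm w)^2)\<close> is the Gaussian of parameter
  \<open>2 * lam\<close>, and the prefactor \<open>2 ^ CARD('n)\<close> is the ratio of the
  densities of \<open>dm (2 * lam)\<close> and \<open>dm lam\<close>.\<close>

lemma weyl_symbol_eq:
  fixes T :: "('n::finite) operator"
  assumes lam: "lam > 0" and T: "\<And>w. T (coh lam w) = (\<lambda>x. f x (vcnj w) * coh lam w x)" and f: "\<And>v. tame (\<lambda>x. f x v)"
    and int: "has_bochner_integral (dm (2 * lam)) (\<lambda>w. f (z + w) (vcnj (z - w)) * of_real (gauss (2 * lam) w)) I"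
  shows "weyl_symbol lam T z = I"
proof -
  define F where "F w = kernel lam T (z + w) (z - w) *
          exp (of_real lam / 2 * (- (z \<odot> vcnj z) - w \<odot> vcnj w + z \<odot> vcnj w - vcnj z \<odot> w))" for w
  have F_eq: "F w = f (z + w) (vcnj (z - w)) * of_real (gauss (2 * lam) w)" for w
  proof -
    have "kernel lam T (z + w) (z - w) = f (z + w) (vcnj (z - w)) * coh lam (z - w) (z + w)"
      unfolding kernel_def T by (rule tame_reproducing[OF tame_mult[OF f tame_coh[OF lam]] lam])
    moreover have "coh lam (z - w) (z + w) * exp (of_real lam / 2 * (- (z \<odot> vcnj z) - w \<odot> vcnj w + z \<odot> vcnj w - vcnj z \<odot> w))
      = of_real (gauss (2 * lam) w)"
    proof -
      have "of_real (gauss (2 * lam) w) = exp (- of_real lam * (w \<odot> vcnj w))"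
        by (simp add: gauss_def cdot_vcnj_self exp_of_real[symmetric])
      then show ?thesis
        unfolding coh_def exp_add[symmetric]
        by (simp only:) (rule arg_cong[where f=exp], simp add: vcnj_diff cdot_diff_left cdot_add_right
            cdot_commute[of "vcnj z"] cdot_commute[of "vcnj w"] field_simps)
    qed
    ultimately show ?thesis by (simp add: F_def mult.assoc)
  qed
  then have hb: "has_bochner_integral (dm (2 * lam)) F I"
    using int by (simp only: F_eq[abs_def])
  then have m: "F \<in> borel_measurable borel"
    using has_bochner_integral_integrable[of "dm (2 * lam)" F] by (auto simp: has_bochner_integral_iff dest: borel_measurable_integrable)
  have "(2 * lam / (2 * pi)) ^ CARD('n) = 2 ^ CARD('n) * (lam / (2 * pi)) ^ CARD('n)"
    by (simp add: power_mult_distrib[symmetric])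
  then have "(\<integral>w. F w \<partial>dm (2 * lam)) = 2 ^ CARD('n) * (\<integral>w. F w \<partial>dm lam)"
    using lam by (simp add: integral_dm(1)[OF _ m] scaleR_conv_of_real mult.assoc)
  with hb show ?thesis
    by (simp add: weyl_symbol_def F_def has_bochner_integral_iff)
qed

text \<open>Conjugating \<open>z - w\<close> turns the sign of the mixed terms in w and
  \<open>vcnj w\<close> positive. For parameter \<open>2 * lam\<close> the variance of a coordinate
  is \<open>1 / lam\<close>, which multiplied by the coefficient \<open>lam / 2\<close> gives the
  factor 1/2 in front of the traces.\<close>

lemma has_bochner_integral_pi_symbol:
  assumes lam: "lam > 0"
  shows "has_bochner_integral (dm (2 * lam))
    (\<lambda>w. pi_symbol lam a c0 Y (z + w) (vcnj (z - w)) * of_real (gauss (2 * lam) w))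
    (pi_symbol lam a c0 Y z (vcnj z) + (trace (mcnj (blockD Y)) + trace (blockA Y)) / 2)"
proof -
  let ?A = "blockA Y" let ?B = "mcnj (blockB Y)" let ?C = "mcnj (blockC Y)" let ?D = "mcnj (blockD Y)"
  \<comment> \<open>\<open>T\<close> collects the terms in w alone and \<open>U\<close> those in
    \<open>vcnj w\<close> alone, including the purely quadratic ones. Both vanish at 0, hence
    average to 0.\<close>
  define T where "T w = of_real lam / 2 * (vcnj (smap a) \<odot> w)
    - of_real lam / 2 * ((?D *v vsnd w) \<odot> vcnj (vsnd z) + (?A *v vfst w) \<odot> vcnj (vfst z)
        - vfst z \<odot> (?B *v vsnd w) - vfst w \<odot> (?B *v vsnd z) - vfst w \<odot> (?B *v vsnd w))" for w
  define U where "U v = of_real lam / 2 * (v \<odot> smap a)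
    - of_real lam / 2 * ((?C *v vfst v) \<odot> vsnd v - (?C *v vfst v) \<odot> vcnj (vsnd z)
        - (?C *v vcnj (vfst z)) \<odot> vsnd v - (?D *v vsnd z) \<odot> vsnd v - (?A *v vfst z) \<odot> vfst v)" for v
  have expand: "pi_symbol lam a c0 Y (z + w) (vcnj (z - w)) = pi_symbol lam a c0 Y z (vcnj z) + T w + U (vcnj w)
      + of_real lam / 2 * ((?D *v vsnd w) \<odot> vcnj (vsnd w) + (?A *v vfst w) \<odot> vcnj (vfst w))" for w
    by (simp add: pi_symbol_def T_def U_def vfst_add vsnd_add vcnj_diff vfst_diff vsnd_diff vfst_vcnj vsnd_vcnj
        matrix_vector_right_distrib matrix_vector_mult_diff_distrib cdot_add_left cdot_add_right
        cdot_diff_left cdot_diff_right algebra_simps)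
  have tT: "tame T" and tU: "tame U"
    unfolding T_def U_def
    by (intro tame_add tame_diff tame_mult tame_const tame_cdot tame_matrix_vector_mult;
        (simp only: vfst_nth vsnd_nth)?; (rule tame_const tame_nth)?)+
  have T0: "T 0 = 0" and U0: "U 0 = 0" by (simp_all add: T_def U_def)
  have lam2: "2 * lam > 0" using lam by simp
  note hD = has_bochner_integral_gauss_form[OF lam2, of Inr vsnd, OF _ vsnd_nth, of ?D]
  note hA = has_bochner_integral_gauss_form[OF lam2, of Inl vfst, OF _ vfst_nth, of ?A]
  have integrand: "pi_symbol lam a c0 Y (z + w) (vcnj (z - w)) * of_real (gauss (2 * lam) w) =
      pi_symbol lam a c0 Y z (vcnj z) * of_real (gauss (2 * lam) w) + T w * of_real (gauss (2 * lam) w)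
      + U (vcnj w) * of_real (gauss (2 * lam) w)
      + of_real lam / 2 * (((?D *v vsnd w) \<odot> vcnj (vsnd w)) * of_real (gauss (2 * lam) w)
        + ((?A *v vfst w) \<odot> vcnj (vfst w)) * of_real (gauss (2 * lam) w))" for w
    by (simp only: expand distrib_right distrib_left mult.assoc)
  have traces: "of_real lam / 2 * (of_real (2 / (2 * lam)) * trace ?D + of_real (2 / (2 * lam)) * trace ?A)
      = (trace ?D + trace ?A) / 2"
    using lam by (simp add: field_simps)
  have "has_bochner_integral (dm (2 * lam))
    (\<lambda>w. pi_symbol lam a c0 Y z (vcnj z) * of_real (gauss (2 * lam) w) + T w * of_real (gauss (2 * lam) w)
      + U (vcnj w) * of_real (gauss (2 * lam) w)
      + of_real lam / 2 * (((?D *v vsnd w) \<odot> vcnj (vsnd w)) * of_real (gauss (2 * lam) w)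
        + ((?A *v vfst w) \<odot> vcnj (vfst w)) * of_real (gauss (2 * lam) w)))
    (pi_symbol lam a c0 Y z (vcnj z) + T 0 + U 0
      + of_real lam / 2 * (of_real (2 / (2 * lam)) * trace ?D + of_real (2 / (2 * lam)) * trace ?A))"
    by (intro has_bochner_integral_add has_bochner_integral_mult_right hD hA
        has_bochner_integral_tame[OF tT lam2] has_bochner_integral_tame_vcnj[OF tU lam2]
        has_bochner_integral_tame[OF tame_const lam2]) auto
  then show ?thesis
    by (simp only: integrand traces T0 U0 add_0_right)
qed

theorem proposition5p4:
  fixes lam c0 :: real
    and A :: "complex^'p::finite^'p" and B :: "complex^'q::finite^'p"
    and C :: "complex^'p^'q" and D :: "complex^'q^'q"
    and z0 :: "complex^('p + 'q)"
    and z1 :: "complex^'p" and z2 :: "complex^'q"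
  assumes "lam > 0"
    and "mblock A B C D \<in> supq"
  shows "berezin_symbol lam (d_ext_harm lam ((z0, vcnj z0), c0, mblock A B C D)) (vjoin z1 z2) =
      of_real lam / 2 * (vcnj (smap z0) \<odot> vjoin z1 z2 - vcnj (vjoin z1 z2) \<odot> smap z0)
      + \<i> * of_real lam * of_real c0 - trace A
      - of_real lam / 2 * ((mcnj C *v vcnj z1) \<odot> vcnj z2 + (mcnj D *v z2) \<odot> vcnj z2
          + (A *v z1) \<odot> vcnj z1 - z1 \<odot> (mcnj B *v z2))
    \<and> weyl_symbol lam (d_ext_harm lam ((z0, vcnj z0), c0, mblock A B C D)) (vjoin z1 z2) =
      of_real lam / 2 * (vcnj (smap z0) \<odot> vjoin z1 z2 - vcnj (vjoin z1 z2) \<odot> smap z0)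
      + \<i> * of_real lam * of_real c0
      - of_real lam / 2 * ((mcnj C *v vcnj z1) \<odot> vcnj z2 + (mcnj D *v z2) \<odot> vcnj z2
          + (A *v z1) \<odot> vcnj z1 - z1 \<odot> (mcnj B *v z2))"
proof -
  let ?Y = "mblock A B C D" and ?z = "vjoin z1 z2"
  let ?T = "d_ext_harm lam ((z0, vcnj z0), c0, ?Y)"
  have blocks: "blockA ?Y = A" "blockB ?Y = B" "blockC ?Y = C" "blockD ?Y = D"
    by (simp_all add: vec_eq_iff blockA_def blockB_def blockC_def blockD_def)
  have symbol: "pi_symbol lam z0 c0 ?Y ?z (vcnj ?z) =
      of_real lam / 2 * (vcnj (smap z0) \<odot> ?z - vcnj ?z \<odot> smap z0)
      + \<i> * of_real lam * of_real c0 - trace A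
      - of_real lam / 2 * ((mcnj C *v vcnj z1) \<odot> vcnj z2 + (mcnj D *v z2) \<odot> vcnj z2
          + (A *v z1) \<odot> vcnj z1 - z1 \<odot> (mcnj B *v z2))"
    by (simp add: pi_symbol_def blocks vfst_vcnj vsnd_vcnj)
  have T: "?T (coh lam w) = (\<lambda>x. pi_symbol lam z0 c0 ?Y x (vcnj w) * coh lam w x)" for w
    by (rule d_ext_harm_coh[OF assms])
  have "berezin_symbol lam ?T ?z = pi_symbol lam z0 c0 ?Y ?z (vcnj ?z)"
    by (rule berezin_symbol_eq[where f="\<lambda>x. pi_symbol lam z0 c0 ?Y x (vcnj ?z)", OF assms(1)])
      (rule T tame_pi_symbol)+
  \<comment> \<open>By \<open>supq_trace\<close> the two half traces add up to
    \<open>trace A\<close>, which cancels the term \<open>- trace A\<close> of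
    \<open>pi_symbol\<close>.\<close>
  moreover have "weyl_symbol lam ?T ?z = pi_symbol lam z0 c0 ?Y ?z (vcnj ?z) + trace A"
    using weyl_symbol_eq[where f="pi_symbol lam z0 c0 ?Y", OF assms(1) T tame_pi_symbol has_bochner_integral_pi_symbol[OF assms(1)], of ?z]
    by (simp add: blocks supq_trace[OF assms(2)])
  ultimately show ?thesis
    by (simp add: symbol)
qed

end
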